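(* For any $p_o, p_v \in [0,1]$ and for any law $\mathcal{L}$ on $\mathbb{R}$ with $\mathcal{L}\neq\delta_0$, the constant $M_c(p_o,p_v;\mathcal{L})$ is finite.
   Context: **Lattice and paths.** The square lattice is the graph $(\mathbb{Z}^2,E_2)$, where $E_2$ is the set of unordered pairs $\{(x_1,y_1),(x_2,y_2)\}$ of points of $\mathbb{Z}^2$ with $|x_1-x_2|+|y_1-y_2|=1$. An edge is horizontal if $|x_1-x_2|=1$ and vertical if $|y_1-y_2|=1$. An infinite path from $v_0\in\mathbb{Z}^2$ is an infinite sequence $\gamma=(v_0,e_1,v_1,e_2,v_2,\ldots)$ with $v_k\in\mathbb{Z}^2$ and $e_k=\{v_{k-1},v_k\}\in E_2$ for all $k\ge 1$. It is self-avoiding if all its vertices are different. For $\mathbf{b}\in\mathbb{Z}^2$, $\Gamma_{\mathbf{b}}$ is the set of infinite self-avoiding paths starting from $\mathbf{b}$. **Random environment.** $\mathbf{X}=(X_e:e\in E_2)$ and $\mathbf{Y}=(Y_e:e\in E_2)$ are two families of independent random variables, $\mathbf{X}$ and $\mathbf{Y}$ being independent of each other. Each $X_e$ is real-valued with common law $\mathcal{L}\neq\delta_0$. Each $Y_e$ takes values in $\{-1,+1\}$, with $\mathbb{P}(Y_e=1)=p_o$ if $e$ is horizontal and $\mathbb{P}(Y_e=1)=p_v$ if $e$ is vertical. **Partial sums.** For a path $\gamma=(v_0,e_1,v_1,\ldots)$ with $v_k=(x_k,y_k)$, set $Z_{(v_{k-1},v_k)}=(x_k-x_{k-1}+y_k-y_{k-1})\,Y_{e_k}$,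 so that $Y_{e_k}$ is multiplied by $+1$ if $e_k$ is crossed rightward or upward and by $-1$ if it is crossed leftward or downward. Set $S_N(\gamma)=\sum_{k=1}^N Z_{(v_{k-1},v_k)}X_{e_k}$. **The constant $M_c$.** For $\mathbf{b}\in\mathbb{Z}^2$ let $\Sigma(\mathbf{b})=\inf_{\gamma\in\Gamma_{\mathbf{b}}}\sup_{N\in\mathbb{N}}|S_N(\gamma)|\in[0,+\infty]$. Its law does not depend on $\mathbf{b}$. Define $M_c=M_c(p_o,p_v;\mathcal{L})$ as the infimum of the positive values $t$ such that $\mathbb{P}(\Sigma(\mathbf{b})\le t)>0$, with $M_c=+\infty$ if no such $t$ exists. *)

theory Defs
  imports "HOL-Probability.Probability"
begin

type_synonym vertex = "int \<times> int"
type_synonym edge = "vertex set"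

definition E2 :: "edge set" where
  "E2 = {{(x1, y1), (x2, y2)} | x1 y1 x2 y2. \<bar>x1 - x2\<bar> + \<bar>y1 - y2\<bar> = 1}"

definition horizontal :: "edge \<Rightarrow> bool" where
  "horizontal e \<longleftrightarrow> e \<in> E2 \<and> (\<exists>x1 y1 x2 y2. e = {(x1, y1), (x2, y2)} \<and> \<bar>x1 - x2\<bar> = 1)"

definition vertical :: "edge \<Rightarrow> bool" where
  "vertical e \<longleftrightarrow> e \<in> E2 \<and> (\<exists>x1 y1 x2 y2. e = {(x1, y1), (x2, y2)} \<and> \<bar>y1 - y2\<bar> = 1)"

(* An infinite path is given by its vertices v_0, v_1, ...; the edges e_k = {v_(k-1), v_k}
   are determined by them. *)

definition infinite_path :: "vertex \<Rightarrow> (nat \<Rightarrow> vertex) \<Rightarrow> bool" where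
  "infinite_path b \<gamma> \<longleftrightarrow> \<gamma> 0 = b \<and> (\<forall>k\<ge>1. {\<gamma> (k - 1), \<gamma> k} \<in> E2)"

definition self_avoiding :: "(nat \<Rightarrow> vertex) \<Rightarrow> bool" where
  "self_avoiding \<gamma> \<longleftrightarrow> inj \<gamma>"

definition \<Gamma> :: "vertex \<Rightarrow> (nat \<Rightarrow> vertex) set" where
  "\<Gamma> b = {\<gamma>. infinite_path b \<gamma> \<and> self_avoiding \<gamma>}"

(* x and y below are realisations of the two families of random variables. *)

definition Z :: "(edge \<Rightarrow> real) \<Rightarrow> vertex \<Rightarrow> vertex \<Rightarrow> real" where
  "Z y u v = real_of_int (fst v - fst u + snd v - snd u) * y {u, v}"

definition S :: "(edge \<Rightarrow> real) \<Rightarrow> (edge \<Rightarrow> real) \<Rightarrow> (nat \<Rightarrow> vertex) \<Rightarrow> nat \<Rightarrow> real" where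
  "S x y \<gamma> N = (\<Sum>k = 1..N. Z y (\<gamma> (k - 1)) (\<gamma> k) * x {\<gamma> (k - 1), \<gamma> k})"

definition \<Sigma> :: "(edge \<Rightarrow> real) \<Rightarrow> (edge \<Rightarrow> real) \<Rightarrow> vertex \<Rightarrow> ennreal" where
  "\<Sigma> x y b = (INF \<gamma> \<in> \<Gamma> b. SUP N. ennreal \<bar>S x y \<gamma> N\<bar>)"

locale random_environment = prob_space M
  for M :: "'w measure" +
  fixes p_o p_v :: real and L :: "real measure"
    and X Y :: "edge \<Rightarrow> 'w \<Rightarrow> real"
  assumes X_indep: "indep_vars (\<lambda>_. borel) X E2"
    and X_law: "\<And>e. e \<in> E2 \<Longrightarrow> distr M borel (X e) = L"
    (* with this target space, each Y e is a random variable with values in {-1, 1} *)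
    and Y_indep: "indep_vars (\<lambda>_. count_space {-1, 1}) Y E2"
    and Y_horizontal: "\<And>e. horizontal e \<Longrightarrow> prob {\<omega> \<in> space M. Y e \<omega> = 1} = p_o"
    and Y_vertical: "\<And>e. vertical e \<Longrightarrow> prob {\<omega> \<in> space M. Y e \<omega> = 1} = p_v"
    and X_Y_indep: "indep_var
        (\<Pi>\<^sub>M e\<in>E2. borel) (\<lambda>\<omega>. \<lambda>e\<in>E2. X e \<omega>)
        (\<Pi>\<^sub>M e\<in>E2. count_space {-1, 1}) (\<lambda>\<omega>. \<lambda>e\<in>E2. Y e \<omega>)"

lemma random_environment_exists:
  fixes p_o p_v :: real and L :: "real measure"
  assumes p: "p_o \<in> {0..1}" "p_v \<in> {0..1}"
    and L: "prob_space L" "sets L = sets borel"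
  obtains M :: "((edge \<Rightarrow> real) \<times> (edge \<Rightarrow> real)) measure" and X Y
    where "random_environment M p_o p_v L X Y"
proof -
  define K :: "edge \<Rightarrow> real measure" where
    "K e = distr (measure_pmf (bernoulli_pmf (if horizontal e then p_o else p_v)))
      (count_space {-1, 1}) (\<lambda>c. if c then 1 else -1)" for e
  have K: "prob_space (K e)" for e
    unfolding K_def by (intro prob_space.prob_space_distr measure_pmf.prob_space_axioms) auto
  have sets_K [measurable_cong, simp]: "sets (K e) = sets (count_space {-1, 1})" for e
    by (simp add: K_def)
  have space_K [simp]: "space (K e) = {-1, 1}" for e
    by (simp add: K_def)
  have K_1: "measure (K e) {1} = (if horizontal e then p_o else p_v)" for e
  proof -
    have "(\<lambda>c. if c then 1 else - 1 :: real) -` {1} = {True}" by (auto split: if_splits)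
    then show ?thesis
      using p by (subst K_def, subst measure_distr) (auto simp: measure_pmf_single)
  qed
  note L(2) [measurable_cong]
  define A where "A = (\<Pi>\<^sub>M e\<in>E2. L)"
  define B where "B = (\<Pi>\<^sub>M e\<in>E2. K e)"
  have sets_A [measurable_cong]: "sets A = sets (\<Pi>\<^sub>M e\<in>E2. borel)"
    unfolding A_def by (intro sets_PiM_cong) (auto simp: L)
  have sets_B [measurable_cong]: "sets B = sets (\<Pi>\<^sub>M e\<in>E2. count_space {-1, 1 :: real})"
    unfolding B_def by (intro sets_PiM_cong) auto
  interpret A: prob_space A unfolding A_def by (intro prob_space_PiM L)
  interpret B: prob_space B unfolding B_def by (intro prob_space_PiM K)
  interpret AB: pair_prob_space A B ..
  define M where "M = A \<Otimes>\<^sub>M B"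
  interpret M: prob_space M unfolding M_def by (rule AB.prob_space_axioms)
  define X :: "edge \<Rightarrow> ((edge \<Rightarrow> real) \<times> (edge \<Rightarrow> real)) \<Rightarrow> real" where "X e \<omega> = fst \<omega> e" for e \<omega>
  define Y :: "edge \<Rightarrow> ((edge \<Rightarrow> real) \<times> (edge \<Rightarrow> real)) \<Rightarrow> real" where "Y e \<omega> = snd \<omega> e" for e \<omega>
  have fst_M [measurable]: "fst \<in> M \<rightarrow>\<^sub>M A" and snd_M [measurable]: "snd \<in> M \<rightarrow>\<^sub>M B"
    unfolding M_def by auto
  have distr_fst: "distr M A fst = A"
    unfolding M_def by (rule B.distr_pair_fst)
  have distr_snd: "distr M B snd = B"
  proof (rule measure_eqI)
    fix T assume T: "T \<in> sets (distr M B snd)"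
    then have "snd -` T \<inter> space M = space A \<times> T"
      using sets.sets_into_space[of T B] by (auto simp: M_def space_pair_measure)
    then show "emeasure (distr M B snd) T = emeasure B T"
      using T by (simp add: emeasure_distr M_def B.emeasure_pair_measure_Times A.emeasure_space_1)
  qed simp
  have X_fun: "(\<lambda>e\<in>E2. X e \<omega>) = fst \<omega>" and Y_fun: "(\<lambda>e\<in>E2. Y e \<omega>) = snd \<omega>"
    if "\<omega> \<in> space M" for \<omega>
    using that by (auto simp: X_def Y_def M_def A_def B_def space_pair_measure space_PiM
        PiE_def extensional_def fun_eq_iff)
  have X_meas: "X e \<in> M \<rightarrow>\<^sub>M borel" and Y_meas: "Y e \<in> M \<rightarrow>\<^sub>M count_space {-1, 1}"
    if e: "e \<in> E2" for e
  proof -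
    have "fst \<in> M \<rightarrow>\<^sub>M (\<Pi>\<^sub>M e\<in>E2. borel)"
      using fst_M measurable_cong_sets[OF refl sets_A] by blast
    from measurable_compose[OF this measurable_component_singleton[OF e]]
    show "X e \<in> M \<rightarrow>\<^sub>M borel" by (simp add: X_def[abs_def])
    have "snd \<in> M \<rightarrow>\<^sub>M (\<Pi>\<^sub>M e\<in>E2. count_space {-1, 1})"
      using snd_M measurable_cong_sets[OF refl sets_B] by blast
    from measurable_compose[OF this measurable_component_singleton[OF e]]
    show "Y e \<in> M \<rightarrow>\<^sub>M count_space {-1, 1}" by (simp add: Y_def[abs_def])
  qed
  have X_law: "distr M borel (X e) = L" if e: "e \<in> E2" for e
  proof -
    have c: "(\<lambda>x. x e) \<in> A \<rightarrow>\<^sub>M L"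
      unfolding A_def using e by (rule measurable_component_singleton)
    have "distr M borel (X e) = distr M L ((\<lambda>x. x e) \<circ> fst)"
      by (rule distr_cong) (simp_all add: L X_def)
    also have "\<dots> = distr (distr M A fst) L (\<lambda>x. x e)"
      by (rule distr_distr[symmetric, OF c fst_M])
    also have "\<dots> = L"
      unfolding distr_fst unfolding A_def by (rule distr_PiM_component) (use e L in auto)
    finally show ?thesis .
  qed
  have Y_law: "distr M (count_space {-1, 1}) (Y e) = K e" if e: "e \<in> E2" for e
  proof -
    have c: "(\<lambda>x. x e) \<in> B \<rightarrow>\<^sub>M K e"
      unfolding B_def using e by (rule measurable_component_singleton)
    have "distr M (count_space {-1, 1}) (Y e) = distr M (K e) ((\<lambda>x. x e) \<circ> snd)"
      by (rule distr_cong) (simp_all add: Y_def)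
    also have "\<dots> = distr (distr M B snd) (K e) (\<lambda>x. x e)"
      by (rule distr_distr[symmetric, OF c snd_M])
    also have "\<dots> = K e"
      unfolding distr_snd unfolding B_def by (rule distr_PiM_component) (use e K in auto)
    finally show ?thesis .
  qed
  have X_joint: "distr M (\<Pi>\<^sub>M e\<in>E2. borel) (\<lambda>\<omega>. \<lambda>e\<in>E2. X e \<omega>) = A"
    by (subst distr_fst[symmetric], rule distr_cong) (simp_all add: X_fun sets_A)
  have Y_joint: "distr M (\<Pi>\<^sub>M e\<in>E2. count_space {-1, 1}) (\<lambda>\<omega>. \<lambda>e\<in>E2. Y e \<omega>) = B"
    by (subst distr_snd[symmetric], rule distr_cong) (simp_all add: Y_fun sets_B)
  have "{(0, 0), (1, 0)} \<in> E2"
    unfolding E2_def by force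
  then have ne: "E2 \<noteq> {}"
    by blast
  have "random_environment M p_o p_v L X Y"
  proof
    show "M.indep_vars (\<lambda>_. borel) X E2"
      using ne X_meas X_joint
      by (subst M.indep_vars_iff_distr_eq_PiM') (auto simp: A_def X_law intro!: PiM_cong)
    show "M.indep_vars (\<lambda>_. count_space {-1, 1}) Y E2"
      using ne Y_meas Y_joint
      by (subst M.indep_vars_iff_distr_eq_PiM') (auto simp: B_def Y_law intro!: PiM_cong)
    show "distr M borel (X e) = L" if "e \<in> E2" for e
      using that by (rule X_law)
    have prob: "M.prob {\<omega> \<in> space M. Y e \<omega> = 1} = measure (K e) {1}" if "e \<in> E2" for e
      using Y_meas[OF that]
      by (subst Y_law[OF that, symmetric], subst measure_distr)
        (auto intro!: arg_cong[where f = "measure M"])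
    show "M.prob {\<omega> \<in> space M. Y e \<omega> = 1} = p_o" if "horizontal e" for e
      using that prob[of e] by (simp add: K_1 horizontal_def)
    show "M.prob {\<omega> \<in> space M. Y e \<omega> = 1} = p_v" if "vertical e" for e
    proof -
      have "\<not> horizontal e"
        using that by (auto simp: horizontal_def vertical_def E2_def doubleton_eq_iff)
      then show ?thesis
        using that prob[of e] by (simp add: K_1 vertical_def)
    qed
    have "distr M (A \<Otimes>\<^sub>M B) (\<lambda>\<omega>. (\<lambda>e\<in>E2. X e \<omega>, \<lambda>e\<in>E2. Y e \<omega>)) = distr M M (\<lambda>\<omega>. \<omega>)"
      by (rule distr_cong) (auto simp: X_fun Y_fun M_def)
    then have "distr M ((\<Pi>\<^sub>M e\<in>E2. borel) \<Otimes>\<^sub>M (\<Pi>\<^sub>M e\<in>E2. count_space {-1, 1}))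
        (\<lambda>\<omega>. (\<lambda>e\<in>E2. X e \<omega>, \<lambda>e\<in>E2. Y e \<omega>)) = A \<Otimes>\<^sub>M B"
      by (simp add: M_def cong: distr_cong sets_pair_measure_cong[OF sets_A sets_B])
    then show "M.indep_var (\<Pi>\<^sub>M e\<in>E2. borel) (\<lambda>\<omega>. \<lambda>e\<in>E2. X e \<omega>)
        (\<Pi>\<^sub>M e\<in>E2. count_space {-1, 1}) (\<lambda>\<omega>. \<lambda>e\<in>E2. Y e \<omega>)"
      unfolding M.indep_var_distribution_eq X_joint Y_joint
      using X_meas Y_meas by (auto intro!: measurable_restrict)
  qed
  then show ?thesis
    by (rule that)
qed

(* The infimum of the empty set is infinity in ennreal. The event below is measurable: the
   lattice is locally finite, so a path bounded by s exists iff finite ones of every length do. *)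

definition M_c :: "'w measure \<Rightarrow> (edge \<Rightarrow> 'w \<Rightarrow> real) \<Rightarrow> (edge \<Rightarrow> 'w \<Rightarrow> real) \<Rightarrow> vertex \<Rightarrow> ennreal"
  where "M_c M X Y b = Inf {ennreal t | t. t > 0 \<and>
    measure M {\<omega> \<in> space M. \<Sigma> (\<lambda>e. X e \<omega>) (\<lambda>e. Y e \<omega>) b \<le> ennreal t} > 0}"

end

theory Submission
  imports Defs "HOL-Library.Transitive_Closure_Table"
begin

text \<open>
  Only the products \<open>W\<^sub>e = Y\<^sub>e X\<^sub>e\<close> matter: a path collects \<open>W\<^sub>e\<close> when it crosses \<open>e\<close> rightward or
  upward and \<open>-W\<^sub>e\<close> otherwise. The \<open>W\<^sub>e\<close> are independent, all horizontal ones have the same law, all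
  vertical ones have the same law, and \<open>\<bar>W\<^sub>e\<bar>\<close> has the same law for all edges.

  If both laws are point masses, they sit at values \<open>\<plusminus>a\<close>, and a staircase whose partial sums alternate
  between \<open>0\<close> and \<open>a\<close> is a bounded path (\<open>staircase_bounded_walk\<close>). Otherwise, after exchanging the two
  coordinates if necessary, the horizontal law is not a point mass.

  In that case the plane is cut into boxes of side of order \<open>n\<close>, one for each site of a coarse copy of
  \<open>\<int>\<^sup>2\<close>, and neighbouring corners are joined by a path of length of order \<open>n\<close> which contains a vertical
  climb. Along the climb the path may make any of \<open>n\<close> optional detours: \<open>n\<close> steps to the right, one
  step up and \<open>n\<close> steps back. The horizontal edges of a detour add the difference of the sums of two independent
  rows, a symmetric variable \<open>\<Sum>\<^sub>j d\<^sub>j\<close>. By Khinchine's inequality it exceeds a multiple of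
  \<open>n\<^sup>-\<^sup>1\<^sup>/\<^sup>2 \<Sum>\<^sub>j \<bar>d\<^sub>j\<bar>\<close> with a probability that is bounded below, and \<open>\<Sum>\<^sub>j \<bar>d\<^sub>j\<bar>\<close> is, up to constants, as large
  as the cost \<open>\<Sum> \<bar>W\<^sub>e\<bar>\<close> of a path of length of order \<open>n\<close>. All these comparisons are between quantiles,
  so heavy tails do no harm. The \<open>n\<close> detours together therefore gain about \<open>n\<^sup>1\<^sup>/\<^sup>2\<close> times the cost of the
  path that carries them (\<open>scale_exists\<close>). Hence, with probability close to 1 for large \<open>n\<close>, the two
  paths owned by a box can be chosen to have a nonnegative sum, and can also be chosen to have a
  nonpositive sum; the box is then called good. Goodness of different boxes is independent.

  Since bad boxes are rare, the box at the origin has a positive probability to be joined by good boxes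
  to boxes arbitrarily far away (\<open>percolation_positive_prob\<close>, \<open>good_path\<close>). Instead of a contour argument
  this uses cells of side \<open>3\<^sup>k\<close>: a cell is bad if two of its nine subcells are bad, so its probability of
  being bad is at most a constant times the square of the one at the level below, while the good subcells
  of neighbouring good cells hang together.

  Along a self-avoiding path of good boxes, the connecting path in each box is chosen with the sign
  opposite to the current sum; so the partial sums never leave a fixed interval
  (\<open>bounded_path_along\<close>). Konig's lemma turns arbitrarily long finite paths into an infinite one
  (\<open>Sigma_le_if\<close>). It also reduces \<open>\<Sigma> \<le> t\<close> to conditions on countably many finite
  paths, so that this is an event, and its probability is at least that of the percolation of good boxes.
\<close>

section \<open>Percolation of good sites\<close>

definition adj :: "vertex \<Rightarrow> vertex \<Rightarrow> bool" where
  "adj u v \<longleftrightarrow> \<bar>fst u - fst v\<bar> + \<bar>snd u - snd v\<bar> = 1"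

text \<open>A cell of level \<open>k + 1\<close> is made of nine cells of level \<open>k\<close>;
  cells of every level are indexed by \<open>\<int>\<^sup>2\<close>.\<close>

definition subcells :: "vertex \<Rightarrow> vertex set" where
  "subcells v = {3 * fst v..3 * fst v + 2} \<times> {3 * snd v..3 * snd v + 2}"

text \<open>One bad subcell is harmless, since it cannot separate the other eight.\<close>

primrec bad :: "vertex set \<Rightarrow> nat \<Rightarrow> vertex \<Rightarrow> bool" where
  "bad B 0 v \<longleftrightarrow> v \<in> B"
| "bad B (Suc k) v \<longleftrightarrow> (\<exists>u\<in>subcells v. \<exists>u'\<in>subcells v. u \<noteq> u' \<and> bad B k u \<and> bad B k u')"

text \<open>The sites of a good cell that are not inside a bad subcell of any level; they form a
  connected set of good sites.\<close>

primrec core :: "vertex set \<Rightarrow> nat \<Rightarrow> vertex \<Rightarrow> vertex set" where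
  "core B 0 v = {v}"
| "core B (Suc k) v = (\<Union>u\<in>{u \<in> subcells v. \<not> bad B k u}. core B k u)"

definition link :: "vertex set \<Rightarrow> vertex \<Rightarrow> vertex \<Rightarrow> bool" where
  "link B u v \<longleftrightarrow> u \<notin> B \<and> v \<notin> B \<and> adj u v"

lemma abs_sum_1_cases:
  fixes a b :: int
  assumes "\<bar>a\<bar> + \<bar>b\<bar> = 1"
  shows "(a, b) = (1, 0) \<or> (a, b) = (-1, 0) \<or> (a, b) = (0, 1) \<or> (a, b) = (0, -1)"
proof (cases "a = 0")
  case True then show ?thesis using assms by (auto simp: abs_if split: if_splits)
next
  case False
  then have "b = 0" using assms by linarith
  then show ?thesis using assms by (auto simp: abs_if split: if_splits)
qed

lemma link_rtranclp_sym: "(link B)\<^sup>*\<^sup>* u v \<Longrightarrow> (link B)\<^sup>*\<^sup>* v u"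
  by (rule sympD[OF symp_rtranclp]) (auto simp: symp_def link_def adj_def)

lemma line_induct:
  fixes i j lo hi :: int
  assumes step: "\<And>k. lo \<le> k \<Longrightarrow> k < hi \<Longrightarrow> R k (k + 1)"
    and sym: "\<And>i j. R i j \<Longrightarrow> R j i" and trans: "\<And>i j k. R i j \<Longrightarrow> R j k \<Longrightarrow> R i k"
    and refl: "\<And>i. lo \<le> i \<Longrightarrow> i \<le> hi \<Longrightarrow> R i i"
    and i: "lo \<le> i" "i \<le> hi" and j: "lo \<le> j" "j \<le> hi"
  shows "R i j"
proof -
  have up: "R a c" if "a \<le> c" "lo \<le> a" "c \<le> hi" for a c
    using that
  proof (induction c rule: int_ge_induct)
    case base then show ?case using refl by simp
  next
    case (step c)
    then show ?case using assms(1)[of c] trans by fastforce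
  qed
  show ?thesis using up[of i j] up[of j i] sym i j by (cases "i \<le> j") auto
qed

text \<open>In a 3 by 3 array with at most one hole, some row and some column are intact; every
  other cell has an intact row or an intact column through it, and so is joined to the crossing of
  these two. Here \<open>R\<close> is the relation of being joined.\<close>

lemma subcells_connected:
  assumes sym: "\<And>u v. R u v \<Longrightarrow> R v u" and trans: "\<And>u v w. R u v \<Longrightarrow> R v w \<Longrightarrow> R u w"
    and refl: "\<And>u. u \<in> subcells v0 \<Longrightarrow> g u \<Longrightarrow> R u u"
    and adjR: "\<And>u v. u \<in> subcells v0 \<Longrightarrow> v \<in> subcells v0 \<Longrightarrow> g u \<Longrightarrow> g v \<Longrightarrow> adj u v \<Longrightarrow> R u v"
    and one: "\<And>u v. u \<in> subcells v0 \<Longrightarrow> v \<in> subcells v0 \<Longrightarrow> \<not> g u \<Longrightarrow> \<not> g v \<Longrightarrow> u = v"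
    and u: "u \<in> subcells v0" "g u" and v: "v \<in> subcells v0" "g v"
  shows "R u v"
proof -
  define X where "X = {3 * fst v0..3 * fst v0 + 2}"
  define Y where "Y = {3 * snd v0..3 * snd v0 + 2}"
  have subcells: "subcells v0 = X \<times> Y" by (simp add: subcells_def X_def Y_def)
  have row: "R (i, y) (j, y)" if "\<And>x. x \<in> X \<Longrightarrow> g (x, y)" "y \<in> Y" "i \<in> X" "j \<in> X" for i j y
  proof (rule line_induct[where R = "\<lambda>i j. R (i, y) (j, y)" and lo = "3 * fst v0" and hi = "3 * fst v0 + 2"])
    show "R (i, y) (k, y)" if "R (i, y) (j, y)" "R (j, y) (k, y)" for i j k using trans that .
    show "R (j, y) (i, y)" if "R (i, y) (j, y)" for i j using sym that .
  qed (use that in \<open>auto intro!: adjR refl simp: subcells X_def adj_def\<close>)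
  have col: "R (x, i) (x, j)" if "\<And>y. y \<in> Y \<Longrightarrow> g (x, y)" "x \<in> X" "i \<in> Y" "j \<in> Y" for i j x
  proof (rule line_induct[where R = "\<lambda>i j. R (x, i) (x, j)" and lo = "3 * snd v0" and hi = "3 * snd v0 + 2"])
    show "R (x, i) (x, k)" if "R (x, i) (x, j)" "R (x, j) (x, k)" for i j k using trans that .
    show "R (x, j) (x, i)" if "R (x, i) (x, j)" for i j using sym that .
  qed (use that in \<open>auto intro!: adjR refl simp: subcells Y_def adj_def\<close>)
  obtain y0 where y0: "y0 \<in> Y" "\<And>x. x \<in> X \<Longrightarrow> g (x, y0)"
  proof (cases "\<forall>x\<in>X. g (x, 3 * snd v0)")
    case True then show ?thesis by (intro that[of "3 * snd v0"]) (auto simp: Y_def)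
  next
    case False
    then obtain x0 where x0: "x0 \<in> X" "\<not> g (x0, 3 * snd v0)" by blast
    have "g (x, 3 * snd v0 + 1)" if "x \<in> X" for x
      using one[of "(x0, 3 * snd v0)" "(x, 3 * snd v0 + 1)"] x0 that by (auto simp: subcells Y_def)
    then show ?thesis by (intro that[of "3 * snd v0 + 1"]) (auto simp: Y_def)
  qed
  obtain x1 where x1: "x1 \<in> X" "\<And>y. y \<in> Y \<Longrightarrow> g (x1, y)"
  proof (cases "\<forall>y\<in>Y. g (3 * fst v0, y)")
    case True then show ?thesis by (intro that[of "3 * fst v0"]) (auto simp: X_def)
  next
    case False
    then obtain y where y: "y \<in> Y" "\<not> g (3 * fst v0, y)" by blast
    have "g (3 * fst v0 + 1, y')" if "y' \<in> Y" for y'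
      using one[of "(3 * fst v0, y)" "(3 * fst v0 + 1, y')"] y that by (auto simp: subcells X_def)
    then show ?thesis by (intro that[of "3 * fst v0 + 1"]) (auto simp: X_def)
  qed
  have to: "R z (x1, y0)" if z: "z \<in> subcells v0" "g z" for z
  proof (cases "\<forall>y\<in>Y. g (fst z, y)")
    case True
    have "R (fst z, snd z) (fst z, y0)" using col[of "fst z"] True z y0 by (auto simp: subcells)
    moreover have "R (fst z, y0) (x1, y0)" using row[of y0] y0 x1 z by (auto simp: subcells)
    ultimately show ?thesis using trans[of "(fst z, snd z)"] by simp
  next
    case False
    then obtain y where y: "y \<in> Y" "\<not> g (fst z, y)" by blast
    have "g (x, snd z)" if "x \<in> X" for x
      using one[of "(fst z, y)" "(x, snd z)"] y z that by (cases z) (auto simp: subcells)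
    then have "R (fst z, snd z) (x1, snd z)" using row[of "snd z"] z x1 by (auto simp: subcells)
    moreover have "R (x1, snd z) (x1, y0)" using col[of x1] y0 x1 z by (auto simp: subcells)
    ultimately show ?thesis using trans[of "(fst z, snd z)"] by simp
  qed
  show ?thesis using to[OF u] to[OF v] sym trans by blast
qed

text \<open>Two neighbouring good cells face each other along three pairs of subcells, and contain
  at most two bad subcells in all; so one of these pairs joins the two cores.\<close>

lemma core_connected:
  "(\<forall>v. \<not> bad B k v \<longrightarrow> core B k v \<noteq> {} \<and> (\<forall>x\<in>core B k v. \<forall>y\<in>core B k v. (link B)\<^sup>*\<^sup>* x y))
   \<and> (\<forall>v v'. \<not> bad B k v \<longrightarrow> \<not> bad B k v' \<longrightarrow> adj v v' \<longrightarrow>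
        (\<exists>x\<in>core B k v. \<exists>y\<in>core B k v'. (link B)\<^sup>*\<^sup>* x y))"
proof (induction k)
  case 0
  show ?case by (auto simp: link_def)
next
  case (Suc k)
  let ?C = "(link B)\<^sup>*\<^sup>*"
  have IH1: "core B k u \<noteq> {}" "\<And>x y. x \<in> core B k u \<Longrightarrow> y \<in> core B k u \<Longrightarrow> ?C x y" if "\<not> bad B k u" for u
    using Suc that by blast+
  have IH2: "?C x y" if "\<not> bad B k u" "\<not> bad B k v" "adj u v" "x \<in> core B k u" "y \<in> core B k v" for u v x y
  proof -
    have "\<exists>x'\<in>core B k u. \<exists>y'\<in>core B k v. ?C x' y'" using Suc that(1-3) by blast
    then obtain x' y' where "x' \<in> core B k u" "y' \<in> core B k v" "?C x' y'" by blast
    then show ?thesis using IH1(2)[of u x x'] IH1(2)[of v y' y] that by (meson rtranclp_trans)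
  qed
  have good_pair: "\<exists>u\<in>subcells v. \<not> bad B k u" if v: "\<not> bad B (Suc k) v" for v
  proof -
    define a b where "a = (3 * fst v, 3 * snd v)" and "b = (3 * fst v + 1, 3 * snd v)"
    have ab: "a \<in> subcells v" "b \<in> subcells v" "a \<noteq> b" by (auto simp: subcells_def a_def b_def)
    then show ?thesis using v by auto
  qed
  have conn: "?C x y" if v: "\<not> bad B (Suc k) v" and x: "x \<in> core B (Suc k) v" and y: "y \<in> core B (Suc k) v" for v x y
  proof -
    obtain u u' where u: "u \<in> subcells v" "\<not> bad B k u" "x \<in> core B k u"
      and u': "u' \<in> subcells v" "\<not> bad B k u'" "y \<in> core B k u'" using x y by auto
    define R where "R = (\<lambda>u u'. \<not> bad B k u \<and> \<not> bad B k u' \<and> (\<forall>x\<in>core B k u. \<forall>y\<in>core B k u'. ?C x y))"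
    have "R u u'"
    proof (rule subcells_connected[where g = "\<lambda>u. \<not> bad B k u" and ?v0.0 = v])
      show "R v u" if "R u v" for u v
        using that link_rtranclp_sym unfolding R_def by blast
      show "R a c" if "R a b" "R b c" for a b c
        using that IH1(1)[of b] unfolding R_def by (meson ex_in_conv rtranclp_trans)
      show "R a a" if "a \<in> subcells v" "\<not> bad B k a" for a
        using that IH1(2) unfolding R_def by blast
      show "R a b" if "\<not> bad B k a" "\<not> bad B k b" "adj a b" for a b
        using that IH2 unfolding R_def by blast
      show "a = b" if "a \<in> subcells v" "b \<in> subcells v" "\<not> \<not> bad B k a" "\<not> \<not> bad B k b" for a b
        using v that by auto
    qed (use u u' in auto)
    then show ?thesis using u u' unfolding R_def by blast
  qed
  have cross: "\<exists>x\<in>core B (Suc k) v. \<exists>y\<in>core B (Suc k) v'. ?C x y"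
    if v: "\<not> bad B (Suc k) v" "\<not> bad B (Suc k) v'" "adj v v'" for v v'
  proof -
    define d where "d = (fst v' - fst v, snd v' - snd v)"
    have d: "d = (1, 0) \<or> d = (-1, 0) \<or> d = (0, 1) \<or> d = (0, -1)"
      using v(3) unfolding adj_def d_def by (intro abs_sum_1_cases) (simp add: abs_minus_commute)
    \<comment> \<open>three disjoint pairs of adjacent subcells, at most two of which contain a bad subcell\<close>
    define f where "f j = (if fst d = 0 then (3 * fst v + j, 3 * snd v + snd d + 1)
                             else (3 * fst v + fst d + 1, 3 * snd v + j))" for j :: int
    have v': "v' = (fst v + fst d, snd v + snd d)" by (simp add: d_def)
    define f' where "f' j = (fst (f j) + fst d, snd (f j) + snd d)" for j
    have f: "f j \<in> subcells v" "f' j \<in> subcells v'" "adj (f j) (f' j)" if "j \<in> {0, 1, 2}" for j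
      using d that by (auto simp: f_def f'_def v' subcells_def adj_def)
    have inj: "f i \<noteq> f j" "f' i \<noteq> f' j" if "i \<noteq> j" for i j
      using that by (auto simp: f_def f'_def)
    have "\<exists>j\<in>{0, 1, 2}. \<not> bad B k (f j) \<and> \<not> bad B k (f' j)"
    proof (rule ccontr)
      assume "\<not> ?thesis"
      then have *: "bad B k (f j) \<or> bad B k (f' j)" if "j \<in> {0, 1, 2}" for j using that by blast
      have 1: "\<not> (bad B k (f i) \<and> bad B k (f j))" if "i \<in> {0,1,2}" "j \<in> {0,1,2}" "i \<noteq> j" for i j
        using v(1) f(1)[OF that(1)] f(1)[OF that(2)] inj(1)[OF that(3)] by auto
      have 2: "\<not> (bad B k (f' i) \<and> bad B k (f' j))" if "i \<in> {0,1,2}" "j \<in> {0,1,2}" "i \<noteq> j" for i j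
        using v(2) f(2)[OF that(1)] f(2)[OF that(2)] inj(2)[OF that(3)] by auto
      show False
        using *[of 0] *[of 1] *[of 2] 1[of 0 1] 1[of 0 2] 1[of 1 2] 2[of 0 1] 2[of 0 2] 2[of 1 2] by auto
    qed
    then obtain j where j: "j \<in> {0, 1, 2}" "\<not> bad B k (f j)" "\<not> bad B k (f' j)" by blast
    obtain x y where "x \<in> core B k (f j)" "y \<in> core B k (f' j)" using IH1(1) j by blast
    then have "x \<in> core B (Suc k) v" "y \<in> core B (Suc k) v'" "?C x y"
      using IH2[OF j(2,3) f(3)[OF j(1)]] f(1,2)[OF j(1)] j(2,3) unfolding core.simps by blast+
    then show ?thesis by blast
  qed
  have "core B (Suc k) v \<noteq> {}" if "\<not> bad B (Suc k) v" for v
    using good_pair[OF that] IH1(1) by auto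
  then show ?case using conn cross by blast
qed

text \<open>For finding far sites in the core of a large cell.\<close>

lemma core_fst_ge: "x \<in> core B k v \<Longrightarrow> fst x \<ge> 3 ^ k * fst v"
proof (induction k arbitrary: v)
  case 0 then show ?case by simp
next
  case (Suc k)
  then obtain u where u: "u \<in> subcells v" "x \<in> core B k u" by auto
  have "(3 :: int) ^ Suc k * fst v = 3 ^ k * (3 * fst v)" by simp
  also have "\<dots> \<le> 3 ^ k * fst u" using u(1) by (intro mult_left_mono) (auto simp: subcells_def)
  also have "\<dots> \<le> fst x" using Suc.IH[OF u(2)] .
  finally show ?case .
qed

text \<open>The origin is the lower left corner of the cells \<open>(0, 0)\<close> of all levels,
  hence lies in the core of each. Such a core also contains sites from a subcell outside the left
  column, which are at distance at least \<open>3\<^sup>n\<close>.\<close>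

lemma percolates:
  assumes good: "\<And>k. \<not> bad B k (0, 0)"
  shows "\<exists>x. (link B)\<^sup>*\<^sup>* (0, 0) x \<and> fst x \<ge> int n"
proof -
  have origin: "(0, 0) \<in> core B k (0, 0)" for k
  proof (induction k)
    case (Suc k) then show ?case using good[of k] by (force simp: subcells_def)
  qed simp
  have "\<exists>u\<in>subcells (0, 0). fst u \<ge> 1 \<and> \<not> bad B n u"
  proof (rule ccontr)
    assume "\<not> ?thesis"
    moreover have subcells: "(1, 0) \<in> subcells (0, 0)" "(2, 0) \<in> subcells (0, 0)" by (auto simp: subcells_def)
    ultimately have "bad B n (1, 0)" "bad B n (2, 0)" by force+
    moreover have "(1 :: int, 0 :: int) \<noteq> (2, 0)" by simp
    ultimately show False using good[of "Suc n"] subcells unfolding bad.simps by blast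
  qed
  then obtain u where u: "u \<in> subcells (0, 0)" "fst u \<ge> 1" "\<not> bad B n u" by blast
  obtain x where x: "x \<in> core B n u" using core_connected[of B n] u by blast
  have "x \<in> core B (Suc n) (0, 0)" using x u unfolding core.simps by blast
  then have "(link B)\<^sup>*\<^sup>* (0, 0) x" using core_connected[of B "Suc n"] good[of "Suc n"] origin by blast
  moreover have "int n \<le> 3 ^ n"
  proof (induction n)
    case (Suc n)
    moreover have "(1::int) \<le> 3 ^ n" by simp
    ultimately show ?case unfolding power_Suc of_nat_Suc by linarith
  qed simp
  moreover have "(3::int) ^ n * 1 \<le> 3 ^ n * fst u" using u by (intro mult_left_mono) auto
  then have "3 ^ n \<le> fst x" using core_fst_ge[OF x] by linarith
  ultimately show ?thesis by (meson order_trans)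
qed

abbreviation walk :: "vertex list \<Rightarrow> bool" where
  "walk \<equiv> successively adj"

lemma rtrancl_path_walk:
  "rtrancl_path (link B) u p v \<Longrightarrow> u \<notin> B \<Longrightarrow> walk (u # p) \<and> set (u # p) \<inter> B = {} \<and> last (u # p) = v"
  by (induction rule: rtrancl_path.induct) (auto simp: link_def)

lemma walk_fst_bound: "walk (u # p) \<Longrightarrow> \<bar>fst (last (u # p)) - fst u\<bar> \<le> int (length p)"
proof (induction p arbitrary: u)
  case (Cons v p)
  have "adj u v" "walk (v # p)" using Cons.prems by auto
  then have "\<bar>fst (last (v # p)) - fst v\<bar> \<le> int (length p)" "\<bar>fst u - fst v\<bar> \<le> 1"
    using Cons.IH[of v] by (auto simp: adj_def)
  then show ?case by (simp only: last.simps list.distinct if_False length_Cons of_nat_Suc)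
qed simp

lemma good_path:
  assumes good: "\<And>k. \<not> bad B k (0, 0)"
  shows "\<exists>p. walk ((0, 0) # p) \<and> distinct ((0, 0) # p) \<and> set ((0, 0) # p) \<inter> B = {} \<and> length p \<ge> n"
proof -
  obtain x where x: "(link B)\<^sup>*\<^sup>* (0, 0) x" "fst x \<ge> int n" using percolates[OF good] by blast
  obtain p where "rtrancl_path (link B) (0, 0) p x" using x by (auto simp: rtranclp_eq_rtrancl_path)
  then obtain p where p: "rtrancl_path (link B) (0, 0) p x" "distinct ((0, 0) # p)"
    by (rule rtrancl_path_distinct)
  have "(0, 0) \<notin> B" using good[of 0] by simp
  from rtrancl_path_walk[OF p(1) this] have w: "walk ((0, 0) # p)" "set ((0, 0) # p) \<inter> B = {}" "last ((0,0) # p) = x"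
    by auto
  show ?thesis using walk_fst_bound[OF w(1)] w x p by (intro exI[of _ p]) auto
qed

text \<open>The minimal sets of bad sites that make a cell bad: a bad cell of level
  \<open>k\<close> contains \<open>2\<^sup>k\<close> bad sites arranged in a binary tree of cells.
  There are few such sets, which allows a union bound.\<close>

primrec bad_patterns :: "nat \<Rightarrow> vertex \<Rightarrow> vertex set set" where
  "bad_patterns 0 v = {{v}}"
| "bad_patterns (Suc k) v = (\<lambda>(F, F'). F \<union> F') `
     (\<Union>u\<in>subcells v. \<Union>u'\<in>subcells v - {u}. bad_patterns k u \<times> bad_patterns k u')"

lemma bad_patterns_SucE:
  assumes "F \<in> bad_patterns (Suc k) v"
  obtains u u' F1 F2 where "u \<in> subcells v" "u' \<in> subcells v" "u \<noteq> u'" "F1 \<in> bad_patterns k u" "F2 \<in> bad_patterns k u'" "F = F1 \<union> F2"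
  using assms unfolding bad_patterns.simps by (elim imageE UN_E SigmaE DiffE) auto

lemma bad_patterns_SucI:
  assumes "u \<in> subcells v" "u' \<in> subcells v" "u \<noteq> u'" "F1 \<in> bad_patterns k u" "F2 \<in> bad_patterns k u'"
  shows "F1 \<union> F2 \<in> bad_patterns (Suc k) v"
  unfolding bad_patterns.simps using assms by (intro image_eqI[where x = "(F1, F2)"]) auto

lemma finite_subcells: "finite (subcells v)" and card_subcells: "card (subcells v) = 9"
  by (simp_all add: subcells_def)

lemma bad_iff_bad_patterns: "bad B k v \<longleftrightarrow> (\<exists>F\<in>bad_patterns k v. F \<subseteq> B)"
proof (induction k arbitrary: v)
  case (Suc k)
  show ?case
  proof
    assume "bad B (Suc k) v"
    then obtain u u' F1 F2 where u: "u \<in> subcells v" "u' \<in> subcells v" "u \<noteq> u'" "F1 \<in> bad_patterns k u" "F2 \<in> bad_patterns k u'"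
      and "F1 \<subseteq> B" "F2 \<subseteq> B" unfolding bad.simps Suc by blast
    then have "F1 \<union> F2 \<subseteq> B" by blast
    then show "\<exists>F\<in>bad_patterns (Suc k) v. F \<subseteq> B" using bad_patterns_SucI[OF u] by blast
  next
    assume "\<exists>F\<in>bad_patterns (Suc k) v. F \<subseteq> B"
    then obtain F where F: "F \<in> bad_patterns (Suc k) v" "F \<subseteq> B" by blast
    from F(1) show "bad B (Suc k) v"
    proof (rule bad_patterns_SucE)
      fix u u' F1 F2
      assume u: "u \<in> subcells v" "u' \<in> subcells v" "u \<noteq> u'" and "F1 \<in> bad_patterns k u" "F2 \<in> bad_patterns k u'" "F = F1 \<union> F2"
      then have "bad B k u" "bad B k u'" unfolding Suc using F(2) by blast+
      then show ?thesis using u by auto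
    qed
  qed
qed simp

lemma bad_patterns_cell: "F \<in> bad_patterns k v \<Longrightarrow> x \<in> F \<Longrightarrow> fst x div 3 ^ k = fst v \<and> snd x div 3 ^ k = snd v"
proof (induction k arbitrary: v F)
  case (Suc k)
  obtain u F' where u: "u \<in> subcells v" "F' \<in> bad_patterns k u" "x \<in> F'"
    using Suc.prems by (elim bad_patterns_SucE) blast
  have "fst x div 3 ^ Suc k = fst u div 3" "snd x div 3 ^ Suc k = snd u div 3"
    using Suc.IH[OF u(2,3)] by (simp_all add: zdiv_zmult2_eq power_Suc2 del: power_Suc)
  then show ?case using u(1) by (auto simp: subcells_def)
qed simp

text \<open>The two halves of a pattern lie in different subcells, so the number of sites doubles
  at each level.\<close>

lemma bad_patterns_card: "F \<in> bad_patterns k v \<Longrightarrow> finite F \<and> card F = 2 ^ k"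
proof (induction k arbitrary: v F)
  case (Suc k)
  obtain u u' F1 F2 where u: "u \<noteq> u'" "F1 \<in> bad_patterns k u" "F2 \<in> bad_patterns k u'" "F = F1 \<union> F2"
    using Suc.prems by (rule bad_patterns_SucE)
  have "F1 \<inter> F2 = {}" using bad_patterns_cell[OF u(2)] bad_patterns_cell[OF u(3)] u(1) by (metis disjoint_iff prod_eqI)
  then show ?case using Suc.IH[OF u(2)] Suc.IH[OF u(3)] u(4) by (simp add: card_Un_disjoint)
qed simp

lemma finite_bad_patterns: "finite (bad_patterns k v)"
  by (induction k arbitrary: v) (auto simp: finite_subcells)

text \<open>A pattern of level \<open>k + 1\<close> is given by a pair of subcells and a pattern
  in each, which gives \<open>N\<^sub>k\<^sub>+\<^sub>1 \<le> 81
  N\<^sub>k\<^sup>2\<close>.\<close>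

lemma card_bad_patterns: "81 * card (bad_patterns k v) \<le> 81 ^ (2 ^ k)"
proof (induction k arbitrary: v)
  case (Suc k)
  define N where "N = (81 :: nat) ^ 2 ^ k div 81"
  have N: "81 * N = 81 ^ 2 ^ k" unfolding N_def by (simp add: dvd_mult_div_cancel)
  then have le: "card (bad_patterns k u) \<le> N" for u using Suc[of u] by linarith
  have "card (bad_patterns (Suc k) v) \<le> card (\<Union>u\<in>subcells v. \<Union>u'\<in>subcells v - {u}. bad_patterns k u \<times> bad_patterns k u')"
    by (simp only: bad_patterns.simps) (rule card_image_le, auto simp: finite_subcells finite_bad_patterns)
  also have "\<dots> \<le> (\<Sum>u\<in>subcells v. card (\<Union>u'\<in>subcells v - {u}. bad_patterns k u \<times> bad_patterns k u'))"
    by (rule card_UN_le) (rule finite_subcells)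
  also have "\<dots> \<le> (\<Sum>u\<in>subcells v. \<Sum>u'\<in>subcells v - {u}. card (bad_patterns k u \<times> bad_patterns k u'))"
    by (intro sum_mono card_UN_le) (simp add: finite_subcells)
  also have "\<dots> \<le> (\<Sum>u\<in>subcells v. \<Sum>u'\<in>subcells v - {u}. N * N)"
    by (intro sum_mono) (simp only: card_cartesian_product, intro mult_mono le, auto)
  also have "\<dots> = 9 * (8 * (N * N))" by (simp add: card_subcells)
  finally have "81 * card (bad_patterns (Suc k) v) \<le> 81 * (9 * (8 * (N * N)))" by simp
  also have "\<dots> \<le> (81 * N) * (81 * N)" by simp
  also have "\<dots> = 81 ^ 2 ^ Suc k" unfolding N by (simp add: power_add[symmetric])
  finally show ?case .
qed simp

context prob_space begin

text \<open>There are at most \<open>81\<^bsup>2^k\<^esup>\<close> patterns of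
  \<open>2\<^sup>k\<close> sites each. If single sites are bad with probability at most \<open>1 /
  (2 \<cdot> 81)\<close>, the expected number of completely bad patterns is summable over the
  levels, with a sum below 1.\<close>

lemma percolation_positive_prob:
  fixes Bd :: "'a \<Rightarrow> vertex set"
  assumes meas: "\<And>v. {\<omega> \<in> space M. v \<in> Bd \<omega>} \<in> events"
    and F: "\<And>F. finite F \<Longrightarrow> F \<noteq> {} \<Longrightarrow> prob {\<omega> \<in> space M. F \<subseteq> Bd \<omega>} \<le> (1 / 162) ^ card F"
  shows "{\<omega> \<in> space M. \<forall>k. \<not> bad (Bd \<omega>) k (0, 0)} \<in> events"
    and "prob {\<omega> \<in> space M. \<forall>k. \<not> bad (Bd \<omega>) k (0, 0)} > 0"
proof -
  define A where "A k = {\<omega> \<in> space M. bad (Bd \<omega>) k (0, 0)}" for k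
  have mF: "{\<omega> \<in> space M. F \<subseteq> Bd \<omega>} \<in> events" if "finite F" for F
    unfolding subset_eq using that by (intro sets.sets_Collect_finite_All meas) auto
  have A: "A k = (\<Union>F\<in>bad_patterns k (0, 0). {\<omega> \<in> space M. F \<subseteq> Bd \<omega>})" for k
    by (auto simp: A_def bad_iff_bad_patterns)
  have A_ev: "A k \<in> events" for k
    unfolding A using finite_bad_patterns bad_patterns_card mF by (intro sets.finite_UN) blast+
  have A_le: "prob (A k) \<le> (1 / 2) ^ (2 ^ k) / 81" for k
  proof -
    have "prob (A k) \<le> (\<Sum>F\<in>bad_patterns k (0, 0). prob {\<omega> \<in> space M. F \<subseteq> Bd \<omega>})"
      unfolding A using finite_bad_patterns bad_patterns_card mF by (intro finite_measure_subadditive_finite) blast+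
    also have "\<dots> \<le> (\<Sum>F\<in>bad_patterns k (0, 0). (1 / 162) ^ 2 ^ k)"
    proof (rule sum_mono)
      fix F assume "F \<in> bad_patterns k (0, 0)"
      then have "finite F" "card F = 2 ^ k" using bad_patterns_card by blast+
      then show "prob {\<omega> \<in> space M. F \<subseteq> Bd \<omega>} \<le> (1 / 162) ^ 2 ^ k" using F[of F] by force
    qed
    also have "\<dots> = real (card (bad_patterns k (0, 0))) * (1 / 162) ^ 2 ^ k" by simp
    also have "\<dots> \<le> (81 ^ 2 ^ k / 81) * (1 / 162) ^ 2 ^ k"
    proof (intro mult_right_mono)
      have "real (81 * card (bad_patterns k (0, 0))) \<le> real (81 ^ 2 ^ k)" using card_bad_patterns of_nat_mono by blast
      then show "real (card (bad_patterns k (0, 0))) \<le> 81 ^ 2 ^ k / 81" by simp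
    qed simp
    also have "\<dots> = (81 * (1 / 162)) ^ 2 ^ k / 81" by (simp only: power_mult_distrib)
    finally show ?thesis by simp
  qed
  have le2: "prob (A k) \<le> (1 / 2) ^ k / 81" for k
  proof -
    have "(1 / 2 :: real) ^ 2 ^ k \<le> (1 / 2) ^ k" by (rule power_decreasing) (auto intro: less_imp_le)
    then have "(1 / 2 :: real) ^ 2 ^ k / 81 \<le> (1 / 2) ^ k / 81" by (rule divide_right_mono) simp
    then show ?thesis using A_le[of k] by linarith
  qed
  have sm: "summable (\<lambda>k. (1 / 2 :: real) ^ k / 81)" by (intro summable_divide summable_geometric) simp
  then have sA: "summable (\<lambda>k. prob (A k))"
    by (rule summable_comparison_test') (use le2 in auto)
  have "prob (\<Union>k. A k) \<le> (\<Sum>k. prob (A k))"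
    by (rule finite_measure_subadditive_countably) (use A_ev sA in auto)
  also have "\<dots> \<le> (\<Sum>k. (1 / 2) ^ k / 81)" by (rule suminf_le[OF le2 sA sm])
  also have "\<dots> = 2 / 81" by (subst suminf_divide) (auto simp: suminf_geometric)
  finally have lt: "prob (\<Union>k. A k) < 1" by simp
  have eq: "{\<omega> \<in> space M. \<forall>k. \<not> bad (Bd \<omega>) k (0, 0)} = space M - (\<Union>k. A k)" by (auto simp: A_def)
  have ev: "(\<Union>k. A k) \<in> events" using A_ev by auto
  show "{\<omega> \<in> space M. \<forall>k. \<not> bad (Bd \<omega>) k (0, 0)} \<in> events" unfolding eq using ev by auto
  show "prob {\<omega> \<in> space M. \<forall>k. \<not> bad (Bd \<omega>) k (0, 0)} > 0" unfolding eq prob_compl[OF ev] using lt by simp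
qed

end

section \<open>Khinchine's inequality\<close>

text \<open>The sum of the \<open>d\<^sub>j\<close> with the signs of the \<open>j \<in> s\<close>
  reversed. Averages over all \<open>s \<subseteq> {..<n}\<close> stand for expectations over
  independent random signs.\<close>

definition signed_sum :: "nat \<Rightarrow> (nat \<Rightarrow> real) \<Rightarrow> nat set \<Rightarrow> real" where
  "signed_sum n d s = (\<Sum>j<n. if j \<in> s then - d j else d j)"

lemma sum_signed_sum_Suc:
  fixes g :: "real \<Rightarrow> real"
  shows "(\<Sum>s\<in>Pow {..<Suc n}. g (signed_sum (Suc n) d s)) =
     (\<Sum>s\<in>Pow {..<n}. g (signed_sum n d s + d n) + g (signed_sum n d s - d n))"
proof -
  have disj: "Pow {..<n} \<inter> insert n ` Pow {..<n} = {}" by auto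
  have inj: "inj_on (insert n) (Pow {..<n})" by (rule inj_onI) (auto simp: insert_ident)
  have a: "signed_sum (Suc n) d s = signed_sum n d s + d n" if "s \<in> Pow {..<n}" for s
    using that by (auto simp: signed_sum_def)
  have b: "signed_sum (Suc n) d (insert n s) = signed_sum n d s - d n" if "s \<in> Pow {..<n}" for s
  proof -
    have "(\<Sum>j<n. if j \<in> insert n s then - d j else d j) = signed_sum n d s"
      unfolding signed_sum_def by (rule sum.cong) auto
    then show ?thesis by (simp add: signed_sum_def)
  qed
  have "Pow {..<Suc n} = Pow {..<n} \<union> insert n ` Pow {..<n}"
    by (simp add: lessThan_Suc Pow_insert)
  then have "(\<Sum>s\<in>Pow {..<Suc n}. g (signed_sum (Suc n) d s)) =
      (\<Sum>s\<in>Pow {..<n}. g (signed_sum (Suc n) d s)) + (\<Sum>s\<in>Pow {..<n}. g (signed_sum (Suc n) d (insert n s)))"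
    using disj inj by (simp add: sum.union_disjoint sum.reindex)
  also have "\<dots> = (\<Sum>s\<in>Pow {..<n}. g (signed_sum n d s + d n)) + (\<Sum>s\<in>Pow {..<n}. g (signed_sum n d s - d n))"
    using a b by (intro arg_cong2[where f = "(+)"] sum.cong) auto
  finally show ?thesis by (simp add: sum.distrib)
qed

lemma sum_signed_sum_minus:
  fixes g :: "real \<Rightarrow> real"
  shows "(\<Sum>s\<in>Pow {..<n}. g (signed_sum n d s)) = (\<Sum>s\<in>Pow {..<n}. g (- signed_sum n d s))"
proof (induction n arbitrary: g)
  case 0 show ?case by (simp add: signed_sum_def)
next
  case (Suc n)
  show ?case unfolding sum_signed_sum_Suc sum_signed_sum_Suc[where g = "\<lambda>x. g (- x)"]
    by (subst Suc) (intro sum.cong refl, simp add: add.commute minus_diff_commute)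
qed

text \<open>The moment bounds that drive Khinchine's inequality: the second moment is \<open>q =
  \<Sum>\<^sub>j d\<^sub>j\<^sup>2\<close>, and the fourth is at most \<open>3
  q\<^sup>2\<close>.\<close>

lemma signed_sum_moments:
  "(\<Sum>s\<in>Pow {..<n}. (signed_sum n d s)\<^sup>2) = 2 ^ n * (\<Sum>j<n. (d j)\<^sup>2)"
  "(\<Sum>s\<in>Pow {..<n}. (signed_sum n d s) ^ 4) \<le> 3 * 2 ^ n * (\<Sum>j<n. (d j)\<^sup>2)\<^sup>2"
proof (induction n)
  case 0
  { case 1 show ?case by (simp add: signed_sum_def) next case 2 show ?case by (simp add: signed_sum_def) }
next
  case (Suc n)
  let ?q = "\<Sum>j<n. (d j)\<^sup>2" and ?S = "signed_sum n d"
  have "(\<Sum>s\<in>Pow {..<Suc n}. (signed_sum (Suc n) d s)\<^sup>2) = (\<Sum>s\<in>Pow {..<n}. 2 * (?S s)\<^sup>2 + 2 * (d n)\<^sup>2)"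
    unfolding sum_signed_sum_Suc[where g = "\<lambda>x. x\<^sup>2"] by (intro sum.cong) (auto simp: power2_eq_square algebra_simps)
  also have "\<dots> = 2 * (2 ^ n * ?q) + 2 ^ n * (2 * (d n)\<^sup>2)"
    using Suc(1) by (simp add: sum.distrib sum_distrib_left[symmetric] card_Pow)
  finally show "(\<Sum>s\<in>Pow {..<Suc n}. (signed_sum (Suc n) d s)\<^sup>2) = 2 ^ Suc n * (\<Sum>j<Suc n. (d j)\<^sup>2)"
    by (simp add: algebra_simps)
  have "(\<Sum>s\<in>Pow {..<Suc n}. (signed_sum (Suc n) d s) ^ 4) =
      (\<Sum>s\<in>Pow {..<n}. 2 * ?S s ^ 4 + 12 * (d n)\<^sup>2 * (?S s)\<^sup>2 + 2 * d n ^ 4)"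
    unfolding sum_signed_sum_Suc[where g = "\<lambda>x. x ^ 4"]
    by (intro sum.cong) (auto simp: power2_eq_square power4_eq_xxxx algebra_simps)
  also have "\<dots> = 2 * (\<Sum>s\<in>Pow {..<n}. ?S s ^ 4) + 12 * (d n)\<^sup>2 * (2 ^ n * ?q) + 2 ^ n * (2 * d n ^ 4)"
    using Suc(1) by (simp add: sum.distrib sum_distrib_left[symmetric] card_Pow)
  also have "\<dots> \<le> 2 * (3 * 2 ^ n * ?q\<^sup>2) + 12 * (d n)\<^sup>2 * (2 ^ n * ?q) + 2 ^ n * (6 * d n ^ 4)"
    using Suc(2) by (intro add_mono mult_left_mono) auto
  also have "\<dots> = 3 * 2 ^ Suc n * (\<Sum>j<Suc n. (d j)\<^sup>2)\<^sup>2"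
    by (simp add: power2_eq_square power4_eq_xxxx algebra_simps)
  finally show "(\<Sum>s\<in>Pow {..<Suc n}. (signed_sum (Suc n) d s) ^ 4) \<le> 3 * 2 ^ Suc n * (\<Sum>j<Suc n. (d j)\<^sup>2)\<^sup>2" .
qed

text \<open>A second moment argument. Instead of the Paley-Zygmund inequality, a parabola in
  \<open>y = S\<^sup>2 / q\<close> that lies below the indicator function of \<open>y \<ge>
  1/4\<close> is averaged.\<close>

lemma khinchine_square:
  "real (card {s \<in> Pow {..<n}. (\<Sum>j<n. (d j)\<^sup>2) / 4 \<le> (signed_sum n d s)\<^sup>2}) \<ge> 2 ^ n / 5"
proof -
  define q where "q = (\<Sum>j<n. (d j)\<^sup>2)"
  let ?S = "signed_sum n d"
  have q0: "q \<ge> 0" unfolding q_def by (simp add: sum_nonneg)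
  show ?thesis
  proof (cases "q = 0")
    case True
    then have "{s \<in> Pow {..<n}. q / 4 \<le> (?S s)\<^sup>2} = Pow {..<n}" by auto
    then show ?thesis unfolding q_def[symmetric] by (simp add: card_Pow)
  next
    case False
    then have q: "q > 0" using q0 by simp
    \<comment> \<open>The parabola has its maximum 1 at \<open>y = 4\<close> and its left zero at
      \<open>y = 1/4\<close>.\<close>
    have pt: "1 - 16 / 225 * ((?S s)\<^sup>2 / q - 4)\<^sup>2 \<le> (if q / 4 \<le> (?S s)\<^sup>2 then 1 else 0)" for s
    proof (cases "q / 4 \<le> (?S s)\<^sup>2")
      case False
      then have "(?S s)\<^sup>2 / q \<le> 1 / 4" using q by (simp add: field_simps)
      then have "(15 / 4)\<^sup>2 \<le> (4 - (?S s)\<^sup>2 / q)\<^sup>2" by (intro power_mono) auto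
      then show ?thesis using False by (subst power2_commute) (simp add: power_divide)
    qed simp
    have "2 ^ n / 5 \<le> 2 ^ n - 16 / 225 * (3 * 2 ^ n - 8 * 2 ^ n + 16 * (2 ^ n :: real))" by (simp add: field_simps)
    also have "\<dots> \<le> 2 ^ n - 16 / 225 * ((\<Sum>s\<in>Pow {..<n}. ?S s ^ 4) / q\<^sup>2 - 8 * 2 ^ n + 16 * 2 ^ n)"
      using signed_sum_moments(2)[of n d] q unfolding q_def[symmetric] by (simp add: field_simps)
    also have "\<dots> = 2 ^ n - 16 / 225 * ((\<Sum>s\<in>Pow {..<n}. ?S s ^ 4) / q\<^sup>2 - 8 * (\<Sum>s\<in>Pow {..<n}. (?S s)\<^sup>2) / q + 16 * 2 ^ n)"
      using signed_sum_moments(1)[of n d] q unfolding q_def[symmetric] by simp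
    also have "\<dots> = (\<Sum>s\<in>Pow {..<n}. 1 - 16 / 225 * (?S s ^ 4 / q\<^sup>2 - 8 * (?S s)\<^sup>2 / q + 16))"
      by (simp add: sum_subtractf sum.distrib sum_distrib_left[symmetric] sum_divide_distrib[symmetric] card_Pow)
    also have "\<dots> = (\<Sum>s\<in>Pow {..<n}. 1 - 16 / 225 * ((?S s)\<^sup>2 / q - 4)\<^sup>2)"
      using q by (intro sum.cong) (auto simp: power2_eq_square power4_eq_xxxx field_simps)
    also have "\<dots> \<le> (\<Sum>s\<in>Pow {..<n}. if q / 4 \<le> (?S s)\<^sup>2 then 1 else 0)"
      using pt by (intro sum_mono) 
    also have "\<dots> = real (card {s \<in> Pow {..<n}. q / 4 \<le> (?S s)\<^sup>2})"
      by (subst sum.inter_filter[symmetric]) (auto simp: finite_subset)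
    finally show ?thesis unfolding q_def .
  qed
qed

text \<open>Sums with random signs are symmetric, so half of the large ones are positive; and
  \<open>\<Sum>\<^sub>j \<bar>d\<^sub>j\<bar> \<le> (n q)\<^sup>1\<^sup>/\<^sup>2\<close>.\<close>

lemma khinchine:
  assumes n: "n > 0"
  shows "real (card {s \<in> Pow {..<n}. (\<Sum>j<n. \<bar>d j\<bar>) / (2 * sqrt n) \<le> signed_sum n d s}) \<ge> 2 ^ n / 10"
proof -
  define q where "q = (\<Sum>j<n. (d j)\<^sup>2)"
  let ?S = "signed_sum n d"
  have q0: "q \<ge> 0" unfolding q_def by (simp add: sum_nonneg)
  define N where "N P = real (card {s \<in> Pow {..<n}. P (?S s)})" for P
  have N: "N P = (\<Sum>s\<in>Pow {..<n}. if P (?S s) then 1 else 0)" for P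
    unfolding N_def by (subst sum.inter_filter[symmetric]) auto
  have sym: "N (\<lambda>x. P (- x)) = N P" for P
    unfolding N by (rule sum_signed_sum_minus[symmetric])
  have "(\<Sum>j<n. \<bar>d j\<bar>)\<^sup>2 \<le> (\<Sum>j<n. \<bar>d j\<bar>\<^sup>2) * card {..<n}"
    by (rule sum_squared_le_sum_of_squares)
  then have "(\<Sum>j<n. \<bar>d j\<bar>)\<^sup>2 \<le> q * n" by (simp add: q_def)
  then have "sqrt ((\<Sum>j<n. \<bar>d j\<bar>)\<^sup>2) \<le> sqrt (q * n)" by (rule real_sqrt_le_mono)
  then have le: "(\<Sum>j<n. \<bar>d j\<bar>) / (2 * sqrt n) \<le> sqrt q / 2"
    using n by (simp add: real_sqrt_mult field_simps sum_nonneg)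
  have "2 ^ n / 5 \<le> N (\<lambda>x. q / 4 \<le> x\<^sup>2)"
    unfolding N_def q_def by (rule khinchine_square)
  also have "\<dots> \<le> N (\<lambda>x. sqrt q / 2 \<le> x) + N (\<lambda>x. sqrt q / 2 \<le> - x)"
    unfolding N sum.distrib[symmetric]
  proof (intro sum_mono)
    fix s
    have "sqrt q / 2 \<le> ?S s \<or> sqrt q / 2 \<le> - ?S s" if "q / 4 \<le> (?S s)\<^sup>2"
    proof -
      have "sqrt (q / 4) \<le> sqrt ((?S s)\<^sup>2)" using that by (rule real_sqrt_le_mono)
      then have "sqrt q / 2 \<le> \<bar>?S s\<bar>" by (simp add: real_sqrt_divide)
      then show ?thesis by linarith
    qed
    then show "(if q / 4 \<le> (?S s)\<^sup>2 then 1 else 0) \<le>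
        (if sqrt q / 2 \<le> ?S s then 1 else 0) + (if sqrt q / 2 \<le> - ?S s then 1 else (0::real))" by auto
  qed
  also have "\<dots> = 2 * N (\<lambda>x. sqrt q / 2 \<le> x)" using sym[of "\<lambda>x. sqrt q / 2 \<le> x"] by simp
  finally have "2 ^ n / 10 \<le> N (\<lambda>x. sqrt q / 2 \<le> x)" by simp
  also have "\<dots> \<le> N (\<lambda>x. (\<Sum>j<n. \<bar>d j\<bar>) / (2 * sqrt n) \<le> x)"
    unfolding N_def using le by (intro of_nat_mono card_mono) auto
  finally show ?thesis unfolding N_def .
qed

section \<open>Independent variables and spread of laws\<close>

context prob_space begin

lemma indep_vars_reindex:
  assumes inj: "inj_on f I" and X: "indep_vars (\<lambda>_. N) X (f ` I)"
  shows "indep_vars (\<lambda>_. N) (\<lambda>i. X (f i)) I"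
  unfolding indep_vars_def2
proof (intro conjI ballI indep_setsI)
  have rv: "random_variable N (X (f i))" if "i \<in> I" for i
    using X that unfolding indep_vars_def2 by blast
  show "random_variable N (X (f i))" if "i \<in> I" for i using rv that .
  show "{X (f i) -` A \<inter> space M |A. A \<in> sets N} \<subseteq> events" if "i \<in> I" for i
    using rv[OF that] measurable_sets by blast
next
  fix A J assume J: "J \<noteq> {}" "J \<subseteq> I" "finite J"
    and A: "\<forall>j\<in>J. A j \<in> {X (f j) -` A \<inter> space M |A. A \<in> sets N}"
  have inv: "inv_into I f (f j) = j" if "j \<in> J" for j using inj J that by (auto intro: inv_into_f_f)
  have injJ: "inj_on f J" using inj J inj_on_subset by blast
  have sets: "indep_sets (\<lambda>i. {X i -` A \<inter> space M |A. A \<in> sets N}) (f ` I)"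
    using X unfolding indep_vars_def2 by blast
  have "prob (\<Inter>k\<in>f ` J. A (inv_into I f k)) = (\<Prod>k\<in>f ` J. prob (A (inv_into I f k)))"
    by (rule indep_setsD[OF sets]) (use A J inv in auto)
  then show "prob (\<Inter>j\<in>J. A j) = (\<Prod>j\<in>J. prob (A j))"
    using inv by (simp add: prod.reindex[OF injJ])
qed

lemma distr_reindexed_family:
  assumes X: "indep_vars (\<lambda>_. N) X (f ` I)" and inj: "inj_on f I" and I: "I \<noteq> {}"
    and law: "\<And>i. i \<in> I \<Longrightarrow> distr M N (X (f i)) = \<nu>"
  shows "distr M (PiM I (\<lambda>_. N)) (\<lambda>\<omega>. \<lambda>i\<in>I. X (f i) \<omega>) = PiM I (\<lambda>_. \<nu>)"
proof -
  have "indep_vars (\<lambda>_. N) (\<lambda>i. X (f i)) I" by (rule indep_vars_reindex[OF inj X])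
  moreover from this have "random_variable N (X (f i))" if "i \<in> I" for i
    using that unfolding indep_vars_def2 by blast
  ultimately have "distr M (PiM I (\<lambda>_. N)) (\<lambda>\<omega>. \<lambda>i\<in>I. X (f i) \<omega>) = PiM I (\<lambda>i. distr M N (X (f i)))"
    using indep_vars_iff_distr_eq_PiM'[OF I, of "\<lambda>i. X (f i)" "\<lambda>_. N"] by blast
  also have "\<dots> = PiM I (\<lambda>_. \<nu>)" by (rule PiM_cong) (auto simp: law)
  finally show ?thesis .
qed

lemma integrable_indicator: "A \<in> events \<Longrightarrow> integrable M (indicat_real A)"
  by (simp add: integrable_indicator_iff emeasure_eq_measure)

text \<open>The random sum is at most \<open>T = \<Sum>\<^sub>j c\<^sub>j\<close> and has a mean
  of at least \<open>\<eta> T\<close>, of which outcomes below \<open>\<eta> T / 2\<close> account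
  for at most \<open>\<eta> T / 2\<close>; so the remaining outcomes have probability at least
  \<open>\<eta> / 2\<close>.\<close>

lemma prob_sum_ge_half_mean:
  assumes J: "finite J" and c: "\<And>j. j \<in> J \<Longrightarrow> c j \<ge> (0::real)" and eta: "0 \<le> \<eta>" "\<eta> \<le> 1"
    and A: "\<And>j. j \<in> J \<Longrightarrow> A j \<in> events" "\<And>j. j \<in> J \<Longrightarrow> prob (A j) \<ge> \<eta>"
  shows "prob {\<omega> \<in> space M. \<eta> / 2 * (\<Sum>j\<in>J. c j) \<le> (\<Sum>j\<in>J. c j * indicator (A j) \<omega>)} \<ge> \<eta> / 2"
proof -
  define T where "T = (\<Sum>j\<in>J. c j)"
  define f where "f \<omega> = (\<Sum>j\<in>J. c j * indicator (A j) \<omega>)" for \<omega>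
  define B where "B = {\<omega> \<in> space M. \<eta> / 2 * T \<le> f \<omega>}"
  have [measurable]: "A j \<in> events" if "j \<in> J" for j using A(1) that .
  have f_meas [measurable]: "f \<in> borel_measurable M" unfolding f_def by measurable
  have B [measurable]: "B \<in> events" unfolding B_def by measurable
  have T0: "T \<ge> 0" unfolding T_def using c by (rule sum_nonneg)
  have f0: "0 \<le> f \<omega>" for \<omega> unfolding f_def using c by (intro sum_nonneg mult_nonneg_nonneg) auto
  have fT: "f \<omega> \<le> T" for \<omega> unfolding f_def T_def using c
    by (intro sum_mono) (auto simp: indicator_def)
  show ?thesis
  proof (cases "T = 0")
    case True
    then have "B = space M" using f0 by (auto simp: B_def)
    then have "\<eta> / 2 \<le> prob B" using eta by (simp add: prob_space)
    then show ?thesis by (simp add: B_def f_def T_def)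
  next
    case False
    then have T: "T > 0" using T0 by simp
    have "\<eta> * T \<le> (\<Sum>j\<in>J. c j * prob (A j))"
      unfolding T_def sum_distrib_left
      by (intro sum_mono, subst mult.commute, rule mult_left_mono) (use A(2) c in auto)
    also have "\<dots> = expectation f"
        unfolding f_def using A(1)
      by (subst Bochner_Integration.integral_sum) (auto simp: integrable_indicator)
    also have "\<dots> \<le> expectation (\<lambda>\<omega>. T * indicator B \<omega> + \<eta> / 2 * T)"
    proof (rule integral_mono)
      show "integrable M f"
        using f0 fT by (intro integrable_const_bound[where B = T]) auto
      show "integrable M (\<lambda>\<omega>. T * indicator B \<omega> + \<eta> / 2 * T)"
        by (simp add: integrable_indicator)
      show "f \<omega> \<le> T * indicator B \<omega> + \<eta> / 2 * T" if "\<omega> \<in> space M" for \<omega>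
      proof -
        have "0 \<le> \<eta> / 2 * T" using eta T by simp
        then show ?thesis using that fT[of \<omega>] by (auto simp: B_def indicator_def)
      qed
    qed
    also have "\<dots> = T * prob B + \<eta> / 2 * T"
      by (simp add: prob_space integrable_indicator)
    finally have "T * (\<eta> / 2) \<le> T * prob B" by (simp add: algebra_simps)
    then show ?thesis using T by (simp add: B_def f_def T_def)
  qed
qed

text \<open>Hoeffding's inequality for the number of large variables.\<close>

lemma count_tail:
  fixes D :: "nat \<Rightarrow> 'a \<Rightarrow> real"
  assumes ind: "indep_vars (\<lambda>_. borel) D {..<n}"
    and p: "\<And>t. t < n \<Longrightarrow> prob {\<omega> \<in> space M. \<beta> \<le> D t \<omega>} \<ge> p" and "p > 0" and n: "n > 0"
  shows "prob {\<omega> \<in> space M. real (card {t. t < n \<and> \<beta> \<le> D t \<omega>}) \<le> n * p / 2} \<le> exp (- (n * p\<^sup>2 / 2))"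
proof -
  define f where "f t \<omega> = (if \<beta> \<le> D t \<omega> then 1 else 0 :: real)" for t \<omega>
  have D: "random_variable borel (D t)" if "t < n" for t using ind that unfolding indep_vars_def2 by blast
  have iv: "indep_vars (\<lambda>_. borel) f {..<n}"
    unfolding f_def by (rule indep_vars_compose2[OF ind]) measurable
  have f: "random_variable borel (f t)" if "t < n" for t using iv that unfolding indep_vars_def2 by blast
  have exp_f: "expectation (f t) = prob {\<omega> \<in> space M. \<beta> \<le> D t \<omega>}" if "t < n" for t
  proof -
    have [measurable]: "random_variable borel (D t)" using D that .
    have "expectation (f t) = expectation (indicator {\<omega> \<in> space M. \<beta> \<le> D t \<omega>})"
      by (rule Bochner_Integration.integral_cong) (auto simp: f_def)
    then show ?thesis by simp
  qed
  let ?mu = "\<Sum>t<n. expectation (f t)"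
  interpret H: Hoeffding_ineq M "{..<n}" f "\<lambda>_. 0" "\<lambda>_. 1" "?mu"
    by unfold_locales (use iv in \<open>auto simp: f_def\<close>)
  have "n * p \<le> ?mu" using sum_mono[of "{..<n}" "\<lambda>_. p" "\<lambda>t. expectation (f t)"] p exp_f by simp
  then have "prob {\<omega> \<in> space M. real (card {t. t < n \<and> \<beta> \<le> D t \<omega>}) \<le> n * p / 2} \<le>
     prob {\<omega> \<in> space M. (\<Sum>t<n. f t \<omega>) \<le> ?mu - n * p / 2}"
  proof (intro finite_measure_mono)
    have "(\<Sum>t<n. f t \<omega>) = real (card {t. t < n \<and> \<beta> \<le> D t \<omega>})" for \<omega>
      by (auto simp: f_def sum.If_cases intro!: arg_cong[where f = card])
    then show "{\<omega> \<in> space M. real (card {t. t < n \<and> \<beta> \<le> D t \<omega>}) \<le> n * p / 2} \<subseteq>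
      {\<omega> \<in> space M. (\<Sum>t<n. f t \<omega>) \<le> ?mu - n * p / 2}" using \<open>n * p \<le> ?mu\<close> by auto
    have "(\<lambda>\<omega>. \<Sum>t<n. f t \<omega>) \<in> borel_measurable M" using f by (intro borel_measurable_sum) auto
    then show "{\<omega> \<in> space M. (\<Sum>t<n. f t \<omega>) \<le> ?mu - n * p / 2} \<in> events" by measurable
  qed
  also have "\<dots> \<le> exp (- 2 * (n * p / 2)\<^sup>2 / (\<Sum>t<n. (1 - 0)\<^sup>2))"
    using n \<open>p > 0\<close> by (intro H.Hoeffding_ineq_le) auto
  also have "\<dots> = exp (- (n * p\<^sup>2 / 2))" using n by (simp add: power2_eq_square field_simps)
  finally show ?thesis .
qed

end

text \<open>The law of \<open>X\<close> does not concentrate near any \<open>w\<close>, even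
  relative to \<open>\<bar>w\<bar>\<close>: values of \<open>w\<close> in a bounded range are
  missed by an absolute amount because \<open>X\<close> is not constant, and larger ones because
  \<open>X\<close> is tight. This makes the difference of two independent copies comparable to
  each of them, although the law may be concentrated near a point other than 0.\<close>

lemma (in prob_space) spread_of_nonconstant:
  fixes X :: "'a \<Rightarrow> real"
  assumes X [measurable]: "random_variable borel X"
    and t: "prob {\<omega> \<in> space M. X \<omega> \<le> t} > 0" "prob {\<omega> \<in> space M. X \<omega> \<le> t} < 1"
  obtains \<kappa> \<eta> where "\<kappa> > 0" "\<eta> > 0" "\<And>w. prob {\<omega> \<in> space M. \<kappa> * \<bar>w\<bar> \<le> \<bar>w - X \<omega>\<bar>} \<ge> \<eta>"
proof -
  have "\<exists>m::nat. prob {\<omega> \<in> space M. X \<omega> > t + 2 / Suc m} > 0"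
  proof (rule ccontr)
    assume "\<not> ?thesis"
    then have "prob {\<omega> \<in> space M. X \<omega> > t + 2 / Suc m} = 0" for m
      by (simp add: not_less measure_le_0_iff)
    then have "AE \<omega> in M. \<not> X \<omega> > t + 2 / Suc m" for m
      by (subst AE_iff_measurable[OF _ refl]) (auto simp: emeasure_eq_measure)
    then have "AE \<omega> in M. \<forall>m::nat. \<not> X \<omega> > t + 2 / Suc m" by (simp add: AE_all_countable)
    then have "AE \<omega> in M. X \<omega> \<le> t"
    proof (eventually_elim)
      case (elim \<omega>)
      have lim: "(\<lambda>m. t + 2 / real (Suc m)) \<longlonglongrightarrow> t + 0"
        by (intro tendsto_add tendsto_const) (rule LIMSEQ_Suc[OF lim_const_over_n])
      have "X \<omega> \<le> t + 0"
        by (rule LIMSEQ_le_const[OF lim]) (use elim in \<open>auto simp: not_less\<close>)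
      then show ?case by simp
    qed
    then show False using t(2) prob_eq_1[of "{\<omega> \<in> space M. X \<omega> \<le> t}"] by simp
  qed
  then obtain m :: nat where m: "prob {\<omega> \<in> space M. X \<omega> > t + 2 / Suc m} > 0" by blast
  define d where "d = 1 / real (Suc m)"
  define e where "e = min (prob {\<omega> \<in> space M. X \<omega> \<le> t}) (prob {\<omega> \<in> space M. X \<omega> > t + 2 * d})"
  have d: "d > 0" and e: "e > 0" using t(1) m by (auto simp: d_def e_def)
  have far: "prob {\<omega> \<in> space M. d \<le> \<bar>w - X \<omega>\<bar>} \<ge> e" for w
  proof (cases "w \<ge> t + d")
    case True
    then have "prob {\<omega> \<in> space M. X \<omega> \<le> t} \<le> prob {\<omega> \<in> space M. d \<le> \<bar>w - X \<omega>\<bar>}"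
      by (intro finite_measure_mono) auto
    then show ?thesis by (simp add: e_def)
  next
    case False
    then have "prob {\<omega> \<in> space M. X \<omega> > t + 2 * d} \<le> prob {\<omega> \<in> space M. d \<le> \<bar>w - X \<omega>\<bar>}"
      by (intro finite_measure_mono) auto
    then show ?thesis by (simp add: e_def)
  qed
  obtain K :: nat where K: "prob {\<omega> \<in> space M. \<bar>X \<omega>\<bar> \<le> K} \<ge> 1 / 2"
  proof -
    have "(\<lambda>K::nat. prob {\<omega> \<in> space M. \<bar>X \<omega>\<bar> \<le> K}) \<longlonglongrightarrow> prob (\<Union>K::nat. {\<omega> \<in> space M. \<bar>X \<omega>\<bar> \<le> K})"
      by (intro finite_Lim_measure_incseq) (auto simp: incseq_def)
    moreover have "(\<Union>K::nat. {\<omega> \<in> space M. \<bar>X \<omega>\<bar> \<le> K}) = space M"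
      using real_arch_simple by auto
    ultimately have "(\<lambda>K::nat. prob {\<omega> \<in> space M. \<bar>X \<omega>\<bar> \<le> K}) \<longlonglongrightarrow> 1" by (simp add: prob_space)
    then have "\<forall>\<^sub>F K in sequentially. 1 / 2 < prob {\<omega> \<in> space M. \<bar>X \<omega>\<bar> \<le> real K}"
      by (rule order_tendstoD) simp
    then show ?thesis using that by (meson eventually_sequentially less_imp_le order_refl)
  qed
  define R where "R = 2 * real K + 1"
  \<comment> \<open>Beyond \<open>R\<close>, half of \<open>\<bar>w\<bar>\<close> is missed with
    probability 1/2; up to \<open>R\<close>, the distance \<open>d\<close> is at least
    \<open>\<kappa> \<bar>w\<bar>\<close>.\<close>
  define \<kappa> where "\<kappa> = min (1 / 2) (d / R)"
  have R: "R > 0" by (simp add: R_def)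
  have \<kappa>: "\<kappa> > 0" "\<kappa> \<le> 1 / 2" "\<kappa> * R \<le> d" using d R by (auto simp: \<kappa>_def min_def field_simps)
  show ?thesis
  proof (rule that[of \<kappa> "min (1 / 2) e"])
    fix w
    show "min (1 / 2) e \<le> prob {\<omega> \<in> space M. \<kappa> * \<bar>w\<bar> \<le> \<bar>w - X \<omega>\<bar>}"
    proof (cases "\<bar>w\<bar> \<le> R")
      case True
      then have "\<kappa> * \<bar>w\<bar> \<le> \<kappa> * R" using \<kappa> by (intro mult_left_mono) auto
      then have "\<kappa> * \<bar>w\<bar> \<le> d" using \<kappa>(3) by (rule order_trans)
      then have "prob {\<omega> \<in> space M. d \<le> \<bar>w - X \<omega>\<bar>} \<le> prob {\<omega> \<in> space M. \<kappa> * \<bar>w\<bar> \<le> \<bar>w - X \<omega>\<bar>}"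
        by (intro finite_measure_mono) auto
      then show ?thesis using far[of w] by simp
    next
      case False
      have "\<kappa> * \<bar>w\<bar> \<le> 1 / 2 * \<bar>w\<bar>" using \<kappa> by (intro mult_right_mono) auto
      then have "prob {\<omega> \<in> space M. \<bar>X \<omega>\<bar> \<le> K} \<le> prob {\<omega> \<in> space M. \<kappa> * \<bar>w\<bar> \<le> \<bar>w - X \<omega>\<bar>}"
        using False by (intro finite_measure_mono) (auto simp: R_def)
      then show ?thesis using K by simp
    qed
  qed (use \<kappa> e in auto)
qed

section \<open>The difference of two random rows\<close>

context prob_space begin

text \<open>Conditionally on the row \<open>True\<close>, each difference \<open>X\<^sub>j -
  X'\<^sub>j\<close> has size at least \<open>\<kappa> \<bar>X\<^sub>j\<bar>\<close> with
  probability at least \<open>\<eta>\<close>, so \<open>prob_sum_ge_half_mean\<close> applies with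
  the weights \<open>\<kappa> \<bar>X\<^sub>j\<bar>\<close>. Summing up the conditional bounds is
  Fubini's theorem for the two independent rows.\<close>

lemma row_pair_spread:
  fixes X :: "nat \<times> bool \<Rightarrow> 'a \<Rightarrow> real"
  assumes X: "indep_vars (\<lambda>_. borel) X ({..<n} \<times> UNIV)"
    and spread: "\<And>w j. j < n \<Longrightarrow> prob {\<omega> \<in> space M. \<kappa> * \<bar>w\<bar> \<le> \<bar>w - X (j, False) \<omega>\<bar>} \<ge> \<eta>"
    and \<kappa>: "\<kappa> > 0" and \<eta>: "0 \<le> \<eta>" "\<eta> \<le> 1"
  shows "\<eta> / 2 * prob {\<omega> \<in> space M. a \<le> (\<Sum>j<n. \<bar>X (j, True) \<omega>\<bar>)}
    \<le> prob {\<omega> \<in> space M. \<kappa> * \<eta> / 2 * a \<le> (\<Sum>j<n. \<bar>X (j, True) \<omega> - X (j, False) \<omega>\<bar>)}"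
proof -
  have rv [measurable]: "random_variable borel (X i)" if "i \<in> {..<n} \<times> UNIV" for i
    using X that unfolding indep_vars_def2 by blast
  have rvT [measurable]: "random_variable borel (X (j, b))" if "j < n" for j b
    using rv that by simp
  define I where "I b = {..<n} \<times> {b}" for b :: bool
  define P where "P b = (\<Pi>\<^sub>M i\<in>I b. (borel :: real measure))" for b
  define R where "R b \<omega> = (\<lambda>i\<in>I b. X i \<omega>)" for b \<omega>
  have R [measurable]: "R b \<in> M \<rightarrow>\<^sub>M P b" for b
    unfolding R_def P_def by (intro measurable_restrict rv) (auto simp: I_def)
  have comp [measurable]: "(\<lambda>r. r (j, b)) \<in> P b \<rightarrow>\<^sub>M borel" if "j < n" for j b
    unfolding P_def using that by (intro measurable_component_singleton) (auto simp: I_def)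
  have "indep_var (P True) (R True) (P False) (R False)"
    unfolding P_def R_def by (rule indep_var_restrict[OF X]) (auto simp: I_def)
  then have pair: "distr M (P True) (R True) \<Otimes>\<^sub>M distr M (P False) (R False) =
      distr M (P True \<Otimes>\<^sub>M P False) (\<lambda>\<omega>. (R True \<omega>, R False \<omega>))"
    unfolding indep_var_distribution_eq by blast
  interpret D1: prob_space "distr M (P True) (R True)" by (rule prob_space_distr) (rule R)
  interpret D2: prob_space "distr M (P False) (R False)" by (rule prob_space_distr) (rule R)
  define s where "s = \<kappa> * \<eta> / 2 * a"
  define A where "A = {r \<in> space (P True). a \<le> (\<Sum>j<n. \<bar>r (j, True)\<bar>)}"
  define E where "E = {z \<in> space (P True \<Otimes>\<^sub>M P False).
     a \<le> (\<Sum>j<n. \<bar>fst z (j, True)\<bar>) \<and> s \<le> (\<Sum>j<n. \<bar>fst z (j, True) - snd z (j, False)\<bar>)}"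
  have cf [measurable]: "(\<lambda>z. fst z (j, True)) \<in> P True \<Otimes>\<^sub>M P False \<rightarrow>\<^sub>M borel"
    "(\<lambda>z. snd z (j, False)) \<in> P True \<Otimes>\<^sub>M P False \<rightarrow>\<^sub>M borel" if "j < n" for j
    using measurable_compose[OF measurable_fst comp[OF that, of True]]
      measurable_compose[OF measurable_snd comp[OF that, of False]] by auto
  have A [measurable]: "A \<in> sets (P True)" unfolding A_def by measurable
  have E [measurable]: "E \<in> sets (P True \<Otimes>\<^sub>M P False)" unfolding E_def by measurable
  have inner: "ennreal (\<eta> / 2) \<le> emeasure (distr M (P False) (R False)) (Pair r -` E)" if r: "r \<in> A" for r
  proof -
    define c where "c j = \<kappa> * \<bar>r (j, True)\<bar>" for j
    define B where "B j = {\<omega> \<in> space M. c j \<le> \<bar>r (j, True) - X (j, False) \<omega>\<bar>}" for j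
    have B: "B j \<in> events" if "j < n" for j unfolding B_def using that by measurable
    have "\<eta> / 2 \<le> prob {\<omega> \<in> space M. \<eta> / 2 * (\<Sum>j<n. c j) \<le> (\<Sum>j<n. c j * indicator (B j) \<omega>)}"
      by (rule prob_sum_ge_half_mean) (use \<kappa> \<eta> B spread in \<open>auto simp: c_def B_def\<close>)
    also have "\<dots> \<le> prob {\<omega> \<in> space M. s \<le> (\<Sum>j<n. \<bar>r (j, True) - X (j, False) \<omega>\<bar>)}"
    proof (rule finite_measure_mono)
      have h1: "s \<le> \<eta> / 2 * (\<Sum>j<n. c j)"
        using r \<kappa> \<eta> unfolding s_def A_def c_def by (simp add: sum_distrib_left[symmetric] mult_left_mono)
      have h2: "(\<Sum>j<n. c j * indicator (B j) \<omega>) \<le> (\<Sum>j<n. \<bar>r (j, True) - X (j, False) \<omega>\<bar>)" for \<omega>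
        by (intro sum_mono) (auto simp: B_def indicator_def)
      show "{\<omega> \<in> space M. \<eta> / 2 * (\<Sum>j<n. c j) \<le> (\<Sum>j<n. c j * indicator (B j) \<omega>)}
         \<subseteq> {\<omega> \<in> space M. s \<le> (\<Sum>j<n. \<bar>r (j, True) - X (j, False) \<omega>\<bar>)}"
        by (intro Collect_mono conj_mono imp_refl impI) (rule order_trans[OF h1 order_trans[OF _ h2]])
    qed measurable
    also have "{\<omega> \<in> space M. s \<le> (\<Sum>j<n. \<bar>r (j, True) - X (j, False) \<omega>\<bar>)} =
        R False -` (Pair r -` E) \<inter> space M"
    proof -
      have "R False \<omega> \<in> space (P False)" if "\<omega> \<in> space M" for \<omega> using R that by (rule measurable_space)
      then show ?thesis using r unfolding E_def A_def by (auto simp: space_pair_measure R_def I_def)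
    qed
    finally show ?thesis
      using sets_Pair1[OF E] by (simp add: emeasure_distr emeasure_eq_measure ennreal_leI)
  qed
  have "ennreal (\<eta> / 2) * emeasure M {\<omega> \<in> space M. a \<le> (\<Sum>j<n. \<bar>X (j, True) \<omega>\<bar>)} =
      (\<integral>\<^sup>+r. ennreal (\<eta> / 2) * indicator A r \<partial>distr M (P True) (R True))"
  proof -
    have "R True -` A \<inter> space M = {\<omega> \<in> space M. a \<le> (\<Sum>j<n. \<bar>X (j, True) \<omega>\<bar>)}"
    proof -
      have "R True \<omega> \<in> space (P True)" if "\<omega> \<in> space M" for \<omega> using R that by (rule measurable_space)
      then show ?thesis unfolding A_def by (auto simp: R_def I_def)
    qed
    then show ?thesis by (simp add: nn_integral_cmult_indicator emeasure_distr)
  qed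
  also have "\<dots> \<le> (\<integral>\<^sup>+r. emeasure (distr M (P False) (R False)) (Pair r -` E) \<partial>distr M (P True) (R True))"
    by (intro nn_integral_mono) (auto simp: indicator_def inner)
  also have "\<dots> = emeasure (distr M (P True) (R True) \<Otimes>\<^sub>M distr M (P False) (R False)) E"
    by (rule D2.emeasure_pair_measure_alt[symmetric]) (simp add: cong: sets_pair_measure_cong)
  also have "\<dots> = emeasure M ((\<lambda>\<omega>. (R True \<omega>, R False \<omega>)) -` E \<inter> space M)"
    unfolding pair by (rule emeasure_distr) auto
  also have "\<dots> \<le> emeasure M {\<omega> \<in> space M. s \<le> (\<Sum>j<n. \<bar>X (j, True) \<omega> - X (j, False) \<omega>\<bar>)}"
    by (rule emeasure_mono) (auto simp: E_def R_def I_def)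
  finally show ?thesis
    using \<eta> unfolding s_def emeasure_eq_measure
    by (subst (asm) ennreal_mult[symmetric]) auto
qed

text \<open>Exchanging the two rows in a set of columns preserves the joint law and changes the
  signs of the differences in these columns. Averaging over all sets of columns reduces the claim
  to Khinchine's inequality for fixed differences.\<close>

lemma row_pair_gain:
  fixes X :: "nat \<times> bool \<Rightarrow> 'a \<Rightarrow> real"
  assumes X: "indep_vars (\<lambda>_. borel) X ({..<n} \<times> UNIV)"
    and law: "\<And>i. i \<in> {..<n} \<times> UNIV \<Longrightarrow> distr M borel (X i) = \<mu>" and n: "n > 0"
  shows "prob {\<omega> \<in> space M. s \<le> (\<Sum>j<n. \<bar>X (j, True) \<omega> - X (j, False) \<omega>\<bar>)} / 10
    \<le> prob {\<omega> \<in> space M. s / (2 * sqrt n) \<le> (\<Sum>j<n. X (j, True) \<omega> - X (j, False) \<omega>)}"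
proof -
  define I where "I = {..<n} \<times> (UNIV :: bool set)"
  have rv [measurable]: "random_variable borel (X i)" if "i \<in> I" for i
    using X that unfolding indep_vars_def2 I_def by blast
  have rvT [measurable]: "random_variable borel (X (j, b))" if "j < n" for j b
    using rv that by (simp add: I_def)
  define d where "d \<omega> j = X (j, True) \<omega> - X (j, False) \<omega>" for \<omega> j
  have [measurable]: "(\<lambda>\<omega>. d \<omega> j) \<in> borel_measurable M" if "j < n" for j
    unfolding d_def using that by measurable
  define \<beta> where "\<beta> = s / (2 * sqrt n)"
  define B where "B = {\<omega> \<in> space M. s \<le> (\<Sum>j<n. \<bar>d \<omega> j\<bar>)}"
  have [measurable]: "B \<in> events" unfolding B_def by measurable
  define G where "G u = {\<omega> \<in> space M. \<beta> \<le> signed_sum n (d \<omega>) u \<and> s \<le> (\<Sum>j<n. \<bar>d \<omega> j\<bar>)}" for u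
  have G [measurable]: "G u \<in> events" for u
    unfolding G_def signed_sum_def by measurable
  have same: "prob (G u) = prob (G {})" if u: "u \<subseteq> {..<n}" for u
  proof -
    define f where "f v i = (fst i, snd i \<noteq> (fst i \<in> v))" for v :: "nat set" and i :: "nat \<times> bool"
    define N where "N = (\<Pi>\<^sub>M i\<in>I. (borel :: real measure))"
    define Q where "Q = {x \<in> space N. \<beta> \<le> (\<Sum>j<n. x (j, True) - x (j, False)) \<and>
        s \<le> (\<Sum>j<n. \<bar>x (j, True) - x (j, False)\<bar>)}"
    have [measurable]: "(\<lambda>x. x (j, b)) \<in> N \<rightarrow>\<^sub>M borel" if "j < n" for j b
      unfolding N_def using that by (intro measurable_component_singleton) (auto simp: I_def)
    have Q: "Q \<in> sets N" unfolding Q_def by measurable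
    have "prob (G v) = measure (\<Pi>\<^sub>M i\<in>I. \<mu>) Q" for v
    proof -
      have "I \<subseteq> f v ` I"
      proof
        fix i assume "i \<in> I"
        then show "i \<in> f v ` I" by (intro image_eqI[where x = "f v i"]) (auto simp: f_def I_def)
      qed
      then have im: "f v ` I = I" by (auto simp: f_def I_def)
      have "distr M N (\<lambda>\<omega>. \<lambda>i\<in>I. X (f v i) \<omega>) = (\<Pi>\<^sub>M i\<in>I. \<mu>)" unfolding N_def
      proof (rule distr_reindexed_family)
        show "indep_vars (\<lambda>_. borel) X (f v ` I)" unfolding im using X by (simp add: I_def)
        show "inj_on (f v) I" by (auto simp: f_def inj_on_def)
        show "I \<noteq> {}" using n by (auto simp: I_def)
        show "distr M borel (X (f v i)) = \<mu>" if "i \<in> I" for i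
          using law[of "f v i"] im that unfolding I_def by blast
      qed
      moreover have mf: "(\<lambda>\<omega>. \<lambda>i\<in>I. X (f v i) \<omega>) \<in> M \<rightarrow>\<^sub>M N"
        unfolding N_def using im by (intro measurable_restrict rv) blast
      moreover have "(\<lambda>\<omega>. \<lambda>i\<in>I. X (f v i) \<omega>) -` Q \<inter> space M = G v"
      proof -
        have sp: "(\<lambda>i\<in>I. X (f v i) \<omega>) \<in> space N" if "\<omega> \<in> space M" for \<omega>
          using measurable_space[OF mf that] .
        have "(\<Sum>j<n. X (f v (j, True)) \<omega> - X (f v (j, False)) \<omega>) = signed_sum n (d \<omega>) v" for \<omega>
          unfolding signed_sum_def by (rule sum.cong) (auto simp: f_def d_def)
        moreover have "(\<Sum>j<n. \<bar>X (f v (j, True)) \<omega> - X (f v (j, False)) \<omega>\<bar>) = (\<Sum>j<n. \<bar>d \<omega> j\<bar>)" for \<omega>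
        proof (rule sum.cong)
          show "\<bar>X (f v (j, True)) \<omega> - X (f v (j, False)) \<omega>\<bar> = \<bar>d \<omega> j\<bar>" for j
            by (cases "j \<in> v") (simp_all add: f_def d_def abs_minus_commute)
        qed simp
        ultimately show ?thesis using sp unfolding Q_def G_def by (auto simp: I_def)
      qed
      ultimately show ?thesis using measure_distr[OF mf Q] by simp
    qed
    then show ?thesis by simp
  qed
  have "2 ^ n * (prob B / 10) = expectation (\<lambda>\<omega>. 2 ^ n / 10 * indicator B \<omega>)" by simp
  also have "\<dots> \<le> expectation (\<lambda>\<omega>. \<Sum>u\<in>Pow {..<n}. indicator (G u) \<omega>)"
  proof (rule integral_mono)
    show "integrable M (\<lambda>\<omega>. \<Sum>u\<in>Pow {..<n}. indicator (G u) \<omega> :: real)"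
      by (intro Bochner_Integration.integrable_sum integrable_indicator G)
    fix \<omega> assume \<omega>: "\<omega> \<in> space M"
    show "2 ^ n / 10 * indicator B \<omega> \<le> (\<Sum>u\<in>Pow {..<n}. indicator (G u) \<omega> :: real)"
    proof (cases "\<omega> \<in> B")
      case True
      have "2 ^ n / 10 \<le> real (card {u \<in> Pow {..<n}. (\<Sum>j<n. \<bar>d \<omega> j\<bar>) / (2 * sqrt n) \<le> signed_sum n (d \<omega>) u})"
        by (rule khinchine[OF n])
      also have "\<dots> \<le> real (card {u \<in> Pow {..<n}. \<omega> \<in> G u})"
      proof -
        have "\<beta> \<le> (\<Sum>j<n. \<bar>d \<omega> j\<bar>) / (2 * sqrt n)"
          using True by (auto simp: B_def \<beta>_def intro!: divide_right_mono)
        then show ?thesis using True \<omega> by (intro of_nat_mono card_mono) (auto simp: G_def B_def)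
      qed
      also have "\<dots> = (\<Sum>u\<in>Pow {..<n}. indicator (G u) \<omega>)"
        by (simp add: indicator_def sum.If_cases Int_def)
      finally show ?thesis using True by simp
    qed (simp add: sum_nonneg)
  qed (simp add: integrable_indicator)
  also have "\<dots> = (\<Sum>u\<in>Pow {..<n}. prob (G u))"
    by (subst Bochner_Integration.integral_sum) (auto simp: integrable_indicator)
  also have "\<dots> = (\<Sum>u\<in>Pow {..<n}. prob (G {}))"
    by (intro sum.cong refl same) blast
  also have "\<dots> = 2 ^ n * prob (G {})" by (simp add: card_Pow)
  finally have "prob B / 10 \<le> prob (G {})" by (rule mult_left_le_imp_le) simp
  also have "\<dots> \<le> prob {\<omega> \<in> space M. \<beta> \<le> (\<Sum>j<n. d \<omega> j)}"
    by (rule finite_measure_mono) (auto simp: G_def signed_sum_def)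
  finally show ?thesis by (simp add: B_def \<beta>_def d_def)
qed

end

section \<open>Costs and gains at a large scale\<close>

text \<open>The weights \<open>W\<^sub>e\<close> in coordinates: \<open>(z, True)\<close> stands
  for the edge from \<open>z\<close> to its right neighbour and \<open>(z, False)\<close> for the
  edge from \<open>z\<close> to its upper neighbour. Vertical weights may have another law than
  \<open>\<mu>\<close>, but their absolute values have the same law as those of the horizontal
  ones.\<close>

locale lattice_field = prob_space M
  for M :: "'w measure" +
  fixes W :: "vertex \<times> bool \<Rightarrow> 'w \<Rightarrow> real" and \<mu> :: "real measure"
  assumes indep: "indep_vars (\<lambda>_. borel) W UNIV"
    and law_horizontal: "\<And>p. distr M borel (W (p, True)) = \<mu>"
    and law_abs: "\<And>e. distr M borel (\<lambda>\<omega>. \<bar>W e \<omega>\<bar>) = distr \<mu> borel abs"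
    and nonconstant: "\<exists>t. 0 < measure \<mu> {..t} \<and> measure \<mu> {..t} < 1"
begin

lemma W_meas [measurable]: "random_variable borel (W e)"
  using indep unfolding indep_vars_def2 by blast

lemma W_law: "prob {\<omega> \<in> space M. P (W (p, True) \<omega>)} = measure \<mu> {x. P x}" if "{x. P x} \<in> sets borel"
  unfolding law_horizontal[of p, symmetric] using that
  by (subst measure_distr) (auto intro!: arg_cong[where f = prob])

definition cost :: "(vertex \<times> bool) set \<Rightarrow> 'w \<Rightarrow> real" where
  "cost E \<omega> = (\<Sum>e\<in>E. \<bar>W e \<omega>\<bar>)"

lemma cost_meas [measurable]: "cost E \<in> borel_measurable M"
  unfolding cost_def by measurable

text \<open>The law of the cost of a set of edges depends only on its size, since the
  \<open>\<bar>W\<^sub>e\<bar>\<close> are independent and identically distributed. So all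
  quantiles can be taken for one reference row.\<close>

lemma cost_law:
  assumes "finite E" "finite E'" "card E = card E'" "E \<noteq> {}" "Q \<in> sets borel"
  shows "prob {\<omega> \<in> space M. cost E \<omega> \<in> Q} = prob {\<omega> \<in> space M. cost E' \<omega> \<in> Q}"
proof -
  define k where "k = card E"
  have k: "k > 0" using assms(1,4) by (simp add: k_def card_gt_0_iff)
  define N where "N = (\<Pi>\<^sub>M i\<in>{..<k}. (borel :: real measure))"
  have cm [measurable]: "(\<lambda>x. x j) \<in> N \<rightarrow>\<^sub>M borel" if "j < k" for j
    unfolding N_def using that by (intro measurable_component_singleton) auto
  define S where "S = {x \<in> space N. (\<Sum>j<k. x j) \<in> Q}"
  have S: "S \<in> sets N"
  proof -
    have "(\<lambda>x. \<Sum>j<k. x j) \<in> N \<rightarrow>\<^sub>M borel" by (intro borel_measurable_sum cm) auto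
    then have "(\<lambda>x. \<Sum>j<k. x j) -` Q \<inter> space N \<in> sets N" using assms(5) by (rule measurable_sets)
    then show ?thesis unfolding S_def by (simp add: vimage_def Int_def conj_commute)
  qed
  have "prob {\<omega> \<in> space M. cost F \<omega> \<in> Q} = measure (\<Pi>\<^sub>M i\<in>{..<k}. distr \<mu> borel abs) S"
    if F: "finite F" "card F = k" for F
  proof -
    obtain f where f: "bij_betw f {..<k} F"
      using F ex_bij_betw_nat_finite[of F] by (auto simp: lessThan_atLeast0)
    have inj: "inj_on f {..<k}" and im: "f ` {..<k} = F" using f by (auto simp: bij_betw_def)
    have "indep_vars (\<lambda>_. borel) (\<lambda>e \<omega>. \<bar>W e \<omega>\<bar>) UNIV"
      by (rule indep_vars_compose2[OF indep]) measurable
    then have "indep_vars (\<lambda>_. borel) (\<lambda>e \<omega>. \<bar>W e \<omega>\<bar>) (f ` {..<k})"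
      by (rule indep_vars_subset) simp
    from distr_reindexed_family[OF this inj, of "distr \<mu> borel abs"]
    have d: "distr M N (\<lambda>\<omega>. \<lambda>i\<in>{..<k}. \<bar>W (f i) \<omega>\<bar>) = (\<Pi>\<^sub>M i\<in>{..<k}. distr \<mu> borel abs)"
      using k law_abs unfolding N_def by (auto simp: lessThan_empty_iff)
    have mf: "(\<lambda>\<omega>. \<lambda>i\<in>{..<k}. \<bar>W (f i) \<omega>\<bar>) \<in> M \<rightarrow>\<^sub>M N"
      unfolding N_def by (intro measurable_restrict) measurable
    have cost: "cost F \<omega> = (\<Sum>j<k. \<bar>W (f j) \<omega>\<bar>)" for \<omega>
      unfolding cost_def im[symmetric] using inj by (simp add: sum.reindex)
    have "(\<lambda>\<omega>. \<lambda>i\<in>{..<k}. \<bar>W (f i) \<omega>\<bar>) -` S \<inter> space M = {\<omega> \<in> space M. cost F \<omega> \<in> Q}"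
      using measurable_space[OF mf] unfolding S_def cost by auto
    then show ?thesis using measure_distr[OF mf S] d by simp
  qed
  then show ?thesis using assms k_def by simp
qed

definition base_row :: "nat \<Rightarrow> (vertex \<times> bool) set" where
  "base_row n = (\<lambda>j. ((int j, 0), True)) ` {..<n}"

lemma base_row: "finite (base_row n)" "card (base_row n) = n"
  unfolding base_row_def by (auto simp: card_image inj_on_def)

lemma cost_mono: "E \<subseteq> F \<Longrightarrow> finite F \<Longrightarrow> cost E \<omega> \<le> cost F \<omega>"
  unfolding cost_def by (rule sum_mono2) auto

lemma cost_nonneg: "cost E \<omega> \<ge> 0"
  unfolding cost_def by (rule sum_nonneg) auto

lemma cost_tail_le_row:
  assumes E: "finite E" "card E \<le> n" and n: "n > 0"
  shows "prob {\<omega> \<in> space M. cost E \<omega> > a} \<le> prob {\<omega> \<in> space M. cost (base_row n) \<omega> > a}"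
proof -
  have "infinite (UNIV - E :: (vertex \<times> bool) set)"
    using E by (intro Diff_infinite_finite) (auto simp: finite_prod)
  then obtain F where F: "F \<subseteq> UNIV - E" "finite F" "card F = n - card E"
    using infinite_arbitrarily_large by blast
  have c: "card (E \<union> F) = n" using F E by (subst card_Un_disjoint) auto
  then have ne: "E \<union> F \<noteq> {}" using n by auto
  have "prob {\<omega> \<in> space M. cost E \<omega> > a} \<le> prob {\<omega> \<in> space M. cost (E \<union> F) \<omega> > a}"
    using F E by (intro finite_measure_mono) (auto intro: less_le_trans[OF _ cost_mono])
  also have "\<dots> = prob {\<omega> \<in> space M. cost (base_row n) \<omega> > a}"
    using cost_law[of "E \<union> F" "base_row n" "{a<..}"] base_row[of n] F(2) E(1) ne unfolding c by auto
  finally show ?thesis .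
qed

text \<open>A set of \<open>g n\<close> edges splits into \<open>g\<close> groups of
  \<open>n\<close>; if its cost exceeds \<open>g a\<close>, some group costs more than
  \<open>a\<close>.\<close>

lemma cost_tail_multiple:
  assumes E: "finite E" "card E \<le> g * n" and n: "n > 0" and g: "g > 0"
  shows "prob {\<omega> \<in> space M. cost E \<omega> > real g * a} \<le> g * prob {\<omega> \<in> space M. cost (base_row n) \<omega> > a}"
  using g E
proof (induction g arbitrary: E rule: nat_induct_non_zero)
  case 1 then show ?case using cost_tail_le_row[of E n a] n by simp
next
  case (Suc g)
  have "min n (card E) \<le> card E" by simp
  then obtain F where F: "F \<subseteq> E" "card F = min n (card E)" and fF: "finite F"
    by (rule obtain_subset_with_card_n)
  have "card (E - F) = card E - card F" using F fF by (simp add: card_Diff_subset)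
  then have "card (E - F) \<le> g * n" using F Suc.prems by (auto simp: min_def split: if_splits)
  then have IH: "prob {\<omega> \<in> space M. cost (E - F) \<omega> > real g * a} \<le> g * prob {\<omega> \<in> space M. cost (base_row n) \<omega> > a}"
    using Suc by auto
  have split: "cost E \<omega> = cost (E - F) \<omega> + cost F \<omega>" for \<omega>
    unfolding cost_def using F Suc.prems by (metis sum.subset_diff)
  have "prob {\<omega> \<in> space M. cost E \<omega> > real (Suc g) * a} \<le>
     prob ({\<omega> \<in> space M. cost (E - F) \<omega> > real g * a} \<union> {\<omega> \<in> space M. cost F \<omega> > a})"
    by (rule finite_measure_mono) (auto simp: split algebra_simps)
  also have "\<dots> \<le> prob {\<omega> \<in> space M. cost (E - F) \<omega> > real g * a} + prob {\<omega> \<in> space M. cost F \<omega> > a}"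
    by (rule measure_Un_le) auto
  also have "\<dots> \<le> g * prob {\<omega> \<in> space M. cost (base_row n) \<omega> > a} + prob {\<omega> \<in> space M. cost (base_row n) \<omega> > a}"
    using IH cost_tail_le_row[of F n a] fF F n by simp
  finally show ?case by (simp add: algebra_simps)
qed

text \<open>Take the infimum \<open>a\<close> of the thresholds that are exceeded with probability
  at most \<open>c\<close>. If \<open>a > 0\<close>, then \<open>a / 2\<close> is not among them;
  if \<open>a = 0\<close>, the last bound is trivial.\<close>

lemma row_quantile:
  assumes c: "0 < c" "c < 1" and n: "n > 0"
  obtains a where "a \<ge> 0" "prob {\<omega> \<in> space M. cost (base_row n) \<omega> > a} \<le> c"
    "prob {\<omega> \<in> space M. cost (base_row n) \<omega> \<ge> a / 2} \<ge> c"
proof -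
  define p where "p x = prob {\<omega> \<in> space M. cost (base_row n) \<omega> > x}" for x
  define S where "S = {x. 0 \<le> x \<and> p x \<le> c}"
  have anti: "p y \<le> p x" if "x \<le> y" for x y
    unfolding p_def using that by (intro finite_measure_mono) auto
  have "(\<lambda>k::nat. p (real k)) \<longlonglongrightarrow> prob (\<Inter>k::nat. {\<omega> \<in> space M. cost (base_row n) \<omega> > k})"
    unfolding p_def by (rule finite_Lim_measure_decseq) (auto simp: decseq_def)
  moreover have "(\<Inter>k::nat. {\<omega> \<in> space M. cost (base_row n) \<omega> > k}) = {}"
  proof -
    have "\<not> (\<forall>k. real k < x)" for x
      using reals_Archimedean2[of x] by (meson less_asym)
    then show ?thesis by blast
  qed
  ultimately have "(\<lambda>k::nat. p (real k)) \<longlonglongrightarrow> 0" by simp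
  then have "\<forall>\<^sub>F k in sequentially. p (real k) < c" using c by (intro order_tendstoD) auto
  then obtain k :: nat where "p (real k) < c" by (meson eventually_sequentially order_refl)
  then have ne: "S \<noteq> {}" unfolding S_def by (auto intro!: exI[of _ "real k"])
  have bdd: "bdd_below S" unfolding S_def by (rule bdd_belowI[of _ 0]) auto
  define a where "a = Inf S"
  have a0: "a \<ge> 0" unfolding a_def using ne by (rule cInf_greatest) (auto simp: S_def)
  have above: "p x \<le> c" if x: "x > a" for x
  proof -
    obtain y where "y \<in> S" "y < x" using cInf_less_iff[OF ne bdd, of x] x unfolding a_def by blast
    then show ?thesis using anti[of y x] by (auto simp: S_def)
  qed
  have "p a \<le> c"
  proof -
    have "(\<lambda>k. p (a + 1 / real (Suc k))) \<longlonglongrightarrow> prob (\<Union>k. {\<omega> \<in> space M. cost (base_row n) \<omega> > a + 1 / real (Suc k)})"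
      unfolding p_def
    proof (rule finite_Lim_measure_incseq)
      have "1 / real (Suc l) \<le> 1 / real (Suc k)" if "k \<le> l" for k l
        using that by (intro divide_left_mono) auto
      then show "incseq (\<lambda>k. {\<omega> \<in> space M. cost (base_row n) \<omega> > a + 1 / real (Suc k)})"
        unfolding incseq_def by (smt (verit) Collect_mono)
    qed auto
    moreover have "(\<Union>k. {\<omega> \<in> space M. cost (base_row n) \<omega> > a + 1 / real (Suc k)}) = {\<omega> \<in> space M. cost (base_row n) \<omega> > a}"
    proof safe
      fix \<omega> k assume "a + 1 / real (Suc k) < cost (base_row n) \<omega>"
      moreover have "0 < 1 / real (Suc k)" by simp
      ultimately show "a < cost (base_row n) \<omega>" by linarith
    next
      fix \<omega> assume w: "a < cost (base_row n) \<omega>" "\<omega> \<in> space M"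
      then obtain k where "1 / real (Suc k) < cost (base_row n) \<omega> - a"
        using nat_approx_posE[of "cost (base_row n) \<omega> - a"] by auto
      then show "\<omega> \<in> (\<Union>k. {\<omega> \<in> space M. cost (base_row n) \<omega> > a + 1 / real (Suc k)})" using w by (auto intro!: exI[of _ k])
    qed
    ultimately have "(\<lambda>k. p (a + 1 / real (Suc k))) \<longlonglongrightarrow> p a" by (simp add: p_def)
    then show ?thesis by (rule LIMSEQ_le_const2) (auto intro!: above exI[of _ 0])
  qed
  moreover have "prob {\<omega> \<in> space M. cost (base_row n) \<omega> \<ge> a / 2} \<ge> c"
  proof (cases "a = 0")
    case True
    then show ?thesis using c cost_nonneg by (simp add: prob_space)
  next
    case False
    then have "a / 2 \<notin> S" unfolding a_def using a0 cInf_lower[OF _ bdd, of "a / 2"] by (auto simp: a_def)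
    then have "c \<le> p (a / 2)" using a0 by (auto simp: S_def)
    also have "\<dots> \<le> prob {\<omega> \<in> space M. cost (base_row n) \<omega> \<ge> a / 2}"
      unfolding p_def by (intro finite_measure_mono) auto
    finally show ?thesis .
  qed
  ultimately show ?thesis using a0 that by (simp add: p_def)
qed

text \<open>\<open>f (j, True)\<close> and \<open>f (j, False)\<close> are the \<open>j\<close>-th
  edges of the two rows of a detour.\<close>

definition strip_diff :: "nat \<Rightarrow> (nat \<times> bool \<Rightarrow> vertex \<times> bool) \<Rightarrow> 'w \<Rightarrow> real" where
  "strip_diff n f \<omega> = (\<Sum>j<n. W (f (j, True)) \<omega> - W (f (j, False)) \<omega>)"

lemma strip_diff_meas [measurable]: "strip_diff n f \<in> borel_measurable M"
  unfolding strip_diff_def by measurable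

text \<open>\<open>row_pair_spread\<close> and \<open>row_pair_gain\<close> put together: a row
  costs at least \<open>a\<close> with probability \<open>c\<close>, then the row differences have
  a sum of absolute values of order \<open>a\<close>, and then their sum is of order \<open>a /
  \<surd>n\<close>.\<close>

lemma strip_gain:
  assumes spread: "\<And>w. measure \<mu> {x. \<kappa> * \<bar>w\<bar> \<le> \<bar>w - x\<bar>} \<ge> \<eta>" and \<kappa>: "\<kappa> > 0" and \<eta>: "\<eta> \<ge> 0" "\<eta> \<le> 1"
    and f: "inj_on f ({..<n} \<times> UNIV)" "\<And>i. snd (f i)" and n: "n > 0"
    and a: "prob {\<omega> \<in> space M. cost (base_row n) \<omega> \<ge> a} \<ge> c"
  shows "prob {\<omega> \<in> space M. \<kappa> * \<eta> * a / (4 * sqrt n) \<le> strip_diff n f \<omega>} \<ge> \<eta> * c / 20"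
proof -
  have fT: "f i = (fst (f i), True)" for i using f(2)[of i] by (cases "f i") auto
  have ind: "indep_vars (\<lambda>_. borel) (\<lambda>i. W (f i)) ({..<n} \<times> UNIV)"
    by (rule indep_vars_reindex[OF f(1) indep_vars_subset[OF indep]]) simp
  have law: "distr M borel (W (f i)) = \<mu>" for i by (subst fT) (rule law_horizontal)
  have sp: "\<eta> \<le> prob {\<omega> \<in> space M. \<kappa> * \<bar>w\<bar> \<le> \<bar>w - W (f (j, False)) \<omega>\<bar>}" for w j
  proof -
    have "prob {\<omega> \<in> space M. \<kappa> * \<bar>w\<bar> \<le> \<bar>w - W (fst (f (j, False)), True) \<omega>\<bar>} = measure \<mu> {x. \<kappa> * \<bar>w\<bar> \<le> \<bar>w - x\<bar>}"
      by (rule W_law) measurable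
    then show ?thesis using spread[of w] fT[of "(j, False)"] by simp
  qed
  let ?E = "(\<lambda>j. f (j, True)) ` {..<n}"
  have inj: "inj_on (\<lambda>j. f (j, True)) {..<n}" using f(1) by (auto simp: inj_on_def)
  have E: "finite ?E" "card ?E = n" using inj by (auto simp: card_image)
  have cE: "cost ?E \<omega> = (\<Sum>j<n. \<bar>W (f (j, True)) \<omega>\<bar>)" for \<omega>
    unfolding cost_def using inj by (simp add: sum.reindex)
  have "c \<le> prob {\<omega> \<in> space M. a \<le> cost ?E \<omega>}"
  proof -
    have "?E \<noteq> {}" using n by (auto simp: lessThan_empty_iff)
    then show ?thesis using a cost_law[of ?E "base_row n" "{a..}"] E base_row by auto
  qed
  then have "\<eta> / 2 * c \<le> \<eta> / 2 * prob {\<omega> \<in> space M. a \<le> (\<Sum>j<n. \<bar>W (f (j, True)) \<omega>\<bar>)}"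
    unfolding cE using \<eta> by (intro mult_left_mono) auto
  also have "\<dots> \<le> prob {\<omega> \<in> space M. \<kappa> * \<eta> / 2 * a \<le> (\<Sum>j<n. \<bar>W (f (j, True)) \<omega> - W (f (j, False)) \<omega>\<bar>)}"
    by (rule row_pair_spread[OF ind]) (use sp \<kappa> \<eta> in auto)
  finally have "\<eta> / 2 * c / 10 \<le> prob {\<omega> \<in> space M. \<kappa> * \<eta> / 2 * a \<le> (\<Sum>j<n. \<bar>W (f (j, True)) \<omega> - W (f (j, False)) \<omega>\<bar>)} / 10"
    by (rule divide_right_mono) simp
  also have "\<dots> \<le> prob {\<omega> \<in> space M. \<kappa> * \<eta> / 2 * a / (2 * sqrt n) \<le> strip_diff n f \<omega>}"
    unfolding strip_diff_def by (rule row_pair_gain[OF ind _ n]) (rule law)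
  finally show ?thesis by simp
qed

lemma strip_diff_indep:
  assumes f: "inj_on (case_prod f) ({..<n} \<times> ({..<n} \<times> UNIV))"
  shows "indep_vars (\<lambda>_. borel) (\<lambda>t. strip_diff n (f t)) {..<n}"
proof -
  define K where "K t = f t ` ({..<n} \<times> UNIV)" for t
  have disj: "disjoint_family_on K {..<n}"
    unfolding disjoint_family_on_def K_def using f by (fastforce simp: inj_on_def)
  have "indep_vars (\<lambda>t. PiM (K t) (\<lambda>_. borel)) (\<lambda>t \<omega>. \<lambda>e\<in>K t. W e \<omega>) {..<n}"
    by (rule indep_vars_restrict[OF indep _ disj]) simp
  then have "indep_vars (\<lambda>_. borel) (\<lambda>t \<omega>. (\<lambda>x. \<Sum>j<n. x (f t (j, True)) - x (f t (j, False))) (\<lambda>e\<in>K t. W e \<omega>)) {..<n}"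
  proof (rule indep_vars_compose2)
    fix t assume "t \<in> {..<n}"
    show "(\<lambda>x :: vertex \<times> bool \<Rightarrow> real. \<Sum>j<n. x (f t (j, True)) - x (f t (j, False))) \<in> PiM (K t) (\<lambda>_. borel) \<rightarrow>\<^sub>M borel"
    proof (rule borel_measurable_sum, rule borel_measurable_diff)
      fix j assume "j \<in> {..<n}"
      then show "(\<lambda>x. x (f t (j, True))) \<in> PiM (K t) (\<lambda>_. borel) \<rightarrow>\<^sub>M borel"
        "(\<lambda>x. x (f t (j, False))) \<in> PiM (K t) (\<lambda>_. borel) \<rightarrow>\<^sub>M borel"
        by (auto intro!: measurable_component_singleton[of _ "K t" "\<lambda>_. borel"] simp: K_def)
    qed
  qed
  moreover have "(\<Sum>j<n. (\<lambda>e\<in>K t. W e \<omega>) (f t (j, True)) - (\<lambda>e\<in>K t. W e \<omega>) (f t (j, False))) = strip_diff n (f t) \<omega>" for t \<omega>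
    unfolding strip_diff_def by (intro sum.cong) (auto simp: K_def)
  ultimately show ?thesis by simp
qed

text \<open>At the scale \<open>n\<close>, any \<open>4 n\<close> edges cost at most
  \<open>\<Lambda>\<close>, whereas \<open>n\<close> disjoint detours provide a gain of at least
  \<open>4 \<Lambda>\<close>, each up to probability \<open>\<epsilon>\<close>. A gain of \<open>4
  \<Lambda>\<close> suffices because the longest connecting path consists of four pieces of at
  most \<open>4 n\<close> edges.\<close>

definition scale_ok :: "real \<Rightarrow> nat \<Rightarrow> real \<Rightarrow> real \<Rightarrow> bool" where
  "scale_ok \<epsilon> n \<Lambda> \<beta> \<longleftrightarrow> n > 0 \<and> \<beta> \<ge> 0 \<and>
    (\<forall>E. finite E \<longrightarrow> card E \<le> 4 * n \<longrightarrow> prob {\<omega> \<in> space M. cost E \<omega> > \<Lambda>} \<le> \<epsilon>) \<and>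
    (\<forall>f. inj_on (case_prod f) ({..<n} \<times> ({..<n} \<times> UNIV)) \<longrightarrow> (\<forall>t i. snd (f t i)) \<longrightarrow>
       prob {\<omega> \<in> space M. real (card {t. t < n \<and> \<beta> \<le> strip_diff n (f t) \<omega>}) * \<beta> < 4 * \<Lambda>} \<le> \<epsilon>)"

text \<open>Both sides are measured in the quantile \<open>a\<close> of the cost of
  \<open>n\<close> edges: the cost is a constant times \<open>a\<close>, while a positive fraction
  of the \<open>n\<close> detours gain a constant times \<open>a / \<surd>n\<close> each, that is
  \<open>a \<surd>n\<close> altogether. The constants do not depend on \<open>n\<close>.\<close>

lemma scale_exists:
  assumes \<epsilon>: "0 < \<epsilon>" "\<epsilon> < 1"
  obtains n \<Lambda> \<beta> where "scale_ok \<epsilon> n \<Lambda> \<beta>"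
proof -
  obtain t0 where t0: "0 < measure \<mu> {..t0}" "measure \<mu> {..t0} < 1" using nonconstant by blast
  have "prob {\<omega> \<in> space M. W ((0, 0), True) \<omega> \<le> t0} = measure \<mu> {..t0}"
    by (subst W_law) (auto simp: atMost_def)
  then obtain \<kappa> \<eta>0 where \<kappa>: "\<kappa> > 0" and \<eta>0: "\<eta>0 > 0"
    and sp: "\<And>w. prob {\<omega> \<in> space M. \<kappa> * \<bar>w\<bar> \<le> \<bar>w - W ((0, 0), True) \<omega>\<bar>} \<ge> \<eta>0"
    using spread_of_nonconstant[of "W ((0, 0), True)" t0] t0 by auto
  define \<eta> where "\<eta> = min 1 \<eta>0"
  have \<eta>: "0 < \<eta>" "\<eta> \<le> 1" using \<eta>0 by (auto simp: \<eta>_def)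
  have spread: "measure \<mu> {x. \<kappa> * \<bar>w\<bar> \<le> \<bar>w - x\<bar>} \<ge> \<eta>" for w
    using sp[of w] by (subst (asm) W_law) (auto simp: \<eta>_def)
  define c where "c = \<epsilon> / 4"
  have c: "0 < c" "c < 1" using \<epsilon> by (auto simp: c_def)
  define p where "p = \<eta> * c / 20"
  have p: "p > 0" using \<eta> c by (simp add: p_def)
  \<comment> \<open>The first condition on \<open>n\<close> makes the gain large, the second makes
    the tail bound for the number of good detours small.\<close>
  have "filterlim (\<lambda>n::nat. sqrt n) at_top sequentially" 
    by (intro filterlim_compose[OF sqrt_at_top filterlim_real_sequentially])
  then have "\<forall>\<^sub>F n in sequentially. 256 / (p * \<kappa> * \<eta>) \<le> sqrt (real n)"
    by (auto simp: filterlim_at_top)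
  moreover have "\<forall>\<^sub>F n in sequentially. 2 * ln (1 / \<epsilon>) / p\<^sup>2 \<le> real n"
    using filterlim_real_sequentially by (auto simp: filterlim_at_top)
  moreover have "\<forall>\<^sub>F n in sequentially. n > (0 :: nat)" by (rule eventually_gt_at_top)
  ultimately have "\<forall>\<^sub>F n in sequentially. 256 / (p * \<kappa> * \<eta>) \<le> sqrt (real n) \<and> 2 * ln (1 / \<epsilon>) / p\<^sup>2 \<le> real n \<and> n > 0"
    by eventually_elim auto
  then obtain n :: nat where n: "256 / (p * \<kappa> * \<eta>) \<le> sqrt (real n)" "2 * ln (1 / \<epsilon>) / p\<^sup>2 \<le> real n" "n > 0"
    using eventually_happens'[OF sequentially_bot] by blast
  obtain a where a: "a \<ge> 0" "prob {\<omega> \<in> space M. cost (base_row n) \<omega> > a} \<le> c"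
    "prob {\<omega> \<in> space M. cost (base_row n) \<omega> \<ge> a / 2} \<ge> c"
    using row_quantile[OF c n(3)] by blast
  define \<beta> where "\<beta> = \<kappa> * \<eta> * (a / 2) / (4 * sqrt n)"
  have \<beta>: "\<beta> \<ge> 0" using \<kappa> \<eta> a by (simp add: \<beta>_def)
  \<comment> \<open>\<open>16 a = 4 \<Lambda>\<close> for the choice \<open>\<Lambda> = 4
    a\<close>, which is the cost of four groups of \<open>n\<close> edges.\<close>
  have big: "16 * a \<le> n * p / 2 * \<beta>"
  proof -
    have "256 \<le> sqrt n * (p * \<kappa> * \<eta>)" using n(1) p \<kappa> \<eta> by (simp add: field_simps)
    then have "256 * a \<le> sqrt n * (p * \<kappa> * \<eta>) * a" using a by (intro mult_right_mono) auto
    moreover have "n * p / 2 * \<beta> = sqrt n * (p * \<kappa> * \<eta>) * a / 16"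
      using n(3) real_div_sqrt[of "real n"] unfolding \<beta>_def by (simp add: field_simps)
    ultimately show ?thesis by linarith
  qed
  have small: "exp (- (n * p\<^sup>2 / 2)) \<le> \<epsilon>"
  proof -
    have "ln (1 / \<epsilon>) \<le> n * p\<^sup>2 / 2" using n(2) p by (simp add: field_simps)
    then have "- (n * p\<^sup>2 / 2) \<le> ln \<epsilon>" using \<epsilon> by (simp add: ln_div)
    then have "exp (- (n * p\<^sup>2 / 2)) \<le> exp (ln \<epsilon>)" by simp
    then show ?thesis using \<epsilon> by simp
  qed
  have "scale_ok \<epsilon> n (4 * a) \<beta>"
    unfolding scale_ok_def
  proof (intro conjI allI impI)
    fix E :: "(vertex \<times> bool) set" assume E: "finite E" "card E \<le> 4 * n"
    have "prob {\<omega> \<in> space M. cost E \<omega> > real 4 * a} \<le> real 4 * prob {\<omega> \<in> space M. cost (base_row n) \<omega> > a}"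
      by (rule cost_tail_multiple[OF E n(3)]) simp
    also have "\<dots> \<le> 4 * c" using a by simp
    finally show "prob {\<omega> \<in> space M. cost E \<omega> > 4 * a} \<le> \<epsilon>" by (simp add: c_def)
  next
    fix f :: "nat \<Rightarrow> nat \<times> bool \<Rightarrow> vertex \<times> bool"
    assume f: "inj_on (case_prod f) ({..<n} \<times> ({..<n} \<times> UNIV))" "\<forall>t i. snd (f t i)"
    have ft: "inj_on (f t) ({..<n} \<times> UNIV)" if "t < n" for t
      using f(1) that by (fastforce simp: inj_on_def)
    have pt: "prob {\<omega> \<in> space M. \<beta> \<le> strip_diff n (f t) \<omega>} \<ge> p" if "t < n" for t
      unfolding \<beta>_def p_def
      by (rule strip_gain[OF spread \<kappa> _ _ ft[OF that] _ n(3) a(3)]) (use \<eta> f in auto)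
    have "prob {\<omega> \<in> space M. real (card {t. t < n \<and> \<beta> \<le> strip_diff n (f t) \<omega>}) * \<beta> < 4 * (4 * a)} \<le>
      prob {\<omega> \<in> space M. real (card {t. t < n \<and> \<beta> \<le> strip_diff n (f t) \<omega>}) \<le> n * p / 2}"
    proof (rule finite_measure_mono)
      have "real k \<le> n * p / 2" if "k * \<beta> < 4 * (4 * a)" for k :: nat
      proof (rule ccontr)
        assume "\<not> ?thesis"
        then have "n * p / 2 * \<beta> \<le> k * \<beta>" using \<beta> by (intro mult_right_mono) auto
        then show False using that big by simp
      qed
      then show "{\<omega> \<in> space M. real (card {t. t < n \<and> \<beta> \<le> strip_diff n (f t) \<omega>}) * \<beta> < 4 * (4 * a)} \<subseteq>
        {\<omega> \<in> space M. real (card {t. t < n \<and> \<beta> \<le> strip_diff n (f t) \<omega>}) \<le> n * p / 2}" by auto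
      have eq: "real (card {t. t < n \<and> \<beta> \<le> strip_diff n (f t) \<omega>}) = (\<Sum>t<n. if \<beta> \<le> strip_diff n (f t) \<omega> then 1 else 0)" for \<omega>
        by (simp add: sum.If_cases Int_def)
      show "{\<omega> \<in> space M. real (card {t. t < n \<and> \<beta> \<le> strip_diff n (f t) \<omega>}) \<le> n * p / 2} \<in> events"
        unfolding eq by measurable
    qed
    also have "\<dots> \<le> exp (- (n * p\<^sup>2 / 2))"
      by (rule count_tail[OF strip_diff_indep[OF f(1)]]) (use pt p n in auto)
    finally show "prob {\<omega> \<in> space M. real (card {t. t < n \<and> \<beta> \<le> strip_diff n (f t) \<omega>}) * \<beta> < 4 * (4 * a)} \<le> \<epsilon>"
      using small by simp
  qed (use n \<beta> in auto)
  then show ?thesis using that by blast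
qed

end

section \<open>Climbs with optional detours\<close>

type_synonym config = "vertex \<times> bool \<Rightarrow> real"

definition increment :: "config \<Rightarrow> vertex \<Rightarrow> vertex \<Rightarrow> real" where
  "increment w u v = (if fst u + snd u < fst v + snd v then w (u, fst u \<noteq> fst v) else - w (v, fst u \<noteq> fst v))"

fun walk_sum :: "config \<Rightarrow> vertex list \<Rightarrow> real" where
  "walk_sum w (u # v # p) = increment w u v + walk_sum w (v # p)"
| "walk_sum w _ = 0"

lemma increment_minus: "adj u v \<Longrightarrow> increment w v u = - increment w u v"
  unfolding adj_def increment_def by (cases "fst u = fst v") auto

lemma walk_sum_append:
  "p \<noteq> [] \<Longrightarrow> q \<noteq> [] \<Longrightarrow> walk_sum w (p @ q) = walk_sum w p + increment w (last p) (hd q) + walk_sum w q"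
proof (induction w p rule: walk_sum.induct)
  case ("2_2" w u) then show ?case by (cases q) auto
qed auto

lemma walk_sum_rev: "walk p \<Longrightarrow> walk_sum w (rev p) = - walk_sum w p"
proof (induction w p rule: walk_sum.induct)
  case (1 w u v p)
  have "walk_sum w (rev (u # v # p)) = walk_sum w (rev (v # p) @ [u])" by simp
  also have "\<dots> = walk_sum w (rev (v # p)) + increment w v u + walk_sum w [u]"
    by (subst walk_sum_append) (auto simp: last_rev)
  finally show ?case using 1 increment_minus[of u v w] by simp
qed auto

definition hline :: "vertex \<Rightarrow> nat \<Rightarrow> vertex list" where
  "hline p k = map (\<lambda>j. p + (int j, 0)) [0..<k]"

lemma hline_simps: "hline p 0 = []" "hline p (Suc k) = hline p k @ [p + (int k, 0)]"
  by (simp_all add: hline_def)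

lemma hline_ne: "hline p k = [] \<longleftrightarrow> k = 0"
  by (simp add: hline_def)

lemma hline_hd: "k > 0 \<Longrightarrow> hd (hline p k) = p"
  by (simp add: hline_def hd_map zero_prod_def[symmetric])

lemma hline_last: "k > 0 \<Longrightarrow> last (hline p k) = p + (int k - 1, 0)"
  by (cases k) (auto simp: hline_simps)

lemma hline_set: "z \<in> set (hline p k) \<longleftrightarrow> snd z = snd p \<and> fst p \<le> fst z \<and> fst z < fst p + int k"
proof -
  have "z \<in> set (hline p k)" if "snd z = snd p" "fst p \<le> fst z" "fst z < fst p + int k"
    unfolding hline_def using that
    by (auto intro!: image_eqI[where x = "nat (fst z - fst p)"] simp: prod_eq_iff)
  then show ?thesis by (auto simp: hline_def)
qed

lemma hline_distinct: "distinct (hline p k)"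
  by (simp add: hline_def distinct_map inj_on_def)

lemma hline_walk: "walk (hline p k)"
proof (induction k)
  case (Suc k)
  then show ?case unfolding hline_simps
    by (cases "k = 0") (auto simp: successively_append_iff hline_ne hline_last hline_simps adj_def)
qed (simp add: hline_simps)

lemma hline_walk_sum: "walk_sum w (hline p (Suc k)) = (\<Sum>j<k. w (p + (int j, 0), True))"
proof (induction k)
  case 0 show ?case by (simp add: hline_simps)
next
  case (Suc k)
  have "walk_sum w (hline p (Suc (Suc k))) = walk_sum w (hline p (Suc k) @ [p + (int (Suc k), 0)])" by (simp add: hline_simps(2)[of p "Suc k"])
  also have "\<dots> = walk_sum w (hline p (Suc k)) + increment w (p + (int k, 0)) (p + (int (Suc k), 0))"
    by (subst walk_sum_append) (auto simp: hline_ne hline_last)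
  finally show ?case using Suc by (simp add: increment_def)
qed

text \<open>For \<open>k = 0\<close> this is the plain step up from \<open>q\<close>.\<close>

definition detour :: "vertex \<Rightarrow> nat \<Rightarrow> vertex list" where
  "detour q k = hline q (Suc k) @ rev (hline (q + (0, 1)) (Suc k))"

lemma detour_ne: "detour q k \<noteq> []" by (simp add: detour_def hline_ne)
lemma detour_hd: "hd (detour q k) = q" by (simp add: detour_def hline_ne hline_hd)
lemma detour_last: "last (detour q k) = q + (0, 1)" by (simp add: detour_def hline_ne hline_hd last_rev)
lemma detour_set: "z \<in> set (detour q k) \<longleftrightarrow> (snd z = snd q \<or> snd z = snd q + 1) \<and> fst q \<le> fst z \<and> fst z \<le> fst q + int k"
  by (auto simp: detour_def hline_set)
lemma detour_distinct: "distinct (detour q k)"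
  by (auto simp: detour_def hline_distinct hline_set)
lemma adj_sym: "adj u v \<longleftrightarrow> adj v u"
  by (simp add: adj_def abs_minus_commute)
lemma walk_rev: "walk (rev p) \<longleftrightarrow> walk p"
proof -
  have "(\<lambda>x y. adj y x) = adj" by (intro ext) (rule adj_sym)
  then show ?thesis by (simp only: successively_rev)
qed

lemma detour_walk: "walk (detour q k)"
  unfolding detour_def successively_append_iff walk_rev
  by (auto simp: hline_walk hline_ne hline_last hd_rev, simp_all add: adj_def)

text \<open>What the horizontal edges of a detour contribute: the lower row is crossed rightward
  and the upper one leftward.\<close>

definition strip :: "config \<Rightarrow> vertex \<Rightarrow> nat \<Rightarrow> real" where
  "strip w q k = (\<Sum>j<k. w (q + (int j, 0), True) - w (q + (int j, 1), True))"

lemma detour_walk_sum: "walk_sum w (detour q k) = strip w q k + w (q + (int k, 0), False)"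
  unfolding detour_def
  by (subst walk_sum_append)
    (auto simp: hline_ne hline_last hd_rev walk_sum_rev hline_walk hline_walk_sum strip_def increment_def sum_subtractf add.assoc)

text \<open>The climb from \<open>p\<close> to height \<open>2 m\<close>. The step from height
  \<open>2 t + 1\<close> to \<open>2 t + 2\<close> is replaced by a detour of width \<open>k
  t\<close>; the rows of different detours are different, so the choices are independent of each
  other.\<close>

primrec climb :: "vertex \<Rightarrow> nat \<Rightarrow> (nat \<Rightarrow> nat) \<Rightarrow> vertex list" where
  "climb p 0 k = [p]"
| "climb p (Suc m) k = climb p m k @ detour (p + (0, 2 * int m + 1)) (k m)"

lemma climb_ne: "climb p m k \<noteq> []" by (induction m) (auto simp: detour_ne)
lemma climb_hd: "hd (climb p m k) = p" by (induction m) (auto simp: climb_ne)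
lemma climb_last: "last (climb p m k) = p + (0, 2 * int m)"
  by (induction m) (auto simp: detour_ne detour_last zero_prod_def[symmetric] algebra_simps)

lemma climb_set:
  assumes "\<And>t. t < m \<Longrightarrow> k t \<le> r" and "z \<in> set (climb p m k)"
  shows "snd p \<le> snd z \<and> snd z \<le> snd p + 2 * int m \<and> fst p \<le> fst z \<and> fst z \<le> fst p + int r \<and>
    (fst z > fst p \<longrightarrow> snd z > snd p)"
  using assms
proof (induction m)
  case (Suc m)
  have k: "k m \<le> r" using Suc.prems by simp
  show ?case
  proof (cases "z \<in> set (climb p m k)")
    case True
    have "k t \<le> r" if "t < m" for t using Suc.prems(1)[of t] that by simp
    from Suc.IH[OF this True] show ?thesis by simp
  next
    case False then show ?thesis using Suc.prems(2) k by (auto simp: detour_set)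
  qed
qed simp

lemma climb_distinct: "distinct (climb p m k)"
proof (induction m)
  case (Suc m)
  have "False" if "z \<in> set (climb p m k)" "z \<in> set (detour (p + (0, 2 * int m + 1)) (k m))" for z
  proof -
    have "k t \<le> Max (k ` {..<m})" if "t < m" for t using that by (intro Max_ge) auto
    from climb_set[of m k, OF this that(1)] show ?thesis using that(2) by (auto simp: detour_set)
  qed
  then show ?case using Suc by (auto simp: detour_distinct)
qed simp

lemma climb_walk: "walk (climb p m k)"
  by (induction m) (auto simp: successively_append_iff detour_walk climb_last detour_hd climb_ne detour_ne, simp_all add: adj_def)

definition col_cost :: "config \<Rightarrow> vertex \<Rightarrow> nat \<Rightarrow> real" where
  "col_cost w p m = (\<Sum>i<m. \<bar>w (p + (0, int i), False)\<bar>)"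

definition turn_cost :: "config \<Rightarrow> vertex \<Rightarrow> nat \<Rightarrow> nat \<Rightarrow> real" where
  "turn_cost w p n m = (\<Sum>t<m. \<bar>w (p + (int n, 2 * int t + 1), False)\<bar>)"

definition row_cost :: "config \<Rightarrow> vertex \<Rightarrow> nat \<Rightarrow> real" where
  "row_cost w p m = (\<Sum>j<m. \<bar>w (p + (int j, 0), True)\<bar>)"

text \<open>The vertical edges that a climb uses are among those of its axis and those at the far
  ends of the detours; so, up to a cost that does not depend on the choices, the climb collects
  the sum of the chosen row differences.\<close>

lemma climb_walk_sum:
  assumes "\<And>t. t < m \<Longrightarrow> k t = 0 \<or> k t = n"
  shows "\<bar>walk_sum w (climb p m k) - (\<Sum>t<m. strip w (p + (0, 2 * int t + 1)) (k t))\<bar> \<le> col_cost w p (2 * m) + turn_cost w p n m"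
  using assms
proof (induction m)
  case 0 show ?case by (simp add: col_cost_def turn_cost_def)
next
  case (Suc m)
  have eq: "walk_sum w (climb p (Suc m) k) = walk_sum w (climb p m k) + w (p + (0, 2 * int m), False)
     + (strip w (p + (0, 2 * int m + 1)) (k m) + w (p + (int (k m), 2 * int m + 1), False))"
    by (simp add: walk_sum_append climb_ne detour_ne climb_last detour_hd detour_walk_sum increment_def add.assoc)
  have c: "col_cost w p (2 * Suc m) = col_cost w p (2 * m) + \<bar>w (p + (0, 2 * int m), False)\<bar> + \<bar>w (p + (0, 2 * int m + 1), False)\<bar>"
    by (simp add: col_cost_def algebra_simps)
  have t: "turn_cost w p n (Suc m) = turn_cost w p n m + \<bar>w (p + (int n, 2 * int m + 1), False)\<bar>"
    by (simp add: turn_cost_def)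
  have "\<bar>w (p + (int (k m), 2 * int m + 1), False)\<bar> \<le> \<bar>w (p + (0, 2 * int m + 1), False)\<bar> + \<bar>w (p + (int n, 2 * int m + 1), False)\<bar>"
    using Suc.prems[of m] by auto
  then show ?case unfolding eq c t using Suc.IH Suc.prems by simp
qed

section \<open>Boxes and the paths that connect them\<close>

text \<open>The corners of the boxes form a sheared lattice: the path to the right neighbour ends
  \<open>2 n + 1\<close> higher than it starts, because it contains a climb that it does not take
  back.\<close>

definition corner :: "nat \<Rightarrow> vertex \<Rightarrow> vertex \<Rightarrow> vertex" where
  "corner n b c = b + (2 * (2 * int n + 1) * fst c, (2 * int n + 1) * fst c + (2 * int n + 2) * snd c)"

text \<open>The box that contains \<open>z\<close>; it is \<open>2 (2 n + 1)\<close> wide and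
  \<open>2 n + 2\<close> high.\<close>

definition site :: "nat \<Rightarrow> vertex \<Rightarrow> vertex \<Rightarrow> vertex" where
  "site n b z = (let i = (fst z - fst b) div (2 * (2 * int n + 1))
     in (i, (snd z - snd b - (2 * int n + 1) * i) div (2 * int n + 2)))"

definition in_box :: "nat \<Rightarrow> vertex \<Rightarrow> vertex \<Rightarrow> vertex \<Rightarrow> bool" where
  "in_box n b c z \<longleftrightarrow> fst (corner n b c) \<le> fst z \<and> fst z < fst (corner n b c) + 2 * (2 * int n + 1) \<and>
     snd (corner n b c) \<le> snd z \<and> snd z < snd (corner n b c) + (2 * int n + 2)"

lemma in_box_iff: "in_box n b c z \<longleftrightarrow> site n b z = c"
proof
  assume *: "in_box n b c z"
  have i: "(fst z - fst b) div (2 * (2 * int n + 1)) = fst c"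
    using * by (intro int_div_pos_eq[where r = "fst z - fst (corner n b c)"]) (auto simp: in_box_def corner_def)
  have "(snd z - snd b - (2 * int n + 1) * fst c) div (2 * int n + 2) = snd c"
    using * by (intro int_div_pos_eq[where r = "snd z - snd (corner n b c)"]) (auto simp: in_box_def corner_def)
  then show "site n b z = c" using i by (simp add: site_def Let_def)
next
  assume *: "site n b z = c"
  define A B where "A = 2 * (2 * int n + 1)" and "B = 2 * int n + 2"
  have AB: "A > 0" "B > 0" by (auto simp: A_def B_def)
  define x y where "x = fst z - fst b" and "y = snd z - snd b - (2 * int n + 1) * fst c"
  have c: "fst c = x div A" "snd c = y div B" using * unfolding site_def Let_def A_def B_def x_def y_def by auto
  have "x = A * fst c + x mod A" "y = B * snd c + y mod B" unfolding c by simp_all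
  moreover have "0 \<le> x mod A" "x mod A < A" "0 \<le> y mod B" "y mod B < B" using AB by auto
  moreover have "fst (corner n b c) = fst b + A * fst c" "snd (corner n b c) = snd b + (2 * int n + 1) * fst c + B * snd c"
    by (simp_all add: corner_def A_def B_def)
  ultimately show "in_box n b c z" unfolding in_box_def A_def[symmetric] B_def[symmetric] x_def y_def by linarith
qed

text \<open>Every vertex of a box, apart from the corner, is reserved for one of the two
  connecting paths that the box owns: the left half above the bottom row for the path to the upper
  neighbour, the rest for the path to the right neighbour. The set of sites joined by this path is
  attached to the vertex as a label; comparing labels then shows that paths for different pairs of
  neighbours are disjoint.\<close>

definition ends :: "nat \<Rightarrow> vertex \<Rightarrow> vertex \<Rightarrow> vertex set" where
  "ends n b z = (let c = site n b z; dx = fst z - fst (corner n b c); dy = snd z - snd (corner n b c) in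
     if dx = 0 \<and> dy = 0 then {c} else if dx < 2 * int n + 1 \<and> dy > 0 then {c, c + (0, 1)} else {c, c + (1, 0)})"

definition up_path :: "nat \<Rightarrow> vertex \<Rightarrow> (nat \<Rightarrow> nat) \<Rightarrow> vertex list" where
  "up_path n q k = climb q n k @ [q + (0, 2 * int n + 1), q + (0, 2 * int n + 2)]"

text \<open>The climb is in the middle column of the box, so that its detours stay in the right
  half.\<close>

definition right_path :: "nat \<Rightarrow> vertex \<Rightarrow> (nat \<Rightarrow> nat) \<Rightarrow> vertex list" where
  "right_path n q k = hline q (2 * n + 1) @ climb (q + (2 * int n + 1, 0)) n k @
     hline (q + (2 * int n + 1, 2 * int n + 1)) (2 * n + 1) @ [q + (2 * (2 * int n + 1), 2 * int n + 1)]"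

lemma up_path_basic:
  "hd (up_path n q k) = q" "last (up_path n q k) = q + (0, 2 * int n + 2)" "walk (up_path n q k)"
  by (auto simp: up_path_def climb_hd climb_ne climb_walk successively_append_iff climb_last, simp_all add: adj_def)

lemma right_path_basic:
  "hd (right_path n q k) = q" "last (right_path n q k) = q + (2 * (2 * int n + 1), 2 * int n + 1)" "walk (right_path n q k)"
  by (auto simp: right_path_def climb_hd climb_ne climb_walk successively_append_iff climb_last
      hline_hd hline_ne hline_walk hline_last, simp_all add: adj_def)

lemma up_path_distinct:
  assumes "\<And>t. t < n \<Longrightarrow> k t \<le> n"
  shows "distinct (up_path n q k)"
proof -
  have "z \<in> set (climb q n k) \<Longrightarrow> snd z \<le> snd q + 2 * int n" for z
    using climb_set[of n k n z q] assms by blast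
  note bound = this
  show ?thesis by (auto simp: up_path_def climb_distinct dest!: bound)
qed

lemma right_path_distinct:
  assumes "\<And>t. t < n \<Longrightarrow> k t \<le> n"
  shows "distinct (right_path n q k)"
proof -
  have "z \<in> set (climb (q + (2 * int n + 1, 0)) n k) \<Longrightarrow> snd z \<le> snd q + 2 * int n \<and> fst q + 2 * int n + 1 \<le> fst z
      \<and> fst z \<le> fst q + 3 * int n + 1" for z
    using climb_set[of n k n z "q + (2 * int n + 1, 0)"] assms by auto
  note bound = this
  show ?thesis by (auto simp: right_path_def climb_distinct hline_distinct hline_set dest!: bound)
qed

lemma up_path_walk_sum:
  assumes "\<And>t. t < n \<Longrightarrow> k t = 0 \<or> k t = n"
  shows "\<bar>walk_sum w (up_path n q k) - (\<Sum>t<n. strip w (q + (0, 2 * int t + 1)) (k t))\<bar>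
     \<le> col_cost w q (2 * n + 2) + turn_cost w q n n"
proof -
  have eq: "walk_sum w (up_path n q k) = walk_sum w (climb q n k) + w (q + (0, 2 * int n), False) + w (q + (0, 2 * int n + 1), False)"
    unfolding up_path_def by (subst walk_sum_append) (auto simp: climb_ne climb_last increment_def)
  have c: "col_cost w q (2 * n + 2) = col_cost w q (2 * n) + \<bar>w (q + (0, 2 * int n), False)\<bar> + \<bar>w (q + (0, 2 * int n + 1), False)\<bar>"
    by (simp add: col_cost_def algebra_simps)
  show ?thesis unfolding eq c using climb_walk_sum[of n k n w q, OF assms] by linarith
qed

lemma right_path_walk_sum:
  fixes q :: vertex
  assumes "\<And>t. t < n \<Longrightarrow> k t = 0 \<or> k t = n"
  defines "p \<equiv> q + (2 * int n + 1, 0)"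
  shows "\<bar>walk_sum w (right_path n q k) - (\<Sum>t<n. strip w (p + (0, 2 * int t + 1)) (k t))\<bar>
     \<le> row_cost w q (2 * n + 1) + col_cost w p (2 * n + 2) + turn_cost w p n n
       + row_cost w (q + (2 * int n + 1, 2 * int n + 1)) (2 * n + 1)"
proof -
  let ?r = "q + (2 * int n + 1, 2 * int n + 1)"
  have row: "walk_sum w (hline x (2 * n + 1)) + w (x + (2 * int n, 0), True) = (\<Sum>j<2 * n + 1. w (x + (int j, 0), True))" for x
    using hline_walk_sum[of w x "2 * n"] by simp
  have row_le: "\<bar>\<Sum>j<2 * n + 1. w (x + (int j, 0), True)\<bar> \<le> row_cost w x (2 * n + 1)" for x
    unfolding row_cost_def by (rule sum_abs)
  have "walk_sum w (right_path n q k) = walk_sum w (hline q (2 * n + 1)) + increment w (q + (2 * int n, 0)) p +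
     (walk_sum w (climb p n k) + increment w (p + (0, 2 * int n)) ?r + (walk_sum w (hline ?r (2 * n + 1)) + increment w (?r + (2 * int n, 0)) (q + (2 * (2 * int n + 1), 2 * int n + 1))))"
    unfolding right_path_def p_def
    by (subst walk_sum_append, simp add: hline_ne, simp add: climb_ne, subst walk_sum_append, simp add: climb_ne, simp add: hline_ne,
        subst walk_sum_append, simp add: hline_ne, simp)
      (simp add: hline_ne hline_last climb_ne climb_last climb_hd hline_hd)
  also have "\<dots> = (\<Sum>j<2 * n + 1. w (q + (int j, 0), True)) + walk_sum w (climb p n k) + w (p + (0, 2 * int n), False)
      + (\<Sum>j<2 * n + 1. w (?r + (int j, 0), True))"
    unfolding row[symmetric] by (simp add: increment_def p_def add.assoc)
  finally have eq: "walk_sum w (right_path n q k) = (\<Sum>j<2 * n + 1. w (q + (int j, 0), True)) + walk_sum w (climb p n k) + w (p + (0, 2 * int n), False)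
      + (\<Sum>j<2 * n + 1. w (?r + (int j, 0), True))" .
  have c: "col_cost w p (2 * n + 2) = col_cost w p (2 * n) + \<bar>w (p + (0, 2 * int n), False)\<bar> + \<bar>w (p + (0, 2 * int n + 1), False)\<bar>"
    by (simp add: col_cost_def algebra_simps)
  show ?thesis unfolding eq c using climb_walk_sum[of n k n w p, OF assms(1)] row_le[of q] row_le[of ?r] by linarith
qed

lemma climb_length:
  assumes "\<And>t. t < m \<Longrightarrow> k t \<le> n"
  shows "length (climb p m k) \<le> 1 + 2 * m * (n + 1)"
  using assms
proof (induction m)
  case (Suc m)
  have "k m \<le> n" "length (climb p m k) \<le> 1 + 2 * m * (n + 1)" using Suc by auto
  then show ?case by (simp add: detour_def hline_def)
qed simp

lemma ends_corner: "ends n b (corner n b c) = {c}"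
proof -
  have "site n b (corner n b c) = c" by (subst in_box_iff[symmetric]) (simp add: in_box_def)
  then show ?thesis by (simp add: ends_def)
qed

lemma ends_in_box:
  assumes "in_box n b c z"
  shows "z = corner n b c \<Longrightarrow> ends n b z = {c}"
    and "fst z < fst (corner n b c) + (2 * int n + 1) \<Longrightarrow> snd z > snd (corner n b c) \<Longrightarrow> ends n b z = {c, c + (0, 1)}"
    and "z \<noteq> corner n b c \<Longrightarrow> fst z \<ge> fst (corner n b c) + (2 * int n + 1) \<or> snd z = snd (corner n b c) \<Longrightarrow> ends n b z = {c, c + (1, 0)}"
proof -
  have s: "site n b z = c" using assms in_box_iff by blast
  show "z = corner n b c \<Longrightarrow> ends n b z = {c}" using ends_corner by simp
  show "fst z < fst (corner n b c) + (2 * int n + 1) \<Longrightarrow> snd z > snd (corner n b c) \<Longrightarrow> ends n b z = {c, c + (0, 1)}"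
    unfolding ends_def Let_def s by auto
  show "z \<noteq> corner n b c \<Longrightarrow> fst z \<ge> fst (corner n b c) + (2 * int n + 1) \<or> snd z = snd (corner n b c) \<Longrightarrow> ends n b z = {c, c + (1, 0)}"
    unfolding ends_def Let_def s by (auto simp: prod_eq_iff)
qed

lemma up_path_set:
  assumes k: "\<And>t. t < n \<Longrightarrow> k t \<le> n" and z: "z \<in> set (butlast (up_path n (corner n b c) k))"
  shows "in_box n b c z \<and> (z = corner n b c \<or> ends n b z = {c, c + (0, 1)})"
proof -
  let ?q = "corner n b c"
  have "z \<in> set (climb ?q n k) \<or> z = ?q + (0, 2 * int n + 1)"
    using z by (auto simp: up_path_def butlast_append)
  then have box: "in_box n b c z" and up: "z = ?q \<or> (fst z < fst ?q + (2 * int n + 1) \<and> snd z > snd ?q)"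
    using climb_set[of n k n z ?q, OF k] by (auto simp: in_box_def prod_eq_iff)
  then show ?thesis using ends_in_box[OF box] by blast
qed

lemma right_path_set:
  assumes k: "\<And>t. t < n \<Longrightarrow> k t \<le> n" and z: "z \<in> set (butlast (right_path n (corner n b c) k))"
  shows "in_box n b c z \<and> (z = corner n b c \<or> ends n b z = {c, c + (1, 0)})"
proof -
  let ?q = "corner n b c"
  have "z \<in> set (hline ?q (2 * n + 1)) \<or> z \<in> set (climb (?q + (2 * int n + 1, 0)) n k) \<or>
      z \<in> set (hline (?q + (2 * int n + 1, 2 * int n + 1)) (2 * n + 1))"
    using z by (auto simp: right_path_def butlast_append climb_ne hline_ne)
  then have box: "in_box n b c z" and right: "z = ?q \<or> fst z \<ge> fst ?q + (2 * int n + 1) \<or> snd z = snd ?q"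
    using climb_set[of n k n z "?q + (2 * int n + 1, 0)", OF k] by (auto simp: in_box_def hline_set prod_eq_iff)
  then show ?thesis using ends_in_box[OF box] by blast
qed

definition small_steps :: "config \<Rightarrow> real \<Rightarrow> vertex list \<Rightarrow> bool" where
  "small_steps w K p \<longleftrightarrow> successively (\<lambda>u v. \<bar>increment w u v\<bar> \<le> K) p"

text \<open>All edges of the path are owned by the box, including the last one, which leaves the
  box in a positive direction.\<close>

lemma small_steps_in_box:
  assumes K: "\<And>z d. in_box n b c z \<Longrightarrow> \<bar>w (z, d)\<bar> \<le> K" and w: "walk (p @ [e])"
    and p: "\<And>z. z \<in> set p \<Longrightarrow> in_box n b c z" and e: "p \<noteq> [] \<Longrightarrow> fst (last p) + snd (last p) < fst e + snd e"
  shows "small_steps w K (p @ [e])"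
proof -
  have "successively (\<lambda>u v. \<bar>increment w u v\<bar> \<le> K) p"
    using w unfolding successively_append_iff
    by (elim conjE successively_mono) (auto simp: increment_def intro!: K p)
  then show ?thesis unfolding small_steps_def successively_append_iff using e
    by (auto simp: increment_def intro!: K p)
qed

lemma small_steps_rev:
  assumes "small_steps w K p" "walk p" shows "small_steps w K (rev p)"
proof -
  have "successively (\<lambda>u v. adj u v \<and> \<bar>increment w u v\<bar> \<le> K) p"
    using assms unfolding small_steps_def successively_conv_nth by blast
  then show ?thesis unfolding small_steps_def successively_rev
    by (rule successively_mono) (auto simp: increment_minus)
qed

lemma small_steps_walk_sum_take: "small_steps w K p \<Longrightarrow> K \<ge> 0 \<Longrightarrow> \<bar>walk_sum w (take i p)\<bar> \<le> K * length p"
proof (induction w p arbitrary: i rule: walk_sum.induct)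
  case (1 w u v p)
  have s: "small_steps w K (v # p)" "\<bar>increment w u v\<bar> \<le> K" using 1 by (auto simp: small_steps_def)
  show ?case
  proof (cases i)
    case 0 then show ?thesis using 1 by simp
  next
    case (Suc i')
    show ?thesis
    proof (cases i')
      case 0 then show ?thesis using 1 Suc by simp
    next
      case (Suc i'')
      have "\<bar>walk_sum w (take i' (v # p))\<bar> \<le> K * length (v # p)" using 1 s by blast
      then have "\<bar>walk_sum w (v # take i'' p)\<bar> \<le> K * length (v # p)" using Suc by simp
      then show ?thesis using s(2) \<open>i = Suc i'\<close> Suc by (simp add: algebra_simps)
    qed
  qed
qed (auto simp: take_Cons split: nat.split)

text \<open>The climb at \<open>p\<close> is cheap apart from its detours, and the favourable
  detours outweigh the cost of the whole connecting path, for either sign.\<close>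

definition good_gadget :: "nat \<Rightarrow> real \<Rightarrow> real \<Rightarrow> config \<Rightarrow> vertex \<Rightarrow> bool" where
  "good_gadget n \<Lambda> \<beta> w p \<longleftrightarrow> col_cost w p (2 * n + 2) \<le> \<Lambda> \<and> turn_cost w p n n \<le> \<Lambda> \<and>
     real (card {t. t < n \<and> \<beta> \<le> strip w (p + (0, 2 * int t + 1)) n}) * \<beta> \<ge> 4 * \<Lambda> \<and>
     real (card {t. t < n \<and> \<beta> \<le> - strip w (p + (0, 2 * int t + 1)) n}) * \<beta> \<ge> 4 * \<Lambda>"

text \<open>The number \<open>K\<close> only serves to bound the partial sums inside the
  box.\<close>

definition good_site :: "nat \<Rightarrow> vertex \<Rightarrow> real \<Rightarrow> real \<Rightarrow> real \<Rightarrow> config \<Rightarrow> vertex \<Rightarrow> bool" where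
  "good_site n b \<Lambda> \<beta> K w c \<longleftrightarrow> row_cost w (corner n b c) (2 * n + 1) \<le> \<Lambda> \<and>
     row_cost w (corner n b c + (2 * int n + 1, 2 * int n + 1)) (2 * n + 1) \<le> \<Lambda> \<and>
     good_gadget n \<Lambda> \<beta> w (corner n b c) \<and> good_gadget n \<Lambda> \<beta> w (corner n b c + (2 * int n + 1, 0)) \<and>
     (\<forall>z. in_box n b c z \<longrightarrow> \<bar>w (z, True)\<bar> \<le> K \<and> \<bar>w (z, False)\<bar> \<le> K)"

text \<open>Exactly the detours with a large gain of the desired sign are made.\<close>

lemma gadget_choice:
  assumes g: "good_gadget n \<Lambda> \<beta> w p"
  obtains k where "\<And>t. t < n \<Longrightarrow> k t = 0 \<or> k t = n"
    and "if pos then (\<Sum>t<n. strip w (p + (0, 2 * int t + 1)) (k t)) \<ge> 4 * \<Lambda>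
      else (\<Sum>t<n. strip w (p + (0, 2 * int t + 1)) (k t)) \<le> - 4 * \<Lambda>"
proof -
  define \<sigma> where "\<sigma> = (if pos then 1 else - 1 :: real)"
  define D where "D t = \<sigma> * strip w (p + (0, 2 * int t + 1)) n" for t :: nat
  define k where "k t = (if \<beta> \<le> D t then n else 0)" for t
  have "4 * \<Lambda> \<le> real (card {t. t < n \<and> \<beta> \<le> D t}) * \<beta>"
    using g unfolding good_gadget_def D_def \<sigma>_def by (cases pos) auto
  also have "\<dots> = (\<Sum>t<n. if \<beta> \<le> D t then \<beta> else 0)"
    by (simp add: sum.If_cases Int_def)
  also have "\<dots> \<le> (\<Sum>t<n. \<sigma> * strip w (p + (0, 2 * int t + 1)) (k t))"
    by (intro sum_mono) (auto simp: k_def D_def strip_def)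
  also have "\<dots> = \<sigma> * (\<Sum>t<n. strip w (p + (0, 2 * int t + 1)) (k t))" by (simp add: sum_distrib_left)
  finally have "4 * \<Lambda> \<le> \<sigma> * (\<Sum>t<n. strip w (p + (0, 2 * int t + 1)) (k t))" .
  then show ?thesis by (intro that[of k]) (auto simp: k_def \<sigma>_def split: if_splits)
qed

text \<open>A path between the corners of neighbouring boxes in the vertices that are reserved for
  it.\<close>

definition linking :: "nat \<Rightarrow> vertex \<Rightarrow> real \<Rightarrow> config \<Rightarrow> vertex \<Rightarrow> vertex \<Rightarrow> vertex list \<Rightarrow> bool" where
  "linking n b K w u v p \<longleftrightarrow> p \<noteq> [] \<and> hd p = corner n b u \<and> last p = corner n b v \<and> walk p \<and> distinct p \<and> small_steps w K p \<and>
     length p \<le> 2 * n * (n + 1) + 4 * n + 4 \<and>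
     (\<forall>z\<in>set p. z = corner n b u \<or> z = corner n b v \<or> ends n b z = {u, v})"

lemma linking_rev: "linking n b K w u v p \<Longrightarrow> linking n b K w v u (rev p)"
  unfolding linking_def by (elim conjE, intro conjI small_steps_rev, simp_all only: walk_rev)
    (auto simp: hd_rev last_rev)

text \<open>What remains to be checked for a concrete path inside a good box; the last step leaves
  the box in a positive direction.\<close>

lemma linking_of_path:
  assumes g: "good_site n b \<Lambda> \<beta> K w c"
    and p: "p \<noteq> []" "hd p = corner n b c" "last p = corner n b v" "walk p" "distinct p"
    and len: "length p \<le> 2 * n * (n + 1) + 4 * n + 4"
    and inner: "\<And>z. z \<in> set (butlast p) \<Longrightarrow> in_box n b c z \<and> (z = corner n b c \<or> ends n b z = {c, v})"
    and out: "fst (last (butlast p)) + snd (last (butlast p)) < fst (last p) + snd (last p)"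
  shows "linking n b K w c v p"
proof -
  have K: "\<bar>w (z, d)\<bar> \<le> K" if "in_box n b c z" for z d
    using g that unfolding good_site_def by (metis (full_types))
  have split: "p = butlast p @ [last p]" using p(1) by simp
  have "small_steps w K (butlast p @ [last p])"
    by (rule small_steps_in_box[where w = w and n = n and b = b and c = c, OF K])
      (use p(4) split inner out in auto)
  moreover have "z \<in> set (butlast p) \<or> z = last p" if "z \<in> set p" for z
    using that by (subst (asm) split) auto
  ultimately show ?thesis unfolding linking_def using p len inner split by metis
qed

lemma linking_up:
  assumes g: "good_site n b \<Lambda> \<beta> K w c"
  shows "\<exists>p. linking n b K w c (c + (0, 1)) p \<and> (if pos then 0 \<le> walk_sum w p else walk_sum w p \<le> 0)"
proof -
  let ?q = "corner n b c"
  have gg: "good_gadget n \<Lambda> \<beta> w ?q"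
    using g unfolding good_site_def by blast
  obtain k where k: "\<And>t. t < n \<Longrightarrow> k t = 0 \<or> k t = n"
    and s: "if pos then (\<Sum>t<n. strip w (?q + (0, 2 * int t + 1)) (k t)) \<ge> 4 * \<Lambda>
      else (\<Sum>t<n. strip w (?q + (0, 2 * int t + 1)) (k t)) \<le> - 4 * \<Lambda>"
    using gadget_choice[OF gg] by blast
  have kn: "k t \<le> n" if "t < n" for t using k[OF that] by auto
  define p where "p = up_path n ?q k"
  have c0: "0 \<le> col_cost w ?q (2 * n + 2)" unfolding col_cost_def by (simp add: sum_nonneg)
  have "\<bar>walk_sum w p - (\<Sum>t<n. strip w (?q + (0, 2 * int t + 1)) (k t))\<bar> \<le> 2 * \<Lambda>" "0 \<le> \<Lambda>"
    using up_path_walk_sum[of n k w ?q, OF k] gg c0 unfolding p_def good_gadget_def by auto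
  then have sign: "if pos then 0 \<le> walk_sum w p else walk_sum w p \<le> 0" using s by (auto split: if_splits)
  have "linking n b K w c (c + (0, 1)) p"
  proof (rule linking_of_path[OF g])
    show "in_box n b c z \<and> (z = ?q \<or> ends n b z = {c, c + (0, 1)})" if "z \<in> set (butlast p)" for z
      using up_path_set[of n k, OF kn] that unfolding p_def by blast
    show "length p \<le> 2 * n * (n + 1) + 4 * n + 4"
      using climb_length[of n k n ?q, OF kn] unfolding p_def up_path_def by simp
  qed (use up_path_distinct[of n k, OF kn] up_path_basic[of n ?q k] in
      \<open>simp_all add: p_def, simp_all add: up_path_def butlast_append corner_def algebra_simps\<close>)
  then show ?thesis using sign by blast
qed

lemma linking_right:
  assumes g: "good_site n b \<Lambda> \<beta> K w c"
  shows "\<exists>p. linking n b K w c (c + (1, 0)) p \<and> (if pos then 0 \<le> walk_sum w p else walk_sum w p \<le> 0)"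
proof -
  let ?q = "corner n b c" and ?p0 = "corner n b c + (2 * int n + 1, 0)"
  have gg: "good_gadget n \<Lambda> \<beta> w ?p0"
    using g unfolding good_site_def by blast
  obtain k where k: "\<And>t. t < n \<Longrightarrow> k t = 0 \<or> k t = n"
    and s: "if pos then (\<Sum>t<n. strip w (?p0 + (0, 2 * int t + 1)) (k t)) \<ge> 4 * \<Lambda>
      else (\<Sum>t<n. strip w (?p0 + (0, 2 * int t + 1)) (k t)) \<le> - 4 * \<Lambda>"
    using gadget_choice[OF gg] by blast
  have kn: "k t \<le> n" if "t < n" for t using k[OF that] by auto
  define p where "p = right_path n ?q k"
  have "\<bar>walk_sum w p - (\<Sum>t<n. strip w (?p0 + (0, 2 * int t + 1)) (k t))\<bar> \<le> 4 * \<Lambda>"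
    using right_path_walk_sum[of n k w ?q, OF k] gg g unfolding p_def good_gadget_def good_site_def by linarith
  then have sign: "if pos then 0 \<le> walk_sum w p else walk_sum w p \<le> 0" using s by (auto split: if_splits)
  have "linking n b K w c (c + (1, 0)) p"
  proof (rule linking_of_path[OF g])
    show "in_box n b c z \<and> (z = ?q \<or> ends n b z = {c, c + (1, 0)})" if "z \<in> set (butlast p)" for z
      using right_path_set[of n k, OF kn] that unfolding p_def by blast
    show "length p \<le> 2 * n * (n + 1) + 4 * n + 4"
      using climb_length[of n k n ?p0, OF kn] unfolding p_def right_path_def by (simp add: hline_def)
  qed (use right_path_distinct[of n k, OF kn] right_path_basic[of n ?q k] in
      \<open>simp_all add: p_def, simp_all add: right_path_def butlast_append hline_ne hline_last climb_ne corner_def algebra_simps\<close>)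
  then show ?thesis using sign by blast
qed

text \<open>Steps to the left and downward use the path owned by the other box, reversed; this
  changes the sign of its sum, and both signs are available.\<close>

lemma linking_exists:
  assumes u: "good_site n b \<Lambda> \<beta> K w u" and v: "good_site n b \<Lambda> \<beta> K w v" and uv: "adj u v"
  shows "\<exists>p. linking n b K w u v p \<and> (if pos then 0 \<le> walk_sum w p else walk_sum w p \<le> 0)"
proof -
  have reversed: "\<exists>p. linking n b K w u v p \<and> (if pos then 0 \<le> walk_sum w p else walk_sum w p \<le> 0)"
    if h: "\<exists>p. linking n b K w v u p \<and> (if \<not> pos then 0 \<le> walk_sum w p else walk_sum w p \<le> 0)"
  proof -
    obtain p where p: "linking n b K w v u p" "if \<not> pos then 0 \<le> walk_sum w p else walk_sum w p \<le> 0" using h by blast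
    have "walk p" using p unfolding linking_def by blast
    then show ?thesis using p linking_rev[OF p(1)] by (intro exI[of _ "rev p"]) (auto simp: walk_sum_rev split: if_splits)
  qed
  have "(fst v - fst u, snd v - snd u) = (1, 0) \<or> (fst v - fst u, snd v - snd u) = (-1, 0) \<or>
      (fst v - fst u, snd v - snd u) = (0, 1) \<or> (fst v - fst u, snd v - snd u) = (0, -1)"
    using uv unfolding adj_def by (intro abs_sum_1_cases) (simp add: abs_minus_commute)
  then consider "v = u + (1, 0)" | "u = v + (1, 0)" | "v = u + (0, 1)" | "u = v + (0, 1)"
    by (auto simp: prod_eq_iff)
  then show ?thesis
  proof cases
    case 1 then show ?thesis using linking_right[OF u] by simp
  next
    case 2 then show ?thesis using linking_right[OF v, of "\<not> pos"] reversed by simp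
  next
    case 3 then show ?thesis using linking_up[OF u] by simp
  next
    case 4 then show ?thesis using linking_up[OF v, of "\<not> pos"] reversed by simp
  qed
qed

lemma walk_sum_append_tl:
  assumes "p \<noteq> []" "q \<noteq> []" "last p = hd q"
  shows "walk_sum w (p @ tl q) = walk_sum w p + walk_sum w q"
proof (cases q)
  case (Cons x q')
  then show ?thesis using assms by (cases q') (auto simp: walk_sum_append)
qed (use assms in simp)

text \<open>The next connecting path is chosen with the sign opposite to the current sum. So the
  sums at the corners stay in \<open>[-T, T]\<close>, where \<open>T\<close> bounds the sums along
  a single connecting path, and all partial sums stay in \<open>[-2 T, 2 T]\<close>.\<close>

lemma bounded_path_along:
  assumes K: "K \<ge> 0" and cs: "cs \<noteq> []" "walk cs" "distinct cs" "\<And>c. c \<in> set cs \<Longrightarrow> good_site n b \<Lambda> \<beta> K w c"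
  defines "T \<equiv> K * real (2 * n * (n + 1) + 4 * n + 4)"
  shows "\<exists>P. P \<noteq> [] \<and> hd P = corner n b (hd cs) \<and> last P = corner n b (last cs) \<and> walk P \<and> distinct P \<and>
    (\<forall>z\<in>set P. ends n b z \<subseteq> set cs) \<and> \<bar>walk_sum w P\<bar> \<le> T \<and> (\<forall>i. \<bar>walk_sum w (take i P)\<bar> \<le> 2 * T) \<and> length P \<ge> length cs"
  using cs
proof (induction cs rule: rev_induct)
  case (snoc v cs)
  have T: "T \<ge> 0" unfolding T_def using K by simp
  show ?case
  proof (cases "cs = []")
    case True
    then show ?thesis using T by (intro exI[of _ "[corner n b v]"]) (auto simp: ends_corner take_Cons split: nat.split)
  next
    case False
    define u where "u = last cs"
    have cs: "walk cs" "distinct cs" "v \<notin> set cs" "adj u v" "u \<in> set cs"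
      using snoc.prems False by (auto simp: successively_append_iff u_def)
    obtain P where P: "P \<noteq> []" "hd P = corner n b (hd cs)" "last P = corner n b u" "walk P" "distinct P"
      "\<And>z. z \<in> set P \<Longrightarrow> ends n b z \<subseteq> set cs" "\<bar>walk_sum w P\<bar> \<le> T" "\<And>i. \<bar>walk_sum w (take i P)\<bar> \<le> 2 * T" "length P \<ge> length cs"
    proof -
      have "good_site n b \<Lambda> \<beta> K w c" if "c \<in> set cs" for c using snoc.prems(4) that by simp
      from snoc.IH[OF False cs(1,2) this] show ?thesis using that unfolding u_def by blast
    qed
    have "good_site n b \<Lambda> \<beta> K w u" "good_site n b \<Lambda> \<beta> K w v" using snoc.prems(4) cs(5) by simp_all
    from linking_exists[OF this cs(4), of "walk_sum w P \<le> 0"]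
    obtain F where F: "linking n b K w u v F" "if walk_sum w P \<le> 0 then 0 \<le> walk_sum w F else walk_sum w F \<le> 0"
      by blast
    have F1: "F \<noteq> []" "hd F = corner n b u" "last F = corner n b v" "walk F" "distinct F" "small_steps w K F"
      "length F \<le> 2 * n * (n + 1) + 4 * n + 4" "\<And>z. z \<in> set F \<Longrightarrow> z = corner n b u \<or> z = corner n b v \<or> ends n b z = {u, v}"
      using F(1) unfolding linking_def by blast+
    have uv: "corner n b u \<noteq> corner n b v" 
    proof
      assume "corner n b u = corner n b v"
      then have "{u} = {v}" by (metis ends_corner)
      then have "u = v" by (rule singleton_inject)
      then show False using cs(3,5) by blast
    qed
    obtain F' where F': "F = corner n b u # F'" using F1(1,2) by (metis list.collapse)
    have ne: "F' \<noteq> []" using F1(3) uv unfolding F' by (metis last.simps)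
    have wtF: "\<bar>walk_sum w (take i F)\<bar> \<le> T" for i
    proof -
      have "\<bar>walk_sum w (take i F)\<bar> \<le> K * length F" by (rule small_steps_walk_sum_take[OF F1(6) K])
      also have "\<dots> \<le> T" unfolding T_def using F1(7) K by (intro mult_left_mono) (simp_all only: of_nat_le_iff)
      finally show ?thesis .
    qed
    have wtFF: "\<bar>walk_sum w F\<bar> \<le> T" using wtF[of "length F"] by simp
    have endsF: "v \<in> ends n b z \<and> ends n b z \<subseteq> {u, v}" if "z \<in> set F'" for z
      using F1(8)[of z] F1(5) that F' by (auto simp: ends_corner)
    have sum: "walk_sum w (P @ F') = walk_sum w P + walk_sum w F" using walk_sum_append_tl[OF P(1) F1(1)] P(3) F1(2) F' by simp
    show ?thesis
    proof (intro exI[of _ "P @ F'"] conjI ballI allI)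
      show "walk (P @ F')" using P F1(4) F' ne by (auto simp: successively_append_iff successively_Cons)
      have "set P \<inter> set F' = {}" using P(6) endsF cs(3) by blast
      then show "distinct (P @ F')" using P(5) F1(5) F' by simp
      show "ends n b z \<subseteq> set (cs @ [v])" if "z \<in> set (P @ F')" for z
        using that P(6)[of z] endsF[of z] cs(5) by auto
      show "\<bar>walk_sum w (P @ F')\<bar> \<le> T" unfolding sum using F(2) P(7) wtFF by (auto split: if_splits)
      show "\<bar>walk_sum w (take i (P @ F'))\<bar> \<le> 2 * T" for i
      proof (cases "i \<le> length P")
        case True then show ?thesis using P(8)[of i] by simp
      next
        case False
        define j where "j = i - length P"
        have "walk_sum w (take i (P @ F')) = walk_sum w (P @ tl (take (Suc j) F))" using False F' by (simp add: j_def)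
        also have "\<dots> = walk_sum w P + walk_sum w (take (Suc j) F)" using P F' by (intro walk_sum_append_tl) auto
        finally show ?thesis using P(7) wtF[of "Suc j"] by linarith
      qed
      show "length (cs @ [v]) \<le> length (P @ F')" using P(9) ne by (cases F') auto
    qed (use P False F1 F' ne in auto)
  qed
qed simp

section \<open>Arbitrarily long bounded paths\<close>

text \<open>Goodness depends only on the edges owned by the box; hence it is independent for
  different boxes.\<close>

lemma good_site_cong:
  assumes eq: "\<And>z d. in_box n b c z \<Longrightarrow> w (z, d) = w' (z, d)"
  shows "good_site n b \<Lambda> \<beta> K w c \<longleftrightarrow> good_site n b \<Lambda> \<beta> K w' c"
proof -
  let ?q = "corner n b c"
  have row: "row_cost w (?q + (dx, dy)) (2 * n + 1) = row_cost w' (?q + (dx, dy)) (2 * n + 1)"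
    if "0 \<le> dx" "dx \<le> 2 * int n + 1" "0 \<le> dy" "dy \<le> 2 * int n + 1" for dx dy
    unfolding row_cost_def using that by (intro sum.cong refl arg_cong[where f = abs] eq) (auto simp: in_box_def)
  have row0: "row_cost w ?q (2 * n + 1) = row_cost w' ?q (2 * n + 1)"
    using row[of 0 0] by (simp add: zero_prod_def[symmetric])
  have gadget: "good_gadget n \<Lambda> \<beta> w (?q + (dx, 0)) = good_gadget n \<Lambda> \<beta> w' (?q + (dx, 0))"
    if dx: "dx = 0 \<or> dx = 2 * int n + 1" for dx
  proof -
    have "col_cost w (?q + (dx, 0)) (2 * n + 2) = col_cost w' (?q + (dx, 0)) (2 * n + 2)"
      unfolding col_cost_def using dx by (intro sum.cong refl arg_cong[where f = abs] eq) (auto simp: in_box_def)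
    moreover have "turn_cost w (?q + (dx, 0)) n n = turn_cost w' (?q + (dx, 0)) n n"
      unfolding turn_cost_def using dx by (intro sum.cong refl arg_cong[where f = abs] eq) (auto simp: in_box_def)
    moreover have "strip w (?q + (dx, 0) + (0, 2 * int t + 1)) n = strip w' (?q + (dx, 0) + (0, 2 * int t + 1)) n" if "t < n" for t
      unfolding strip_def using dx that
      by (intro sum.cong refl arg_cong2[where f = "(-)"] eq) (auto simp: in_box_def)
    ultimately show ?thesis unfolding good_gadget_def by (simp cong: conj_cong)
  qed
  have gadget0: "good_gadget n \<Lambda> \<beta> w ?q = good_gadget n \<Lambda> \<beta> w' ?q"
    using gadget[of 0] by (simp add: zero_prod_def[symmetric])
  show ?thesis unfolding good_site_def using row0 gadget0 row[of "2 * int n + 1" "2 * int n + 1"] gadget[of "2 * int n + 1"] eq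
    by simp
qed

lemma good_site_measurable:
  assumes g [measurable]: "\<And>e. (\<lambda>x. g x e) \<in> borel_measurable N"
  shows "{x \<in> space N. good_site n b \<Lambda> \<beta> K (g x) c} \<in> sets N"
proof -
  have card: "real (card {t. t < n \<and> P t}) = (\<Sum>t<n. if P t then 1 else 0)" for P
    by (simp add: sum.If_cases Int_def)
  have [measurable]: "(\<lambda>x. row_cost (g x) p m) \<in> borel_measurable N" "(\<lambda>x. col_cost (g x) p m) \<in> borel_measurable N"
    "(\<lambda>x. turn_cost (g x) p m m') \<in> borel_measurable N" "(\<lambda>x. strip (g x) p m) \<in> borel_measurable N" for p m m'
    unfolding row_cost_def col_cost_def turn_cost_def strip_def by measurable
  have [measurable]: "Measurable.pred N (\<lambda>x. good_gadget n \<Lambda> \<beta> (g x) p)" for p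
    unfolding good_gadget_def card by measurable
  show ?thesis unfolding good_site_def by measurable
qed

context prob_space begin

lemma prob_union_list:
  fixes \<epsilon> :: real
  shows "(\<And>A. A \<in> set As \<Longrightarrow> A \<in> events \<and> prob A \<le> \<epsilon>) \<Longrightarrow> prob (\<Union>(set As)) \<le> length As * \<epsilon>"
proof (induction As)
  case (Cons A As)
  have "prob (A \<union> \<Union>(set As)) \<le> prob A + prob (\<Union>(set As))"
    using Cons.prems by (intro measure_Un_le sets.finite_Union) auto
  then show ?case using Cons by (fastforce simp: algebra_simps)
qed simp

end

context lattice_field begin

abbreviation cfg :: "'w \<Rightarrow> config" where "cfg \<omega> \<equiv> \<lambda>e. W e \<omega>"

lemma sum_eq_cost:
  assumes "inj_on f {..<m}"
  shows "(\<Sum>j<m. \<bar>W (f j) \<omega>\<bar>) = cost (f ` {..<m}) \<omega>" "finite (f ` {..<m})" "card (f ` {..<m}) = m"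
  using assms by (simp_all add: cost_def sum.reindex card_image)

text \<open>The bad events are: two costs above \<open>\<Lambda>\<close>, and too few favourable
  detours for one of the two signs. The negative sign is the positive one with the two rows of
  each detour exchanged.\<close>

lemma gadget_bad_prob:
  assumes ok: "scale_ok \<epsilon> n \<Lambda> \<beta>"
  shows "{\<omega> \<in> space M. \<not> good_gadget n \<Lambda> \<beta> (cfg \<omega>) p} \<in> events"
    and "prob {\<omega> \<in> space M. \<not> good_gadget n \<Lambda> \<beta> (cfg \<omega>) p} \<le> 4 * \<epsilon>"
proof -
  have n: "n > 0" using ok by (simp add: scale_ok_def)
  define f where "f s t i = (p + (int (fst i), 2 * int t + 1 + (if snd i = s then 0 else 1)), True)"
    for s :: bool and t :: nat and i :: "nat \<times> bool"
  have inj: "inj_on (case_prod (f s)) ({..<n} \<times> ({..<n} \<times> UNIV))" for s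
    unfolding f_def inj_on_def by (auto split: if_splits) presburger+
  have strip: "strip (cfg \<omega>) (p + (0, 2 * int t + 1)) n = strip_diff n (f True t) \<omega>"
    "- strip (cfg \<omega>) (p + (0, 2 * int t + 1)) n = strip_diff n (f False t) \<omega>" for \<omega> t
    unfolding strip_def strip_diff_def f_def by (simp_all add: add.assoc sum_negf[symmetric])
  define C where "C s \<omega> = real (card {t. t < n \<and> \<beta> \<le> strip_diff n (f s t) \<omega>}) * \<beta>" for s \<omega>
  have card: "real (card {t. t < n \<and> P t}) = (\<Sum>t<n. if P t then 1 else 0)" for P
    by (simp add: sum.If_cases Int_def)
  have [measurable]: "C s \<in> borel_measurable M" for s unfolding C_def card by measurable
  have C: "prob {\<omega> \<in> space M. C s \<omega> < 4 * \<Lambda>} \<le> \<epsilon>" for s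
    using ok inj[of s] unfolding scale_ok_def C_def by (simp add: f_def)
  define c where "c j = (p + (0, int j), False)" for j :: nat
  define d where "d t = (p + (int n, 2 * int t + 1), False)" for t :: nat
  have injc: "inj_on c {..<2 * n + 2}" and injd: "inj_on d {..<n}" by (auto simp: c_def d_def inj_on_def)
  have col: "col_cost (cfg \<omega>) p (2 * n + 2) = cost (c ` {..<2 * n + 2}) \<omega>"
    and turn: "turn_cost (cfg \<omega>) p n n = cost (d ` {..<n}) \<omega>" for \<omega>
    unfolding col_cost_def turn_cost_def sum_eq_cost(1)[OF injc, symmetric] sum_eq_cost(1)[OF injd, symmetric]
    by (simp_all add: c_def d_def)
  have cost: "prob {\<omega> \<in> space M. cost (c ` {..<2 * n + 2}) \<omega> > \<Lambda>} \<le> \<epsilon>" "prob {\<omega> \<in> space M. cost (d ` {..<n}) \<omega> > \<Lambda>} \<le> \<epsilon>"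
    using ok sum_eq_cost(2,3)[OF injc] sum_eq_cost(2,3)[OF injd] n unfolding scale_ok_def by auto
  have "good_gadget n \<Lambda> \<beta> (cfg \<omega>) p \<longleftrightarrow> cost (c ` {..<2 * n + 2}) \<omega> \<le> \<Lambda> \<and> cost (d ` {..<n}) \<omega> \<le> \<Lambda> \<and>
      4 * \<Lambda> \<le> C True \<omega> \<and> 4 * \<Lambda> \<le> C False \<omega>" for \<omega>
    unfolding good_gadget_def col turn C_def strip[symmetric] ..
  then have eq: "{\<omega> \<in> space M. \<not> good_gadget n \<Lambda> \<beta> (cfg \<omega>) p} =
    \<Union>(set [{\<omega> \<in> space M. cost (c ` {..<2 * n + 2}) \<omega> > \<Lambda>}, {\<omega> \<in> space M. cost (d ` {..<n}) \<omega> > \<Lambda>},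
      {\<omega> \<in> space M. C True \<omega> < 4 * \<Lambda>}, {\<omega> \<in> space M. C False \<omega> < 4 * \<Lambda>}])"
    by (auto simp: not_le)
  show "{\<omega> \<in> space M. \<not> good_gadget n \<Lambda> \<beta> (cfg \<omega>) p} \<in> events" unfolding eq by simp
  show "prob {\<omega> \<in> space M. \<not> good_gadget n \<Lambda> \<beta> (cfg \<omega>) p} \<le> 4 * \<epsilon>"
    unfolding eq by (rule order_trans[OF prob_union_list[where \<epsilon> = \<epsilon>]]) (use C cost in auto)
qed

text \<open>Two rows, two climbs with four bad events each, and the bound \<open>K\<close> make
  eleven bad events. \<open>K\<close> is chosen after the scale, as a quantile of the cost of the
  whole box.\<close>

lemma site_bad_prob:
  assumes ok: "scale_ok \<epsilon> n \<Lambda> \<beta>" and \<epsilon>: "0 < \<epsilon>" "\<epsilon> < 1"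
  obtains K where "K \<ge> 0" "\<And>c. prob {\<omega> \<in> space M. \<not> good_site n b \<Lambda> \<beta> K (cfg \<omega>) c} \<le> 11 * \<epsilon>"
proof -
  have n: "n > 0" using ok by (simp add: scale_ok_def)
  define m where "m = (2 * (2 * n + 1)) * (2 * n + 2) * 2"
  have m: "m > 0" by (simp add: m_def)
  obtain K where K: "K \<ge> 0" "prob {\<omega> \<in> space M. cost (base_row m) \<omega> > K} \<le> \<epsilon>"
    using row_quantile[OF \<epsilon> m] by blast
  have "prob {\<omega> \<in> space M. \<not> good_site n b \<Lambda> \<beta> K (cfg \<omega>) c} \<le> 11 * \<epsilon>" for c
  proof -
    let ?q = "corner n b c"
    define Bx where "Bx = {z. in_box n b c z} \<times> (UNIV :: bool set)"
    have "{z. in_box n b c z} = {fst ?q..<fst ?q + 2 * (2 * int n + 1)} \<times> {snd ?q..<snd ?q + (2 * int n + 2)}"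
      by (auto simp: in_box_def)
    then have Bx: "finite Bx" "card Bx = m"
      unfolding Bx_def m_def by (auto simp: card_cartesian_product nat_add_distrib nat_mult_distrib)
    have K_bad: "prob {\<omega> \<in> space M. cost Bx \<omega> > K} \<le> \<epsilon>"
      using cost_tail_le_row[OF Bx(1), of m K] Bx(2) m K(2) by simp
    have K_cost: "cost Bx \<omega> > K" if "\<bar>W (z, d) \<omega>\<bar> > K" "in_box n b c z" for \<omega> z d
    proof -
      have "cost {(z, d)} \<omega> \<le> cost Bx \<omega>" by (rule cost_mono) (use Bx that in \<open>auto simp: Bx_def\<close>)
      then show ?thesis using that by (simp add: cost_def)
    qed
    define r where "r p j = (p + (int j, 0), True)" for p :: vertex and j :: nat
    have injr: "inj_on (r p) {..<2 * n + 1}" for p by (auto simp: r_def inj_on_def)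
    have row: "row_cost (cfg \<omega>) p (2 * n + 1) = cost (r p ` {..<2 * n + 1}) \<omega>" for p \<omega>
      unfolding row_cost_def sum_eq_cost(1)[OF injr, symmetric] by (simp add: r_def)
    have row_bad: "prob {\<omega> \<in> space M. cost (r p ` {..<2 * n + 1}) \<omega> > \<Lambda>} \<le> \<epsilon>" for p
      using ok sum_eq_cost(2,3)[OF injr[of p]] n unfolding scale_ok_def by auto
    define G where "G p = {\<omega> \<in> space M. \<not> good_gadget n \<Lambda> \<beta> (cfg \<omega>) p}" for p
    define R where "R p = {\<omega> \<in> space M. cost (r p ` {..<2 * n + 1}) \<omega> > \<Lambda>}" for p
    have R_bad: "prob (R p) \<le> \<epsilon>" for p unfolding R_def by (rule row_bad)
    let ?r2 = "?q + (2 * int n + 1, 2 * int n + 1)" and ?p2 = "?q + (2 * int n + 1, 0)"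
    let ?KB = "{\<omega> \<in> space M. cost Bx \<omega> > K}"
    have ev: "G p \<in> events" "R p \<in> events" "?KB \<in> events" for p
      unfolding G_def R_def using gadget_bad_prob(1)[OF ok] by auto
    have "{\<omega> \<in> space M. \<not> good_site n b \<Lambda> \<beta> K (cfg \<omega>) c} \<subseteq> \<Union>(set [R ?q, R ?r2, ?KB]) \<union> (G ?q \<union> G ?p2)"
      unfolding good_site_def row G_def R_def by (auto simp: not_less not_le dest: K_cost)
    then have "prob {\<omega> \<in> space M. \<not> good_site n b \<Lambda> \<beta> K (cfg \<omega>) c} \<le> prob (\<Union>(set [R ?q, R ?r2, ?KB]) \<union> (G ?q \<union> G ?p2))"
      using ev by (intro finite_measure_mono) auto
    also have "\<dots> \<le> prob (\<Union>(set [R ?q, R ?r2, ?KB])) + prob (G ?q \<union> G ?p2)"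
      using ev by (intro measure_Un_le) auto
    also have "\<dots> \<le> 3 * \<epsilon> + (4 * \<epsilon> + 4 * \<epsilon>)"
    proof (rule add_mono)
      show "prob (\<Union>(set [R ?q, R ?r2, ?KB])) \<le> 3 * \<epsilon>"
      proof (rule order_trans[OF prob_union_list[where \<epsilon> = \<epsilon>]])
        fix A assume "A \<in> set [R ?q, R ?r2, ?KB]"
        then have "A = R ?q \<or> A = R ?r2 \<or> A = ?KB" by simp
        then show "A \<in> events \<and> prob A \<le> \<epsilon>"
          using ev(2)[of ?q] ev(2)[of ?r2] ev(3) R_bad[of ?q] R_bad[of ?r2] K_bad by (elim disjE) simp_all
      qed simp
      have "prob (G ?q \<union> G ?p2) \<le> prob (G ?q) + prob (G ?p2)" using ev by (intro measure_Un_le) auto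
      also have "\<dots> \<le> 4 * \<epsilon> + 4 * \<epsilon>" unfolding G_def by (intro add_mono gadget_bad_prob(2)[OF ok])
      finally show "prob (G ?q \<union> G ?p2) \<le> 4 * \<epsilon> + 4 * \<epsilon>" .
    qed
    finally show ?thesis by simp
  qed
  then show ?thesis using that K(1) by blast
qed

lemma bounded_paths_positive_prob:
  obtains A t where "A \<in> events" "prob A > 0" "t > 0"
    "\<And>\<omega> m. \<omega> \<in> A \<Longrightarrow> \<exists>P. P \<noteq> [] \<and> hd P = b \<and> walk P \<and> distinct P \<and> length P \<ge> m \<and> (\<forall>i. \<bar>walk_sum (cfg \<omega>) (take i P)\<bar> \<le> t)"
proof -
  \<comment> \<open>\<open>11 / 2000\<close> is below the threshold \<open>1 / 162\<close> for
    percolation.\<close>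
  obtain n \<Lambda> \<beta> where ok: "scale_ok (1 / 2000) n \<Lambda> \<beta>" using scale_exists[of "1 / 2000"] by auto
  obtain K where K: "K \<ge> 0" "\<And>c. prob {\<omega> \<in> space M. \<not> good_site n b \<Lambda> \<beta> K (cfg \<omega>) c} \<le> 11 * (1 / 2000)"
    using site_bad_prob[OF ok, of b] by auto
  define Bd where "Bd \<omega> = {c. \<not> good_site n b \<Lambda> \<beta> K (cfg \<omega>) c}" for \<omega>
  have good_ev: "{\<omega> \<in> space M. good_site n b \<Lambda> \<beta> K (cfg \<omega>) c} \<in> events" for c
    by (rule good_site_measurable) measurable
  have Bd_ev: "{\<omega> \<in> space M. c \<in> Bd \<omega>} \<in> events" for c
  proof -
    have "{\<omega> \<in> space M. c \<in> Bd \<omega>} = space M - {\<omega> \<in> space M. good_site n b \<Lambda> \<beta> K (cfg \<omega>) c}" by (auto simp: Bd_def)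
    then show ?thesis using good_ev[of c] by simp
  qed
  define Bx where "Bx c = {z. in_box n b c z} \<times> (UNIV :: bool set)" for c
  \<comment> \<open>Goodness as a function of the weights in the box alone; the value 0 outside is
    arbitrary.\<close>
  define ext where "ext c x = (\<lambda>e. if e \<in> Bx c then x e else (0::real))" for c x
  have "disjoint_family_on Bx UNIV"
    unfolding disjoint_family_on_def Bx_def in_box_iff by auto
  then have "indep_vars (\<lambda>c. PiM (Bx c) (\<lambda>_. borel)) (\<lambda>c \<omega>. restrict (cfg \<omega>) (Bx c)) UNIV"
    by (rule indep_vars_restrict[OF indep, rotated]) simp
  then have "indep_events (\<lambda>c. {\<omega> \<in> space M. \<not> good_site n b \<Lambda> \<beta> K (ext c (restrict (cfg \<omega>) (Bx c))) c}) UNIV"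
  proof (rule indep_eventsI_indep_vars)
    fix c
    let ?N = "PiM (Bx c) (\<lambda>_. borel :: real measure)"
    have "(\<lambda>x. ext c x e) \<in> borel_measurable ?N" for e
      unfolding ext_def by (cases "e \<in> Bx c") (auto intro!: measurable_component_singleton[of _ "Bx c" "\<lambda>_. borel"])
    then have "{x \<in> space ?N. good_site n b \<Lambda> \<beta> K (ext c x) c} \<in> sets ?N" by (rule good_site_measurable)
    moreover have "{x \<in> space ?N. \<not> good_site n b \<Lambda> \<beta> K (ext c x) c} = space ?N - {x \<in> space ?N. good_site n b \<Lambda> \<beta> K (ext c x) c}"
      by auto
    ultimately show "{x \<in> space ?N. \<not> good_site n b \<Lambda> \<beta> K (ext c x) c} \<in> sets ?N" by simp
  qed
  moreover have "good_site n b \<Lambda> \<beta> K (ext c (restrict (cfg \<omega>) (Bx c))) c = good_site n b \<Lambda> \<beta> K (cfg \<omega>) c" for c \<omega>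
    by (rule good_site_cong) (auto simp: ext_def Bx_def)
  ultimately have ind: "indep_events (\<lambda>c. {\<omega> \<in> space M. c \<in> Bd \<omega>}) UNIV" by (simp add: Bd_def)
  have F: "prob {\<omega> \<in> space M. F \<subseteq> Bd \<omega>} \<le> (1 / 162) ^ card F" if "finite F" "F \<noteq> {}" for F
  proof -
    have "{\<omega> \<in> space M. F \<subseteq> Bd \<omega>} = (\<Inter>c\<in>F. {\<omega> \<in> space M. c \<in> Bd \<omega>})" using that by auto
    then have "prob {\<omega> \<in> space M. F \<subseteq> Bd \<omega>} = (\<Prod>c\<in>F. prob {\<omega> \<in> space M. c \<in> Bd \<omega>})"
      using ind that unfolding indep_events_def by simp
    also have "\<dots> \<le> (\<Prod>c\<in>F. 1 / 162)"
    proof (intro prod_mono conjI)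
      fix c
      have "prob {\<omega> \<in> space M. c \<in> Bd \<omega>} \<le> 11 * (1 / 2000)" using K(2)[of c] by (simp add: Bd_def)
      then show "prob {\<omega> \<in> space M. c \<in> Bd \<omega>} \<le> 1 / 162" by simp
    qed simp
    finally show ?thesis by simp
  qed
  define A where "A = {\<omega> \<in> space M. \<forall>k. \<not> bad (Bd \<omega>) k (0, 0)}"
  have A: "A \<in> events" "prob A > 0"
    using percolation_positive_prob[OF Bd_ev F] unfolding A_def by blast+
  define T where "T = K * real (2 * n * (n + 1) + 4 * n + 4)"
  have T0: "T \<ge> 0" unfolding T_def using K(1) by simp
  show ?thesis
  proof (rule that[OF A, of "2 * T + 1"])
    fix \<omega> m assume "\<omega> \<in> A"
    then have "\<And>k. \<not> bad (Bd \<omega>) k (0, 0)" by (simp add: A_def)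
    then obtain p where p: "walk ((0, 0) # p)" "distinct ((0, 0) # p)" "set ((0, 0) # p) \<inter> Bd \<omega> = {}" "length p \<ge> m"
      using good_path[of "Bd \<omega>" m] by blast
    have good: "good_site n b \<Lambda> \<beta> K (cfg \<omega>) c" if "c \<in> set ((0, 0) # p)" for c
      using p(3) that by (auto simp: Bd_def)
    have "corner n b (0, 0) = b" by (simp add: corner_def zero_prod_def[symmetric])
    then obtain P where P: "P \<noteq> []" "hd P = b" "walk P" "distinct P" "\<And>i. \<bar>walk_sum (cfg \<omega>) (take i P)\<bar> \<le> 2 * T" "length P \<ge> length ((0, 0) # p)"
      using bounded_path_along[OF K(1) _ p(1,2) good] unfolding T_def by auto
    have "\<bar>walk_sum (cfg \<omega>) (take i P)\<bar> \<le> 2 * T + 1" for i using P(5)[of i] by linarith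
    then show "\<exists>P. P \<noteq> [] \<and> hd P = b \<and> walk P \<and> distinct P \<and> length P \<ge> m \<and> (\<forall>i. \<bar>walk_sum (cfg \<omega>) (take i P)\<bar> \<le> 2 * T + 1)"
      using P p(4) by (intro exI[of _ P]) auto
  qed (use T0 in simp)
qed

end

section \<open>Infinite bounded paths by Konig's lemma\<close>

text \<open>Konig's lemma for the tree of finite sequences with the property \<open>Q\<close>: a
  sequence with arbitrarily long extensions has a one-step extension with arbitrarily long
  extensions.\<close>

lemma konig:
  fixes Q :: "'a list \<Rightarrow> bool"
  assumes prefix: "\<And>p q. Q (p @ q) \<Longrightarrow> Q p"
    and fin: "\<And>p. finite {v. Q (p @ [v])}"
    and long: "\<And>m. \<exists>p. Q p \<and> length p = m"
  shows "\<exists>\<gamma>. \<forall>m. Q (map \<gamma> [0..<m])"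
proof -
  define E where "E p \<longleftrightarrow> (\<forall>m. \<exists>q. length q \<ge> m \<and> Q (p @ q))" for p
  have E0: "E []" unfolding E_def
  proof
    fix m
    show "\<exists>q. length q \<ge> m \<and> Q ([] @ q)" using long[of m] by auto
  qed
  have step: "\<exists>v. E (p @ [v])" if "E p" for p
  proof (rule ccontr)
    assume "\<not> ?thesis"
    then have "\<forall>v. \<exists>m. \<forall>q. length q \<ge> m \<longrightarrow> \<not> Q ((p @ [v]) @ q)" unfolding E_def by blast
    then obtain f where f: "\<And>v q. length q \<ge> f v \<Longrightarrow> \<not> Q ((p @ [v]) @ q)" by metis
    define F where "F = {v. Q (p @ [v])}"
    have fF: "finite F" unfolding F_def by (rule fin)
    define m where "m = Suc (\<Sum>v\<in>F. f v)"
    obtain q where q: "length q \<ge> m" "Q (p @ q)" using \<open>E p\<close> unfolding E_def by blast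
    then obtain v q' where v: "q = v # q'" by (cases q) (auto simp: m_def)
    have Qv: "Q ((p @ [v]) @ q')" using q v by simp
    then have "v \<in> F" unfolding F_def using prefix by blast
    then have "f v \<le> (\<Sum>v\<in>F. f v)" using fF by (simp add: member_le_sum)
    then have "f v \<le> length q'" using q(1) v by (simp add: m_def)
    then show False using f Qv by blast
  qed
  obtain P where P: "\<And>k. E (P k) \<and> length (P k) = k" "\<And>k. \<exists>v. P (Suc k) = P k @ [v]"
  proof -
    have "\<exists>P. \<forall>k. (E (P k) \<and> length (P k) = k) \<and> (\<exists>v. P (Suc k) = P k @ [v])"
    proof (rule dependent_nat_choice)
      show "\<exists>p. E p \<and> length p = 0" using E0 by auto
      fix p k assume "E p \<and> length p = k"
      then obtain v where "E (p @ [v])" "length (p @ [v]) = Suc k" using step[of p] by auto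
      then show "\<exists>p'. (E p' \<and> length p' = Suc k) \<and> (\<exists>v. p' = p @ [v])" by blast
    qed
    then show ?thesis using that by blast
  qed
  define \<gamma> where "\<gamma> k = last (P (Suc k))" for k
  have "P m = map \<gamma> [0..<m]" for m
  proof (induction m)
    case 0 show ?case using P(1)[of 0] by simp
  next
    case (Suc m)
    obtain v where "P (Suc m) = P m @ [v]" using P(2) by blast
    then have "P (Suc m) = P m @ [\<gamma> m]" by (simp add: \<gamma>_def)
    then show ?case using Suc by simp
  qed
  moreover have "Q (P m)" for m
  proof -
    obtain q where "Q (P m @ q)" using P(1)[of m] unfolding E_def by blast
    then show ?thesis by (rule prefix)
  qed
  ultimately show ?thesis by metis
qed

definition nbrs :: "vertex \<Rightarrow> vertex set" where
  "nbrs u = {u + (1, 0), u + (-1, 0), u + (0, 1), u + (0, -1)}"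

lemma adj_nbrs: "adj u v \<Longrightarrow> v \<in> nbrs u"
proof -
  assume "adj u v"
  then have "(fst v - fst u, snd v - snd u) = (1, 0) \<or> (fst v - fst u, snd v - snd u) = (-1, 0) \<or>
      (fst v - fst u, snd v - snd u) = (0, 1) \<or> (fst v - fst u, snd v - snd u) = (0, -1)"
    unfolding adj_def by (intro abs_sum_1_cases) (simp add: abs_minus_commute)
  then show ?thesis by (auto simp: nbrs_def prod_eq_iff)
qed

text \<open>The empty sequence is included, so that prefixes of every length qualify.\<close>

definition bounded_walk :: "config \<Rightarrow> vertex \<Rightarrow> real \<Rightarrow> vertex list \<Rightarrow> bool" where
  "bounded_walk w b t p \<longleftrightarrow> (p \<noteq> [] \<longrightarrow> hd p = b) \<and> walk p \<and> distinct p \<and> (\<forall>i. \<bar>walk_sum w (take i p)\<bar> \<le> t)"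

lemma bounded_walk_prefix: "bounded_walk w b t (p @ q) \<Longrightarrow> bounded_walk w b t p"
proof -
  assume *: "bounded_walk w b t (p @ q)"
  have "\<bar>walk_sum w (take i p)\<bar> \<le> t" for i
  proof -
    have "take i p = take (min i (length p)) (p @ q)" by (simp add: min_def)
    then show ?thesis using * unfolding bounded_walk_def by metis
  qed
  moreover have "walk p" using * unfolding bounded_walk_def successively_append_iff by blast
  ultimately show ?thesis using * unfolding bounded_walk_def by (simp add: hd_append split: if_splits)
qed

lemma finite_bounded_walk_extensions: "finite {v. bounded_walk w b t (p @ [v])}"
proof (cases "p = []")
  case True
  then have "{v. bounded_walk w b t (p @ [v])} \<subseteq> {b}" by (auto simp: bounded_walk_def)
  then show ?thesis using finite_subset by blast
next
  case False
  then have "{v. bounded_walk w b t (p @ [v])} \<subseteq> nbrs (last p)"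
    by (auto simp: bounded_walk_def successively_append_iff intro: adj_nbrs)
  then show ?thesis using finite_subset by (auto simp: nbrs_def)
qed

lemma bounded_infinite_walk:
  assumes "\<And>m. \<exists>p. bounded_walk w b t p \<and> length p = m"
  shows "\<exists>\<gamma>. \<forall>m. bounded_walk w b t (map \<gamma> [0..<m])"
  by (rule konig[OF bounded_walk_prefix finite_bounded_walk_extensions]) (use assms in auto)

text \<open>From the coordinates of \<open>lattice_field\<close> to edges as sets of two
  vertices.\<close>

definition edge_at :: "vertex \<times> bool \<Rightarrow> edge" where
  "edge_at e = {fst e, fst e + (if snd e then (1, 0) else (0, 1))}"

definition signed_weight :: "(edge \<Rightarrow> real) \<Rightarrow> (edge \<Rightarrow> real) \<Rightarrow> config" where
  "signed_weight x y e = y (edge_at e) * x (edge_at e)"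

lemma E2_iff_adj: "{u, v} \<in> E2 \<longleftrightarrow> adj u v"
  unfolding E2_def adj_def by (cases u; cases v) (auto simp: doubleton_eq_iff abs_minus_commute)

lemma edge_at_E2: "edge_at e \<in> E2"
  by (simp add: edge_at_def E2_iff_adj adj_def)

text \<open>The signs of the partial sums in coordinates agree with those of
  \<open>Z\<close>.\<close>

lemma increment_signed_weight:
  assumes "adj u v"
  shows "increment (signed_weight x y) u v = Z y u v * x {u, v}"
  using adj_nbrs[OF assms]
  by (auto simp: nbrs_def increment_def signed_weight_def edge_at_def Z_def insert_commute add.assoc zero_prod_def[symmetric])

lemma S_eq_walk_sum:
  assumes "\<And>k. adj (\<gamma> k) (\<gamma> (Suc k))"
  shows "S x y \<gamma> N = walk_sum (signed_weight x y) (map \<gamma> [0..<Suc N])"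
proof (induction N)
  case 0 show ?case by (simp add: S_def)
next
  case (Suc N)
  have "walk_sum (signed_weight x y) (map \<gamma> [0..<Suc (Suc N)]) = walk_sum (signed_weight x y) (map \<gamma> [0..<Suc N] @ [\<gamma> (Suc N)])" by simp
  also have "\<dots> = walk_sum (signed_weight x y) (map \<gamma> [0..<Suc N]) + increment (signed_weight x y) (\<gamma> N) (\<gamma> (Suc N))"
    by (subst walk_sum_append) (auto simp: last_map)
  finally show ?case using Suc increment_signed_weight[OF assms[of N]] by (simp add: S_def)
qed

lemma Gamma_iff: "\<gamma> \<in> \<Gamma> b \<longleftrightarrow> \<gamma> 0 = b \<and> (\<forall>k. adj (\<gamma> k) (\<gamma> (Suc k))) \<and> inj \<gamma>"
proof -
  have "(\<forall>k\<ge>1. {\<gamma> (k - 1), \<gamma> k} \<in> E2) \<longleftrightarrow> (\<forall>k. adj (\<gamma> k) (\<gamma> (Suc k)))"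
    unfolding E2_iff_adj
  proof safe
    fix k assume "\<forall>k\<ge>1. adj (\<gamma> (k - 1)) (\<gamma> k)"
    then show "adj (\<gamma> k) (\<gamma> (Suc k))" by (metis diff_Suc_1 le_add1 plus_1_eq_Suc)
  next
    fix k :: nat assume *: "\<forall>k. adj (\<gamma> k) (\<gamma> (Suc k))" "k \<ge> 1"
    then show "adj (\<gamma> (k - 1)) (\<gamma> k)" by (cases k) auto
  qed
  then show ?thesis unfolding \<Gamma>_def infinite_path_def self_avoiding_def by auto
qed

lemma walk_map_upt: "walk (map \<gamma> [0..<m]) \<longleftrightarrow> (\<forall>k. Suc k < m \<longrightarrow> adj (\<gamma> k) (\<gamma> (Suc k)))"
  by (simp add: successively_conv_nth)

lemma bounded_walk_Gamma:
  assumes \<gamma>: "\<gamma> \<in> \<Gamma> b" and t: "t \<ge> 0"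
  shows "(\<forall>N. \<bar>S x y \<gamma> N\<bar> \<le> t) \<longleftrightarrow> (\<forall>m. bounded_walk (signed_weight x y) b t (map \<gamma> [0..<m]))"
proof -
  have g: "\<gamma> 0 = b" "\<And>k. adj (\<gamma> k) (\<gamma> (Suc k))" "inj \<gamma>" using \<gamma> by (auto simp: Gamma_iff)
  have S: "S x y \<gamma> N = walk_sum (signed_weight x y) (map \<gamma> [0..<Suc N])" for N by (rule S_eq_walk_sum[of \<gamma> x y N, OF g(2)])
  show ?thesis
  proof safe
    fix m assume *: "\<forall>N. \<bar>S x y \<gamma> N\<bar> \<le> t"
    have "\<bar>walk_sum (signed_weight x y) (map \<gamma> [0..<k])\<bar> \<le> t" for k
      using *[unfolded S] t by (cases k) auto
    then have "\<bar>walk_sum (signed_weight x y) (take i (map \<gamma> [0..<m]))\<bar> \<le> t" for i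
    proof -
      have "take i (map \<gamma> [0..<m]) = map \<gamma> [0..<min i m]" by (rule nth_equalityI) auto
      then show ?thesis using \<open>\<And>k. \<bar>walk_sum (signed_weight x y) (map \<gamma> [0..<k])\<bar> \<le> t\<close> by simp
    qed
    then show "bounded_walk (signed_weight x y) b t (map \<gamma> [0..<m])"
      unfolding bounded_walk_def walk_map_upt
      using g(1,2) inj_on_subset[OF g(3), of "{0..<m}"] by (simp add: distinct_map hd_map)
  next
    fix N assume *: "\<forall>m. bounded_walk (signed_weight x y) b t (map \<gamma> [0..<m])"
    have "\<bar>walk_sum (signed_weight x y) (take (Suc N) (map \<gamma> [0..<Suc N]))\<bar> \<le> t" using * unfolding bounded_walk_def by blast
    then show "\<bar>S x y \<gamma> N\<bar> \<le> t" unfolding S by simp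
  qed
qed

lemma infinite_walk_Gamma:
  assumes "\<And>m. bounded_walk w b t (map \<gamma> [0..<m])"
  shows "\<gamma> \<in> \<Gamma> b"
  unfolding Gamma_iff
proof (intro conjI allI injI)
  show "\<gamma> 0 = b" using assms[of 1] by (simp add: bounded_walk_def)
  show "adj (\<gamma> k) (\<gamma> (Suc k))" for k
    using assms[of "Suc (Suc k)"] unfolding bounded_walk_def walk_map_upt by blast
  fix i j assume "\<gamma> i = \<gamma> j"
  moreover have "distinct (map \<gamma> [0..<Suc (i + j)])" using assms unfolding bounded_walk_def by blast
  then have "inj_on \<gamma> {0..<Suc (i + j)}" by (simp only: distinct_map set_upt)
  ultimately show "i = j" by (auto dest: inj_onD)
qed

lemma Sigma_le_if:
  assumes t: "t \<ge> 0" and p: "\<And>m. \<exists>p. bounded_walk (signed_weight x y) b t p \<and> length p = m"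
  shows "\<Sigma> x y b \<le> ennreal t"
proof -
  obtain \<gamma> where \<gamma>: "\<And>m. bounded_walk (signed_weight x y) b t (map \<gamma> [0..<m])"
    using bounded_infinite_walk[OF p] by blast
  have G: "\<gamma> \<in> \<Gamma> b" using \<gamma> by (rule infinite_walk_Gamma)
  then have "\<bar>S x y \<gamma> N\<bar> \<le> t" for N using bounded_walk_Gamma[OF G t] \<gamma> by blast
  then have "(SUP N. ennreal \<bar>S x y \<gamma> N\<bar>) \<le> ennreal t" by (intro SUP_least ennreal_leI)
  then show ?thesis unfolding \<Sigma>_def using G by (rule INF_lower2[rotated])
qed

text \<open>The infimum in \<open>\<Sigma>\<close> is at most \<open>t\<close> if and only if
  there is a path for each of the bounds \<open>t + 1 / (k + 1)\<close>, and by Konig's lemma each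
  of these conditions involves only countably many finite walks; hence it defines an
  event.\<close>

lemma Sigma_le_iff:
  assumes t: "t \<ge> 0"
  shows "\<Sigma> x y b \<le> ennreal t \<longleftrightarrow>
    (\<forall>k m. \<exists>p. bounded_walk (signed_weight x y) b (t + 1 / real (Suc k)) p \<and> length p = m)"
proof (intro iffI allI)
  assume p: "\<forall>k m. \<exists>p. bounded_walk (signed_weight x y) b (t + 1 / real (Suc k)) p \<and> length p = m"
  show "\<Sigma> x y b \<le> ennreal t"
  proof (rule ennreal_le_epsilon)
    fix e :: real assume "e > 0"
    then obtain k where k: "1 / real (Suc k) < e" using nat_approx_posE by blast
    have "\<Sigma> x y b \<le> ennreal (t + 1 / real (Suc k))" using p t by (intro Sigma_le_if) auto
    also have "\<dots> \<le> ennreal (t + e)" using k by (intro ennreal_leI) simp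
    also have "\<dots> = ennreal t + ennreal e" using t \<open>e > 0\<close> by (intro ennreal_plus) auto
    finally show "\<Sigma> x y b \<le> ennreal t + ennreal e" .
  qed
next
  fix k m assume le: "\<Sigma> x y b \<le> ennreal t"
  let ?t = "t + 1 / real (Suc k)"
  have t': "0 \<le> ?t" using t by simp
  have "\<Sigma> x y b < ennreal ?t"
    using t by (intro le_less_trans[OF le]) (simp add: ennreal_less_iff)
  then obtain \<gamma> where \<gamma>: "\<gamma> \<in> \<Gamma> b" "(SUP N. ennreal \<bar>S x y \<gamma> N\<bar>) < ennreal ?t"
    unfolding \<Sigma>_def INF_less_iff by blast
  have "\<bar>S x y \<gamma> N\<bar> \<le> ?t" for N
  proof -
    have "ennreal \<bar>S x y \<gamma> N\<bar> \<le> (SUP N. ennreal \<bar>S x y \<gamma> N\<bar>)" by (rule SUP_upper) simp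
    then have "ennreal \<bar>S x y \<gamma> N\<bar> \<le> ennreal ?t" using \<gamma>(2) by simp
    then show ?thesis using t' by (simp add: ennreal_le_iff)
  qed
  then have "bounded_walk (signed_weight x y) b ?t (map \<gamma> [0..<m])"
    using bounded_walk_Gamma[OF \<gamma>(1) t'] by blast
  then show "\<exists>p. bounded_walk (signed_weight x y) b ?t p \<and> length p = m" by (intro exI[of _ "map \<gamma> [0..<m]"]) simp
qed

lemma Sigma_le_measurable:
  assumes t: "t \<ge> 0" and [measurable]: "\<And>e. (\<lambda>\<omega>. signed_weight (x \<omega>) (y \<omega>) e) \<in> borel_measurable N"
  shows "{\<omega> \<in> space N. \<Sigma> (x \<omega>) (y \<omega>) b \<le> ennreal t} \<in> sets N"
proof -
  have [measurable]: "(\<lambda>\<omega>. increment (signed_weight (x \<omega>) (y \<omega>)) u v) \<in> borel_measurable N" for u v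
    unfolding increment_def by measurable
  have [measurable]: "(\<lambda>\<omega>. walk_sum (signed_weight (x \<omega>) (y \<omega>)) p) \<in> borel_measurable N" for p
  proof (induction p)
    case (Cons u p)
    then show ?case by (cases p) auto
  qed simp
  show ?thesis unfolding Sigma_le_iff[OF t] bounded_walk_def by measurable
qed

section \<open>Reflection of the lattice and deterministic weights\<close>

text \<open>The constant is the place where the distribution function jumps from 0 to 1.\<close>

lemma (in prob_space) constant_of_trivial_cdf:
  fixes X :: "'a \<Rightarrow> real"
  assumes X [measurable]: "random_variable borel X"
    and t: "\<And>t. prob {\<omega> \<in> space M. X \<omega> \<le> t} = 0 \<or> prob {\<omega> \<in> space M. X \<omega> \<le> t} = 1"
  obtains a where "AE \<omega> in M. X \<omega> = a"
proof -
  define F where "F t = prob {\<omega> \<in> space M. X \<omega> \<le> t}" for t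
  have mono: "F s \<le> F t" if "s \<le> t" for s t
    unfolding F_def using that by (intro finite_measure_mono) auto
  have "(\<lambda>k::nat. F (real k)) \<longlonglongrightarrow> prob (\<Union>k::nat. {\<omega> \<in> space M. X \<omega> \<le> k})"
    unfolding F_def by (intro finite_Lim_measure_incseq) (auto simp: incseq_def)
  moreover have "(\<Union>k::nat. {\<omega> \<in> space M. X \<omega> \<le> k}) = space M" using real_arch_simple by blast
  ultimately have "(\<lambda>k::nat. F (real k)) \<longlonglongrightarrow> 1" by (simp add: prob_space)
  then have "\<forall>\<^sub>F k in sequentially. 0 < F (real k)" by (rule order_tendstoD) simp
  then obtain k1 :: nat where "0 < F (real k1)" using eventually_happens'[OF sequentially_bot] by blast
  then have k1: "F (real k1) = 1" using t[of "real k1"] unfolding F_def by linarith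
  have "(\<lambda>k::nat. F (- real k)) \<longlonglongrightarrow> prob (\<Inter>k::nat. {\<omega> \<in> space M. X \<omega> \<le> - real k})"
    unfolding F_def by (intro finite_Lim_measure_decseq) (auto simp: decseq_def)
  moreover have "(\<Inter>k::nat. {\<omega> \<in> space M. X \<omega> \<le> - real k}) = {}"
  proof -
    have "\<not> (\<forall>k::nat. x \<le> - real k)" for x :: real
      using reals_Archimedean2[of "- x"] by (smt (verit))
    then show ?thesis by blast
  qed
  ultimately have "(\<lambda>k::nat. F (- real k)) \<longlonglongrightarrow> 0" by simp
  then have "\<forall>\<^sub>F k in sequentially. F (- real k) < 1" by (rule order_tendstoD) simp
  then obtain k0 :: nat where k0: "F (- real k0) < 1" using eventually_happens'[OF sequentially_bot] by blast
  define S where "S = {t. F t = 1}"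
  have S: "S \<noteq> {}" "bdd_below S"
  proof -
    show "S \<noteq> {}" using k1 by (auto simp: S_def)
    have "- real k0 \<le> t" if "t \<in> S" for t
    proof (rule ccontr)
      assume "\<not> ?thesis"
      then have "F t \<le> F (- real k0)" by (intro mono) simp
      then show False using that k0 by (simp add: S_def)
    qed
    then show "bdd_below S" by (rule bdd_belowI)
  qed
  define a where "a = Inf S"
  have up: "AE \<omega> in M. X \<omega> \<le> a + 1 / real (Suc k)" for k
  proof -
    have "a < a + 1 / real (Suc k)" by simp
    then obtain s where "s \<in> S" "s < a + 1 / real (Suc k)"
      unfolding a_def using cInf_less_iff[OF S] by blast
    then have "F (a + 1 / real (Suc k)) \<ge> 1" using mono[of s "a + 1 / real (Suc k)"] by (simp add: S_def)
    then have "F (a + 1 / real (Suc k)) = 1" unfolding F_def using prob_le_1 by (simp add: eq_iff)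
    then show ?thesis unfolding F_def by (subst (asm) prob_eq_1) auto
  qed
  have low: "AE \<omega> in M. \<not> X \<omega> \<le> a - 1 / real (Suc k)" for k
  proof -
    have "a - 1 / real (Suc k) \<notin> S"
    proof
      assume "a - 1 / real (Suc k) \<in> S"
      then have "a \<le> a - 1 / real (Suc k)" unfolding a_def using S(2) by (rule cInf_lower)
      moreover have "0 < 1 / real (Suc k)" by simp
      ultimately show False by linarith
    qed
    then have "prob {\<omega> \<in> space M. X \<omega> \<le> a - 1 / real (Suc k)} = 0"
      using t[of "a - 1 / real (Suc k)"] by (auto simp: S_def F_def)
    then show ?thesis by (subst AE_iff_measurable[OF _ refl]) (auto simp: emeasure_eq_measure)
  qed
  have "AE \<omega> in M. \<forall>k::nat. X \<omega> \<le> a + 1 / real (Suc k) \<and> \<not> X \<omega> \<le> a - 1 / real (Suc k)"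
    using up low by (simp add: AE_all_countable)
  then have "AE \<omega> in M. X \<omega> = a"
  proof eventually_elim
    case (elim \<omega>)
    have "\<bar>X \<omega> - a\<bar> \<le> 0 + e" if e: "e > 0" for e :: real
    proof -
      obtain k where k: "1 / real (Suc k) < e" using nat_approx_posE[OF e] by blast
      have "X \<omega> \<le> a + 1 / real (Suc k)" "a - 1 / real (Suc k) < X \<omega>" using elim by (auto simp: not_le)
      then show ?thesis using k by linarith
    qed
    then have "\<bar>X \<omega> - a\<bar> \<le> 0" by (rule field_le_epsilon)
    then show ?case by simp
  qed
  then show ?thesis by (rule that)
qed

text \<open>Reflection in the diagonal preserves the positive directions, hence the signs, and
  exchanges horizontal and vertical edges.\<close>

definition transpose_index :: "vertex \<times> bool \<Rightarrow> vertex \<times> bool" where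
  "transpose_index e = (prod.swap (fst e), \<not> snd e)"

lemma adj_swap: "adj (prod.swap u) (prod.swap v) \<longleftrightarrow> adj u v"
  by (auto simp: adj_def)

lemma increment_swap: "adj u v \<Longrightarrow> increment w (prod.swap u) (prod.swap v) = increment (\<lambda>e. w (transpose_index e)) u v"
  using abs_sum_1_cases[of "fst u - fst v" "snd u - snd v"]
  unfolding adj_def increment_def transpose_index_def by (auto simp: add.commute)

lemma walk_sum_swap: "walk p \<Longrightarrow> walk_sum w (map prod.swap p) = walk_sum (\<lambda>e. w (transpose_index e)) p"
  by (induction p rule: induct_list012) (auto simp: increment_swap)

lemma bounded_walk_swap:
  assumes "bounded_walk (\<lambda>e. w (transpose_index e)) (prod.swap b) t p"
  shows "bounded_walk w b t (map prod.swap p)"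
proof -
  have p: "p \<noteq> [] \<longrightarrow> hd p = prod.swap b" "walk p" "distinct p" "\<And>i. \<bar>walk_sum (\<lambda>e. w (transpose_index e)) (take i p)\<bar> \<le> t"
    using assms unfolding bounded_walk_def by blast+
  have tk: "walk (take i p)" for i
    using p(2) append_take_drop_id[of i p] by (metis successively_append_iff)
  have "\<bar>walk_sum w (take i (map prod.swap p))\<bar> \<le> t" for i
    unfolding take_map walk_sum_swap[OF tk] by (rule p(4))
  moreover have "walk (map prod.swap p)" using p(2) by (simp add: successively_map adj_swap)
  moreover have "distinct (map prod.swap p)" using p(3) by (simp add: distinct_map)
  ultimately show ?thesis using p(1) unfolding bounded_walk_def by (auto simp: hd_map)
qed

text \<open>Steps to the right alternate with vertical steps in the direction
  \<open>s\<close>.\<close>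

definition staircase :: "vertex \<Rightarrow> int \<Rightarrow> nat \<Rightarrow> vertex" where
  "staircase b s k = b + (int ((k + 1) div 2), s * int (k div 2))"

text \<open>If all horizontal weights equal \<open>a\<close> and all vertical ones equal
  \<open>\<plusminus>a\<close>, the direction of the vertical steps can be chosen such that each
  cancels the preceding step to the right.\<close>

lemma staircase_bounded_walk:
  assumes s: "s = 1 \<or> s = -1" and w: "\<And>z. w (z, True) = a" "\<And>z. w (z, False) = - of_int s * a"
  shows "bounded_walk w b \<bar>a\<bar> (map (staircase b s) [0..<m])"
proof -
  have step: "adj (staircase b s k) (staircase b s (Suc k)) \<and>
      increment w (staircase b s k) (staircase b s (Suc k)) = (if even k then a else - a)" for k
  proof (cases "even k")
    case True
    then obtain l where "k = 2 * l" by blast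
    then show ?thesis using w by (auto simp: staircase_def adj_def increment_def)
  next
    case False
    then obtain l where "k = 2 * l + 1" by (rule oddE)
    then show ?thesis using s w by (auto simp: staircase_def adj_def increment_def)
  qed
  have walk_sum: "walk_sum w (map (staircase b s) [0..<Suc N]) = (if even N then 0 else a)" for N
  proof (induction N)
    case (Suc N)
    have "walk_sum w (map (staircase b s) [0..<Suc (Suc N)]) =
        walk_sum w (map (staircase b s) [0..<Suc N] @ [staircase b s (Suc N)])" by simp
    also have "\<dots> = walk_sum w (map (staircase b s) [0..<Suc N]) + increment w (staircase b s N) (staircase b s (Suc N))"
      by (subst walk_sum_append) (auto simp: last_map)
    finally show ?case unfolding Suc using step[of N] by simp
  qed simp
  have "\<bar>walk_sum w (take i (map (staircase b s) [0..<m]))\<bar> \<le> \<bar>a\<bar>" for i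
  proof -
    have "take i (map (staircase b s) [0..<m]) = map (staircase b s) [0..<min i m]" by (rule nth_equalityI) auto
    then show ?thesis using walk_sum[of "min i m - 1"] by (cases "min i m") auto
  qed
  moreover have "inj (staircase b s)"
  proof (rule injI)
    fix k l assume eq: "staircase b s k = staircase b s l"
    then have 1: "(k + 1) div 2 = (l + 1) div 2" by (simp add: staircase_def)
    have "s * int (k div 2) = s * int (l div 2)" using eq by (simp add: staircase_def)
    then have "k div 2 = l div 2" using s by auto
    then show "k = l" using 1 by presburger
  qed
  then have "distinct (map (staircase b s) [0..<m])" by (auto simp: distinct_map intro: inj_on_subset)
  ultimately show ?thesis unfolding bounded_walk_def walk_map_upt using step
    by (auto simp: hd_map staircase_def zero_prod_def[symmetric])
qed

section \<open>The random environment\<close>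

lemma inj_edge_at: "inj edge_at"
  unfolding inj_def edge_at_def by (auto simp: doubleton_eq_iff prod_eq_iff split: if_splits)

lemma horizontal_edge_at: "horizontal (edge_at (z, True))"
proof -
  have "\<exists>x1 y1 x2 y2. edge_at (z, True) = {(x1, y1), (x2, y2)} \<and> \<bar>x1 - x2\<bar> = (1::int)"
    by (rule exI[of _ "fst z"], rule exI[of _ "snd z"], rule exI[of _ "fst z + 1"], rule exI[of _ "snd z"])
      (simp add: edge_at_def plus_prod_def)
  then show ?thesis unfolding horizontal_def using edge_at_E2 by blast
qed

lemma vertical_edge_at: "vertical (edge_at (z, False))"
proof -
  have "\<exists>x1 y1 x2 y2. edge_at (z, False) = {(x1, y1), (x2, y2)} \<and> \<bar>y1 - y2\<bar> = (1::int)"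
    by (rule exI[of _ "fst z"], rule exI[of _ "snd z"], rule exI[of _ "fst z"], rule exI[of _ "snd z + 1"])
      (simp add: edge_at_def plus_prod_def)
  then show ?thesis unfolding vertical_def using edge_at_E2 by blast
qed

context random_environment begin

text \<open>The weight collected when \<open>e\<close> is crossed in a positive direction.\<close>

definition V :: "edge \<Rightarrow> 'w \<Rightarrow> real" where "V e \<omega> = Y e \<omega> * X e \<omega>"

lemma X_rv: "e \<in> E2 \<Longrightarrow> random_variable borel (X e)"
  using X_indep unfolding indep_vars_def2 by blast

lemma Y_rv: "e \<in> E2 \<Longrightarrow> random_variable (count_space {-1, 1}) (Y e)"
  using Y_indep unfolding indep_vars_def2 by blast

lemma Y_values: "e \<in> E2 \<Longrightarrow> \<omega> \<in> space M \<Longrightarrow> Y e \<omega> = -1 \<or> Y e \<omega> = 1"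
  using measurable_space[OF Y_rv] by fastforce

text \<open>The three independence assumptions combined into one product formula.\<close>

lemma joint_prob:
  assumes J: "J \<noteq> {}" "finite J" "J \<subseteq> E2"
    and A: "\<And>j. j \<in> J \<Longrightarrow> A j \<in> sets borel" and B: "\<And>j. j \<in> J \<Longrightarrow> B j \<subseteq> {-1, 1}"
  shows "prob (\<Inter>j\<in>J. (X j -` A j \<inter> space M) \<inter> (Y j -` B j \<inter> space M)) =
    (\<Prod>j\<in>J. prob (X j -` A j \<inter> space M) * prob (Y j -` B j \<inter> space M))"
proof -
  let ?P = "\<Pi>\<^sub>M e\<in>E2. (borel :: real measure)" and ?Q = "\<Pi>\<^sub>M e\<in>E2. count_space {-1, 1 :: real}"
  define SA where "SA = {x \<in> space ?P. \<forall>j\<in>J. x j \<in> A j}"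
  define SB where "SB = {y \<in> space ?Q. \<forall>j\<in>J. y j \<in> B j}"
  have SA: "SA \<in> sets ?P" unfolding SA_def
  proof (rule sets.sets_Collect_finite_All[OF _ J(2)])
    fix j assume j: "j \<in> J"
    then have "(\<lambda>x. x j) \<in> ?P \<rightarrow>\<^sub>M borel" using J(3) by (intro measurable_component_singleton) auto
    from measurable_sets[OF this A[OF j]] show "{x \<in> space ?P. x j \<in> A j} \<in> sets ?P"
      by (simp add: vimage_def Int_def conj_commute)
  qed
  have SB: "SB \<in> sets ?Q" unfolding SB_def
  proof (rule sets.sets_Collect_finite_All[OF _ J(2)])
    fix j assume j: "j \<in> J"
    then have "(\<lambda>x. x j) \<in> ?Q \<rightarrow>\<^sub>M count_space {-1, 1}" using J(3) by (intro measurable_component_singleton) auto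
    moreover have "B j \<in> sets (count_space {-1, 1})" using B[OF j] by simp
    ultimately have "(\<lambda>x. x j) -` B j \<inter> space ?Q \<in> sets ?Q" by (rule measurable_sets)
    then show "{x \<in> space ?Q. x j \<in> B j} \<in> sets ?Q"
      by (simp add: vimage_def Int_def conj_commute)
  qed
  let ?X = "\<lambda>\<omega>. \<lambda>e\<in>E2. X e \<omega>" and ?Y = "\<lambda>\<omega>. \<lambda>e\<in>E2. Y e \<omega>"
  have spX: "?X \<omega> \<in> space ?P" for \<omega> by (simp add: space_PiM)
  have spY: "?Y \<omega> \<in> space ?Q" if "\<omega> \<in> space M" for \<omega>
    using Y_values[OF _ that] by (auto simp: space_PiM)
  have eX: "?X -` SA \<inter> space M = (\<Inter>j\<in>J. X j -` A j \<inter> space M)"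
    using J spX unfolding SA_def by (auto simp: subset_iff)
  have eY: "?Y -` SB \<inter> space M = (\<Inter>j\<in>J. Y j -` B j \<inter> space M)"
    using J spY unfolding SB_def by (auto simp: subset_iff)
  have "(\<Inter>j\<in>J. (X j -` A j \<inter> space M) \<inter> (Y j -` B j \<inter> space M)) = (\<lambda>\<omega>. (?X \<omega>, ?Y \<omega>)) -` (SA \<times> SB) \<inter> space M"
  proof -
    have "(\<lambda>\<omega>. (?X \<omega>, ?Y \<omega>)) -` (SA \<times> SB) \<inter> space M = (?X -` SA \<inter> space M) \<inter> (?Y -` SB \<inter> space M)" by auto
    then show ?thesis unfolding eX eY by auto
  qed
  then have "prob (\<Inter>j\<in>J. (X j -` A j \<inter> space M) \<inter> (Y j -` B j \<inter> space M)) =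
      prob (?X -` SA \<inter> space M) * prob (?Y -` SB \<inter> space M)"
    using indep_varD[OF X_Y_indep SA SB] by simp
  also have "\<dots> = (\<Prod>j\<in>J. prob (X j -` A j \<inter> space M)) * (\<Prod>j\<in>J. prob (Y j -` B j \<inter> space M))"
    unfolding eX eY using indep_varsD[OF X_indep J A] indep_varsD[OF Y_indep J, of B] B by simp
  finally show ?thesis by (simp add: prod.distrib)
qed

lemma joint_prob1:
  assumes "e \<in> E2" "A \<in> sets borel" "B \<subseteq> {-1, 1}"
  shows "prob ((X e -` A \<inter> space M) \<inter> (Y e -` B \<inter> space M)) = prob (X e -` A \<inter> space M) * prob (Y e -` B \<inter> space M)"
  using joint_prob[of "{e}" "\<lambda>_. A" "\<lambda>_. B"] assms by simp

lemma V_vimage: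
  assumes e: "e \<in> E2"
  shows "V e -` Q \<inter> space M = ((X e -` Q \<inter> space M) \<inter> (Y e -` {1} \<inter> space M)) \<union>
    ((X e -` (uminus -` Q) \<inter> space M) \<inter> (Y e -` {-1} \<inter> space M))"
proof -
  have "V e \<omega> \<in> Q \<longleftrightarrow> (X e \<omega> \<in> Q \<and> Y e \<omega> = 1) \<or> (- X e \<omega> \<in> Q \<and> Y e \<omega> = -1)" if "\<omega> \<in> space M" for \<omega>
    using Y_values[OF e that] by (auto simp: V_def)
  then show ?thesis by auto
qed

lemma uminus_vimage_borel: "Q \<in> sets borel \<Longrightarrow> uminus -` Q \<in> sets (borel :: real measure)"
  using measurable_sets[of uminus borel borel Q] by simp

lemma XY_sets:
  assumes "e \<in> E2" "A \<in> sets borel" "B \<subseteq> {-1, 1}"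
  shows "(X e -` A \<inter> space M) \<inter> (Y e -` B \<inter> space M) \<in> events"
  using measurable_sets[OF X_rv[OF assms(1)] assms(2)] measurable_sets[OF Y_rv[OF assms(1)], of B] assms(3)
  by simp

text \<open>The rectangles \<open>{X\<^sub>e \<in> A, Y\<^sub>e \<in> B}\<close> form independent
  intersection-stable systems by \<open>joint_prob\<close>, and the generated sigma-algebras make
  the products measurable.\<close>

lemma V_indep: "indep_vars (\<lambda>_. borel) V E2"
proof -
  define G where "G e = {(X e -` A \<inter> space M) \<inter> (Y e -` B \<inter> space M) | A B. A \<in> sets borel \<and> B \<subseteq> {-1, 1}}" for e
  have "indep_sets G E2"
  proof (rule indep_setsI)
    show "G e \<subseteq> events" if "e \<in> E2" for e using XY_sets[OF that] unfolding G_def by blast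
    fix C J assume J: "J \<noteq> {}" "J \<subseteq> E2" "finite J" and C: "\<forall>j\<in>J. C j \<in> G j"
    have "\<forall>j\<in>J. \<exists>A B. C j = (X j -` A \<inter> space M) \<inter> (Y j -` B \<inter> space M) \<and> A \<in> sets borel \<and> B \<subseteq> {-1, 1}"
      using C unfolding G_def by blast
    then obtain A B where AB: "\<And>j. j \<in> J \<Longrightarrow> C j = (X j -` A j \<inter> space M) \<inter> (Y j -` B j \<inter> space M)"
      "\<And>j. j \<in> J \<Longrightarrow> A j \<in> sets borel" "\<And>j. j \<in> J \<Longrightarrow> B j \<subseteq> {-1, 1}" by metis
    have "(\<Inter>j\<in>J. C j) = (\<Inter>j\<in>J. (X j -` A j \<inter> space M) \<inter> (Y j -` B j \<inter> space M))" using AB(1) by auto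
    then have "prob (\<Inter>j\<in>J. C j) = (\<Prod>j\<in>J. prob (X j -` A j \<inter> space M) * prob (Y j -` B j \<inter> space M))"
      using joint_prob[OF J(1,3,2) AB(2,3)] by simp
    also have "\<dots> = (\<Prod>j\<in>J. prob (C j))"
      by (rule prod.cong) (use J AB joint_prob1 in auto)
    finally show "prob (\<Inter>j\<in>J. C j) = (\<Prod>j\<in>J. prob (C j))" .
  qed
  moreover have "Int_stable (G e)" for e
  proof (rule Int_stableI)
    fix a b assume "a \<in> G e" "b \<in> G e"
    then obtain A B A' B' where "a = (X e -` A \<inter> space M) \<inter> (Y e -` B \<inter> space M)" "A \<in> sets borel" "B \<subseteq> {-1, 1}"
      "b = (X e -` A' \<inter> space M) \<inter> (Y e -` B' \<inter> space M)" "A' \<in> sets borel" "B' \<subseteq> {-1, 1}"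
      unfolding G_def by blast
    then have "a \<inter> b = (X e -` (A \<inter> A') \<inter> space M) \<inter> (Y e -` (B \<inter> B') \<inter> space M)" "A \<inter> A' \<in> sets borel" "B \<inter> B' \<subseteq> {-1, 1}"
      by auto
    then show "a \<inter> b \<in> G e" unfolding G_def by blast
  qed
  ultimately have indep_sigma: "indep_sets (\<lambda>e. sigma_sets (space M) (G e)) E2" by (rule indep_sets_sigma)
  have V: "V e -` Q \<inter> space M \<in> sigma_sets (space M) (G e)" if e: "e \<in> E2" and Q: "Q \<in> sets borel" for e Q
  proof -
    have "(X e -` Q \<inter> space M) \<inter> (Y e -` {1} \<inter> space M) \<in> G e" unfolding G_def using Q by blast
    moreover have "(X e -` (uminus -` Q) \<inter> space M) \<inter> (Y e -` {-1} \<inter> space M) \<in> G e"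
      unfolding G_def using uminus_vimage_borel[OF Q] by blast
    ultimately show ?thesis unfolding V_vimage[OF e] by (intro sigma_sets_Un sigma_sets.Basic)
  qed
  have "indep_sets (\<lambda>e. {V e -` Q \<inter> space M | Q. Q \<in> sets borel}) E2"
    by (rule indep_sets_mono_sets[OF indep_sigma]) (use V in blast)
  moreover have "random_variable borel (V e)" if e: "e \<in> E2" for e
  proof (rule measurableI)
    fix Q :: "real set" assume Q: "Q \<in> sets borel"
    show "V e -` Q \<inter> space M \<in> events"
      unfolding V_vimage[OF e] using XY_sets[OF e] Q uminus_vimage_borel[OF Q] by (intro sets.Un) auto
  qed simp
  ultimately show ?thesis unfolding indep_vars_def2 by blast
qed

lemma V_rv: "e \<in> E2 \<Longrightarrow> random_variable borel (V e)"
  using V_indep unfolding indep_vars_def2 by blast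

text \<open>The law of \<open>Y\<^sub>e X\<^sub>e\<close> is the mixture of \<open>L\<close> and
  its reflection with weights \<open>p\<close> and \<open>1 - p\<close>.\<close>

lemma V_law_eq:
  assumes e: "e \<in> E2" "e' \<in> E2"
    and p: "prob {\<omega> \<in> space M. Y e \<omega> = 1} = p" "prob {\<omega> \<in> space M. Y e' \<omega> = 1} = p"
  shows "distr M borel (V e) = distr M borel (V e')"
proof (rule measure_eqI)
  fix Q :: "real set" assume "Q \<in> sets (distr M borel (V e))"
  then have Q: "Q \<in> sets borel" by simp
  have "prob (V f -` Q \<inter> space M) = measure L Q * p + measure L (uminus -` Q) * (1 - p)"
    if f: "f \<in> E2" and pf: "prob {\<omega> \<in> space M. Y f \<omega> = 1} = p" for f
  proof -
    have X: "prob (X f -` A \<inter> space M) = measure L A" if "A \<in> sets borel" for A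
      using measure_distr[OF X_rv[OF f] that] X_law[OF f] by simp
    have Y1: "prob (Y f -` {1} \<inter> space M) = p"
      using pf by (simp add: vimage_def Int_def conj_commute)
    have Y1e: "Y f -` {1} \<inter> space M \<in> events" using measurable_sets[OF Y_rv[OF f], of "{1}"] by simp
    have "Y f -` {-1} \<inter> space M = space M - (Y f -` {1} \<inter> space M)" using Y_values[OF f] by fastforce
    then have Y2: "prob (Y f -` {-1} \<inter> space M) = 1 - p" using prob_compl[OF Y1e] Y1 by simp
    show ?thesis unfolding V_vimage[OF f]
      using f Q uminus_vimage_borel[OF Q] XY_sets[OF f]
      by (subst finite_measure_Union) (auto simp: joint_prob1 X Y1 Y2)
  qed
  from this[OF e(1) p(1)] this[OF e(2) p(2)]
  have "prob (V e -` Q \<inter> space M) = prob (V e' -` Q \<inter> space M)" by simp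
  then show "emeasure (distr M borel (V e)) Q = emeasure (distr M borel (V e')) Q"
    using Q V_rv e by (simp add: emeasure_distr emeasure_eq_measure)
qed simp

text \<open>Signs do not affect absolute values; this makes costs of horizontal and vertical edges
  comparable even if \<open>p_o \<noteq> p_v\<close>.\<close>

lemma V_abs_law:
  assumes "e \<in> E2"
  shows "distr M borel (\<lambda>\<omega>. \<bar>V e \<omega>\<bar>) = distr L borel abs"
proof -
  have "distr M borel (\<lambda>\<omega>. \<bar>V e \<omega>\<bar>) = distr M borel (abs \<circ> X e)"
  proof (rule distr_cong)
    show "\<bar>V e \<omega>\<bar> = (abs \<circ> X e) \<omega>" if "\<omega> \<in> space M" for \<omega>
      using Y_values[OF assms that] by (auto simp: V_def)
  qed simp_all
  also have "\<dots> = distr (distr M borel (X e)) borel abs"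
    by (rule distr_distr[symmetric]) (use X_rv[OF assms] in auto)
  finally show ?thesis using X_law[OF assms] by simp
qed

text \<open>The map \<open>f\<close> is \<open>edge_at\<close> or its composition with the
  reflection in the diagonal.\<close>

lemma lattice_field:
  fixes f :: "vertex \<times> bool \<Rightarrow> edge"
  assumes f: "inj f" "range f \<subseteq> E2" and p: "\<And>z. prob {\<omega> \<in> space M. Y (f (z, True)) \<omega> = 1} = p"
    and t: "0 < prob {\<omega> \<in> space M. V (f ((0, 0), True)) \<omega> \<le> t}" "prob {\<omega> \<in> space M. V (f ((0, 0), True)) \<omega> \<le> t} < 1"
  shows "lattice_field M (\<lambda>i. V (f i)) (distr M borel (V (f ((0, 0), True))))"
proof
  have fE: "f i \<in> E2" for i using f by blast
  show "indep_vars (\<lambda>_. borel) (\<lambda>i. V (f i)) UNIV"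
    by (rule indep_vars_reindex[OF f(1) indep_vars_subset[OF V_indep f(2)]])
  show "distr M borel (V (f (z, True))) = distr M borel (V (f ((0, 0), True)))" for z
    by (rule V_law_eq[OF fE fE p p])
  let ?\<mu> = "distr M borel (V (f ((0, 0), True)))"
  show "distr M borel (\<lambda>\<omega>. \<bar>V (f e) \<omega>\<bar>) = distr ?\<mu> borel abs" for e
  proof -
    have "distr ?\<mu> borel abs = distr M borel (abs \<circ> V (f ((0, 0), True)))"
      by (rule distr_distr) (use V_rv[OF fE] in auto)
    then show ?thesis using V_abs_law[OF fE, of e] V_abs_law[OF fE, of "((0, 0), True)"] by (simp add: comp_def)
  qed
  have "measure ?\<mu> {..t} = prob {\<omega> \<in> space M. V (f ((0, 0), True)) \<omega> \<le> t}"
    by (subst measure_distr) (use V_rv[OF fE] in \<open>auto intro!: arg_cong[where f = prob]\<close>)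
  then show "\<exists>t. 0 < measure ?\<mu> {..t} \<and> measure ?\<mu> {..t} < 1"
    using t by (intro exI[of _ t]) simp
qed

lemma signed_weight_eq_V: "signed_weight (\<lambda>e. X e \<omega>) (\<lambda>e. Y e \<omega>) i = V (edge_at i) \<omega>"
  by (simp add: signed_weight_def V_def)

text \<open>Membership in \<open>A\<close> implies \<open>\<Sigma> \<le> t\<close>, which is an
  event.\<close>

lemma M_c_finite_if:
  assumes A: "A \<in> events" "prob A > 0" and t: "t > 0"
    and walk: "\<And>\<omega> m. \<omega> \<in> A \<Longrightarrow> \<exists>p. bounded_walk (\<lambda>i. V (edge_at i) \<omega>) b t p \<and> length p \<ge> m"
  shows "M_c M X Y b < \<infinity>"
proof -
  let ?E = "{\<omega> \<in> space M. \<Sigma> (\<lambda>e. X e \<omega>) (\<lambda>e. Y e \<omega>) b \<le> ennreal t}"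
  have rv: "(\<lambda>\<omega>. signed_weight (\<lambda>e. X e \<omega>) (\<lambda>e. Y e \<omega>) i) \<in> borel_measurable M" for i
    unfolding signed_weight_eq_V using V_rv[OF edge_at_E2] by simp
  have "?E \<in> events" by (rule Sigma_le_measurable[OF less_imp_le[OF t] rv])
  moreover have "A \<subseteq> ?E"
  proof
    fix \<omega> assume \<omega>: "\<omega> \<in> A"
    have "\<exists>p. bounded_walk (signed_weight (\<lambda>e. X e \<omega>) (\<lambda>e. Y e \<omega>)) b t p \<and> length p = m" for m
    proof -
      obtain p where p: "bounded_walk (signed_weight (\<lambda>e. X e \<omega>) (\<lambda>e. Y e \<omega>)) b t p" "length p \<ge> m"
        using walk[OF \<omega>, of m] unfolding signed_weight_eq_V[abs_def] by blast
      have "bounded_walk (signed_weight (\<lambda>e. X e \<omega>) (\<lambda>e. Y e \<omega>)) b t (take m p)"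
        by (rule bounded_walk_prefix[where q = "drop m p"]) (simp add: p(1))
      then show ?thesis using p(2) by (intro exI[of _ "take m p"]) simp
    qed
    then show "\<omega> \<in> ?E" using \<omega> sets.sets_into_space[OF A(1)] Sigma_le_if[OF less_imp_le[OF t]] by blast
  qed
  ultimately have "prob ?E > 0" using A(2) finite_measure_mono[of A ?E] by linarith
  then have "ennreal t \<in> {ennreal t | t. t > 0 \<and> prob {\<omega> \<in> space M. \<Sigma> (\<lambda>e. X e \<omega>) (\<lambda>e. Y e \<omega>) b \<le> ennreal t} > 0}"
    using t by blast
  then have "M_c M X Y b \<le> ennreal t" unfolding M_c_def by (rule Inf_lower)
  then show ?thesis using le_less_trans by fastforce
qed

text \<open>If the horizontal and the vertical weights are both almost surely constant, a
  staircase is bounded. Otherwise the general construction applies, possibly to the reflected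
  lattice.\<close>

lemma M_c_finite: "M_c M X Y b < \<infinity>"
proof -
  define h where "h = edge_at ((0, 0), True)"
  define v where "v = edge_at ((0, 0), False)"
  have E2: "h \<in> E2" "v \<in> E2" unfolding h_def v_def by (rule edge_at_E2)+
  have ph: "prob {\<omega> \<in> space M. Y (edge_at (z, True)) \<omega> = 1} = p_o" for z
    by (rule Y_horizontal[OF horizontal_edge_at])
  have pv: "prob {\<omega> \<in> space M. Y (edge_at (z, False)) \<omega> = 1} = p_v" for z
    by (rule Y_vertical[OF vertical_edge_at])
  consider t where "0 < prob {\<omega> \<in> space M. V h \<omega> \<le> t}" "prob {\<omega> \<in> space M. V h \<omega> \<le> t} < 1"
    | t where "0 < prob {\<omega> \<in> space M. V v \<omega> \<le> t}" "prob {\<omega> \<in> space M. V v \<omega> \<le> t} < 1"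
    | "\<And>t. prob {\<omega> \<in> space M. V h \<omega> \<le> t} = 0 \<or> prob {\<omega> \<in> space M. V h \<omega> \<le> t} = 1"
      "\<And>t. prob {\<omega> \<in> space M. V v \<omega> \<le> t} = 0 \<or> prob {\<omega> \<in> space M. V v \<omega> \<le> t} = 1"
  proof -
    define F where "F g t = prob {\<omega> \<in> space M. V g \<omega> \<le> t}" for g t
    have "F g t = 0 \<or> F g t = 1 \<or> (0 < F g t \<and> F g t < 1)" for g t
      using measure_nonneg[of M] prob_le_1 unfolding F_def by (metis less_le)
    then show ?thesis using that unfolding F_def[symmetric] by blast
  qed
  then show ?thesis
  proof cases
    case (1 t)
    interpret F: lattice_field M "\<lambda>i. V (edge_at i)" "distr M borel (V (edge_at ((0, 0), True)))"
      by (rule lattice_field[OF inj_edge_at _ ph, of t]) (use 1 edge_at_E2 in \<open>auto simp: h_def\<close>)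
    obtain A t where A: "A \<in> events" "prob A > 0" "t > 0" and P: "\<And>\<omega> m. \<omega> \<in> A \<Longrightarrow>
      \<exists>P. P \<noteq> [] \<and> hd P = b \<and> walk P \<and> distinct P \<and> length P \<ge> m \<and> (\<forall>i. \<bar>walk_sum (\<lambda>e. V (edge_at e) \<omega>) (take i P)\<bar> \<le> t)"
      using F.bounded_paths_positive_prob[of b] by blast
    show ?thesis
    proof (rule M_c_finite_if[OF A])
      fix \<omega> m assume "\<omega> \<in> A"
      then show "\<exists>p. bounded_walk (\<lambda>e. V (edge_at e) \<omega>) b t p \<and> length p \<ge> m"
        using P[of \<omega> m] unfolding bounded_walk_def by blast
    qed
  next
    case (2 t)
    define f where "f i = edge_at (transpose_index i)" for i
    have inj: "inj f"
      unfolding f_def by (rule inj_compose[OF inj_edge_at, unfolded comp_def])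
        (auto simp: inj_def transpose_index_def)
    have fT: "f (z, True) = edge_at (prod.swap z, False)" for z by (simp add: f_def transpose_index_def)
    interpret F: lattice_field M "\<lambda>i. V (f i)" "distr M borel (V (f ((0, 0), True)))"
      by (rule lattice_field[OF inj, of p_v t]) (use 2 edge_at_E2 pv in \<open>auto simp: fT v_def f_def[symmetric]\<close>, simp add: f_def edge_at_E2)
    obtain A t where A: "A \<in> events" "prob A > 0" "t > 0" and P: "\<And>\<omega> m. \<omega> \<in> A \<Longrightarrow>
      \<exists>P. P \<noteq> [] \<and> hd P = prod.swap b \<and> walk P \<and> distinct P \<and> length P \<ge> m \<and> (\<forall>i. \<bar>walk_sum (\<lambda>e. V (f e) \<omega>) (take i P)\<bar> \<le> t)"
      using F.bounded_paths_positive_prob[of "prod.swap b"] by blast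
    show ?thesis
    proof (rule M_c_finite_if[OF A])
      fix \<omega> m assume "\<omega> \<in> A"
      then obtain p where p: "hd p = prod.swap b" "walk p" "distinct p" "length p \<ge> m"
        "\<And>i. \<bar>walk_sum (\<lambda>e. V (f e) \<omega>) (take i p)\<bar> \<le> t" using P[of \<omega> m] by blast
      then have "bounded_walk (\<lambda>e. V (edge_at (transpose_index e)) \<omega>) (prod.swap b) t p"
        by (simp add: bounded_walk_def f_def)
      then have "bounded_walk (\<lambda>e. V (edge_at e) \<omega>) b t (map prod.swap p)" by (rule bounded_walk_swap)
      then show "\<exists>p. bounded_walk (\<lambda>e. V (edge_at e) \<omega>) b t p \<and> length p \<ge> m"
        using p(4) by (intro exI[of _ "map prod.swap p"]) simp
    qed
  next
    case 3
    obtain a where a: "AE \<omega> in M. V h \<omega> = a" using constant_of_trivial_cdf[OF V_rv[OF E2(1)] 3(1)] by blast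
    obtain a' where a': "AE \<omega> in M. V v \<omega> = a'" using constant_of_trivial_cdf[OF V_rv[OF E2(2)] 3(2)] by blast
    have AE_law: "AE \<omega> in M. P (g' \<omega>)"
      if "AE \<omega> in M. P (g \<omega>)" "distr M borel g = distr M borel g'" "g \<in> borel_measurable M" "g' \<in> borel_measurable M" "{x. P x} \<in> sets borel"
      for P :: "real \<Rightarrow> bool" and g g'
    proof -
      have "AE x in distr M borel g. P x" using that by (subst AE_distr_iff) auto
      then have "AE x in distr M borel g'. P x" by (rule subst[where P = "\<lambda>N. AE x in N. P x", OF that(2)])
      then show ?thesis using that by (subst (asm) AE_distr_iff) auto
    qed
    have H: "AE \<omega> in M. V (edge_at (z, True)) \<omega> = a" for z
    proof -
      have "distr M borel (V h) = distr M borel (V (edge_at (z, True)))"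
        unfolding h_def by (rule V_law_eq[OF edge_at_E2 edge_at_E2 ph ph])
      from AE_law[OF a this V_rv[OF E2(1)] V_rv[OF edge_at_E2]] show ?thesis by simp
    qed
    have Ve: "AE \<omega> in M. V (edge_at (z, False)) \<omega> = a'" for z
    proof -
      have "distr M borel (V v) = distr M borel (V (edge_at (z, False)))"
        unfolding v_def by (rule V_law_eq[OF edge_at_E2 edge_at_E2 pv pv])
      from AE_law[OF a' this V_rv[OF E2(2)] V_rv[OF edge_at_E2]] show ?thesis by simp
    qed
    \<comment> \<open>All \<open>\<bar>V e\<bar>\<close> have the same law, so the two constants
      agree up to sign.\<close>
    have "AE \<omega> in M. \<bar>V h \<omega>\<bar> = \<bar>a\<bar>" using a by eventually_elim simp
    moreover have "distr M borel (\<lambda>\<omega>. \<bar>V h \<omega>\<bar>) = distr M borel (\<lambda>\<omega>. \<bar>V v \<omega>\<bar>)"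
      using V_abs_law[OF E2(1)] V_abs_law[OF E2(2)] by simp
    ultimately have "AE \<omega> in M. \<bar>V v \<omega>\<bar> = \<bar>a\<bar>"
      using AE_law[of "\<lambda>x. x = \<bar>a\<bar>" "\<lambda>\<omega>. \<bar>V h \<omega>\<bar>" "\<lambda>\<omega>. \<bar>V v \<omega>\<bar>"] V_rv[OF E2(1)] V_rv[OF E2(2)] by simp
    then have "AE \<omega> in M. \<bar>a'\<bar> = \<bar>a\<bar>" using a' by eventually_elim simp
    then have abs_eq: "\<bar>a'\<bar> = \<bar>a\<bar>" by (simp add: AE_const)
    define s :: int where "s = (if a' = a then -1 else 1)"
    have s: "s = 1 \<or> s = -1" "a' = - of_int s * a" using abs_eq by (auto simp: s_def)
    define A where "A = {\<omega> \<in> space M. (\<forall>z. V (edge_at (z, True)) \<omega> = a) \<and> (\<forall>z. V (edge_at (z, False)) \<omega> = a')}"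
    have "AE \<omega> in M. (\<forall>z. V (edge_at (z, True)) \<omega> = a) \<and> (\<forall>z. V (edge_at (z, False)) \<omega> = a')"
      using H Ve by (simp add: AE_all_countable)
    moreover have Aev: "A \<in> events"
    proof -
      have [measurable]: "random_variable borel (V (edge_at e))" for e by (rule V_rv[OF edge_at_E2])
      show ?thesis unfolding A_def by measurable
    qed
    ultimately have "prob A = 1" by (subst prob_eq_1) (auto simp: A_def)
    then show ?thesis
    \<comment> \<open>The summand 1 makes the bound positive when \<open>a = 0\<close>.\<close>
    proof (intro M_c_finite_if[OF Aev, of "\<bar>a\<bar> + 1"])
      fix \<omega> m assume "\<omega> \<in> A"
      then have "bounded_walk (\<lambda>i. V (edge_at i) \<omega>) b \<bar>a\<bar> (map (staircase b s) [0..<m])"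
        using s by (intro staircase_bounded_walk) (auto simp: A_def)
      then have "bounded_walk (\<lambda>i. V (edge_at i) \<omega>) b (\<bar>a\<bar> + 1) (map (staircase b s) [0..<m])"
        unfolding bounded_walk_def by (meson add_increasing2 order_trans order_refl zero_le_one)
      then show "\<exists>p. bounded_walk (\<lambda>i. V (edge_at i) \<omega>) b (\<bar>a\<bar> + 1) p \<and> length p \<ge> m"
        by (intro exI[of _ "map (staircase b s) [0..<m]"]) simp
    qed auto
  qed
qed

end

theorem theorem1:
  fixes p_o p_v :: real and L :: "real measure"
    and M :: "'w measure" and X Y :: "edge \<Rightarrow> 'w \<Rightarrow> real" and b :: vertex
  assumes "p_o \<in> {0..1}" and "p_v \<in> {0..1}"
    and "prob_space L" and "sets L = sets borel" and "L \<noteq> return borel 0"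
    and "random_environment M p_o p_v L X Y"
  shows "M_c M X Y b < \<infinity>"
  by (rule random_environment.M_c_finite[OF assms(6)])

end
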